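(* Let $k$ be a positive even integer and $d_k=\dim S_k(1)$. Then $$T_{2,k}(x)\equiv\prod_{j=1}^{d_k}(x-a_j)\pmod{13},$$ where $(a_j)_{j\ge1}$ is a sequence of period $14$ depending only on $k\bmod12$, whose first $14$ terms $(a_1,\dots,a_{14})$ are: - $k\equiv0\pmod{12}$: $(2,12,9,4,1,11,5,11,1,4,9,12,2,8)$; - $k\equiv2\pmod{12}$: $(4,11,5,8,2,9,10,9,2,8,5,11,4,3)$; - $k\equiv4\pmod{12}$: $(8,6,8,9,10,3,4,5,7,5,4,3,10,9)$; - $k\equiv6\pmod{12}$: $(5,3,12,3,5,7,6,8,10,1,10,8,6,7)$; - $k\equiv8\pmod{12}$: $(1,10,6,11,6,10,1,12,3,7,2,7,3,12)$; - $k\equiv10\pmod{12}$: $(11,2,7,12,9,12,7,2,11,6,1,4,1,6)$.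
   Context: $S_k(1)$ denotes the complex vector space of holomorphic cusp forms of weight $k$ for $SL_2(\mathbb{Z})$. The Hecke operator $T_n$ acts on $S_k(1)$ by $(T_nf)(z)=\frac1n\sum_{ad=n}a^k\sum_{0\le b<d}f\left(\frac{az+b}{d}\right)$, and $T_{n,k}(x)$ is the characteristic polynomial of $T_n$ acting on $S_k(1)$; it is monic with integer coefficients and degree $d_k=\dim S_k(1)$. Congruences of polynomials are coefficientwise. *)

theory Defs
  imports
    "HOL-Complex_Analysis.Complex_Analysis"
    "HOL-Library.Function_Algebras"
    "HOL-Number_Theory.Cong"
    "Jordan_Normal_Form.Char_Poly"
begin

section \<open>Level one cusp forms\<close>

definition upper_half_plane :: "complex set" where
  "upper_half_plane = {z. Im z > 0}"

text \<open>
  A function on the upper half plane is represented by its extension by zero to all complex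
  numbers, so that equality of functions is equality on the upper half plane.
  The last condition is the Fourier expansion at infinity; \<open>c 0 = 0\<close> is cuspidality.
\<close>

definition cusp_forms :: "nat \<Rightarrow> (complex \<Rightarrow> complex) set" where
  "cusp_forms k = {f.
     (\<forall>z. z \<notin> upper_half_plane \<longrightarrow> f z = 0) \<and>
     f holomorphic_on upper_half_plane \<and>
     (\<forall>(a::int) (b::int) (c::int) (d::int). a * d - b * c = 1 \<longrightarrow>
        (\<forall>z\<in>upper_half_plane.
           f ((of_int a * z + of_int b) / (of_int c * z + of_int d)) =
           (of_int c * z + of_int d) ^ k * f z)) \<and>
     (\<exists>c :: nat \<Rightarrow> complex. c 0 = 0 \<and>
        (\<forall>z\<in>upper_half_plane.
           (\<lambda>n. c n * exp (2 * of_real pi * \<i> * z) ^ n) sums f z))}"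


section \<open>Hecke operators\<close>

text \<open>
  No guard on \<open>z\<close> is needed: the maps \<open>z \<mapsto> (a * z + b) / d\<close> with \<open>a, d > 0\<close> preserve the
  upper half plane and its complement, so the result again vanishes off the upper half plane.
\<close>

definition hecke_operator ::
  "nat \<Rightarrow> nat \<Rightarrow> (complex \<Rightarrow> complex) \<Rightarrow> complex \<Rightarrow> complex" where
  "hecke_operator n k f = (\<lambda>z.
     1 / of_nat n *
     (\<Sum>(a, d)\<in>{(a, d). a * d = n}.
        of_nat a ^ k * (\<Sum>b<d. f ((of_nat a * z + of_nat b) / of_nat d))))"


section \<open>Characteristic polynomials of operators on spaces of functions\<close>

interpretation cfun: vector_space
  "\<lambda>(c::complex) (f::complex \<Rightarrow> complex) z. c * f z"
  by unfold_locales (auto simp: fun_eq_iff algebra_simps)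

definition is_basis_list ::
  "(complex \<Rightarrow> complex) list \<Rightarrow> (complex \<Rightarrow> complex) set \<Rightarrow> bool" where
  "is_basis_list bs V \<longleftrightarrow>
     distinct bs \<and> cfun.independent (set bs) \<and> cfun.span (set bs) = V"

definition operator_matrix ::
  "(complex \<Rightarrow> complex) list \<Rightarrow> ((complex \<Rightarrow> complex) \<Rightarrow> complex \<Rightarrow> complex) \<Rightarrow> complex mat" where
  "operator_matrix bs T =
     Matrix.mat (length bs) (length bs)
       (\<lambda>(i, j). cfun.representation (set bs) (T (bs ! j)) (bs ! i))"

text \<open>
  Meaningful for a finite-dimensional \<open>V\<close> mapped into itself by the linear operator \<open>T\<close>; the
  value then does not depend on the chosen basis.
\<close>

definition operator_char_poly ::
  "(complex \<Rightarrow> complex) set \<Rightarrow> ((complex \<Rightarrow> complex) \<Rightarrow> complex \<Rightarrow> complex) \<Rightarrow> complex poly" where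
  "operator_char_poly V T = char_poly (operator_matrix (SOME bs. is_basis_list bs V) T)"

definition hecke_char_poly :: "nat \<Rightarrow> nat \<Rightarrow> complex poly" where
  "hecke_char_poly n k = operator_char_poly (cusp_forms k) (hecke_operator n k)"

definition cusp_dim :: "nat \<Rightarrow> nat" where
  "cusp_dim k = cfun.dim (cusp_forms k)"


section \<open>Polynomial congruences and the root sequences\<close>

definition poly_cong :: "int poly \<Rightarrow> int poly \<Rightarrow> int \<Rightarrow> bool" where
  "poly_cong P Q m \<longleftrightarrow> (\<forall>i. [coeff P i = coeff Q i] (mod m))"

definition root_table :: "nat \<Rightarrow> int list" where
  "root_table r =
    (if r = 0 then [2, 12, 9, 4, 1, 11, 5, 11, 1, 4, 9, 12, 2, 8]
     else if r = 2 then [4, 11, 5, 8, 2, 9, 10, 9, 2, 8, 5, 11, 4, 3]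
     else if r = 4 then [8, 6, 8, 9, 10, 3, 4, 5, 7, 5, 4, 3, 10, 9]
     else if r = 6 then [5, 3, 12, 3, 5, 7, 6, 8, 10, 1, 10, 8, 6, 7]
     else if r = 8 then [1, 10, 6, 11, 6, 10, 1, 12, 3, 7, 2, 7, 3, 12]
     else if r = 10 then [11, 2, 7, 12, 9, 12, 7, 2, 11, 6, 1, 4, 1, 6]
     else [])"

text \<open>Indexed from \<open>j = 1\<close>; only even \<open>k\<close> is relevant.\<close>

definition root_seq :: "nat \<Rightarrow> nat \<Rightarrow> int" where
  "root_seq k j = root_table (k mod 12) ! ((j - 1) mod 14)"

end

(*
A form of level one is treated as its q-expansion, a power series F converging on the unit disc.
Let C = E4^3 - 5 Delta, which has integral coefficients and is congruent to 1 modulo 13, and let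
r be one of 0, 4, 6, 8, 10, 14, with E the form of weight r and constant term 1. The forms
Delta^j C^(d-j) E with 1 <= j <= d are an integral basis of the cusp forms of weight k = 12 d + r.
Since C is 1 modulo 13 and 2^(k-1) mod 13 depends only on k mod 12, the image of such a basis
form under T_2 is, modulo 13, the image of Delta^j E computed in weight 12 j + r, so the matrix
of T_2 is triangular modulo 13 and its j-th diagonal entry l_j depends only on r.

The three conjugates 2^12 Delta(2z), Delta(z/2), Delta((z+1)/2) are the roots of
  X^3 + 48 Delta X^2 + (763 Delta^2 - Delta C) X + 4096 Delta^3,
so T_2 (Delta^j E) satisfies a linear recurrence in j. Its leading coefficients are those of
l_(j+3) = - 48 l_(j+2) - 763 l_(j+1) - 4096 l_j, which has period 14 modulo 13.

The last coefficient of the cubic also shows that the zeros of Delta are closed under z -> 2z, so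
Delta has none and the valence bound follows from the maximum principle in weight 0. The weaker
bound needed to find the cubic comes from maximising |f(z)| (Im z)^(k/2).
*)
theory Submission
  imports Defs
begin

section \<open>Power series as functions on the upper half plane\<close>

text \<open>The Fourier coefficients of Eisenstein series are never computed from lattice sums.
  These sums only supply forms of weights 4 and 6 with constant term 1; up to weight 10 every form
  is a Hecke eigenform, and the Hecke relations for the two forms and for their products of weights
  8 and 10 determine all coefficients. The obstacle is a circle: a sharp valence bound needs that
  Delta has no zeros, which comes from the cubic, and the cubic is found by comparing coefficients.
  The weak bound k <= 10 m breaks it, because it already decides weights 12, 24 and 36 from 2, 3 and
  4 coefficients. The prime is 13 = 12 + 1, so that 2^12 is 1 modulo 13 and so is the Eisenstein
  series of weight 12. The latter is E4^3 - (720 - 65520/691) Delta; as 13 divides 65520 and 720 is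
  5 modulo 13, it reduces to the form C, which has no denominator.\<close>

definition nome :: "complex \<Rightarrow> complex" where
  "nome z = exp (2 * of_real pi * \<i> * z)"

definition qev :: "complex fps \<Rightarrow> complex \<Rightarrow> complex" where
  "qev F z = eval_fps F (nome z)"

text \<open>A q-expansion is already invariant under z -> z + 1 and regular at the cusp, so the
  inversion is the one generator of the modular group left to impose. Taking the series as the basic
  object keeps the coefficients, which carry the arithmetic, at hand.\<close>

definition modular_fps :: "nat \<Rightarrow> complex fps \<Rightarrow> bool" where
  "modular_fps k F \<longleftrightarrow> fps_conv_radius F \<ge> 1 \<and>
     (\<forall>z. Im z > 0 \<longrightarrow> qev F (- 1 / z) = z ^ k * qev F z)"

lemma norm_nome: "norm (nome z) = exp (- 2 * pi * Im z)"
  by (simp add: nome_def norm_exp_eq_Re)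

lemma norm_nome_less_1: "Im z > 0 \<Longrightarrow> norm (nome z) < 1"
  by (simp add: norm_nome)

lemma nome_nonzero [simp]: "nome z \<noteq> 0"
  by (simp add: nome_def)

lemma nome_add: "nome (z + w) = nome z * nome w"
  by (simp add: nome_def exp_add ring_distribs)

lemma nome_of_nat_mult: "nome (of_nat n * z) = nome z ^ n"
  by (simp add: nome_def exp_of_nat_mult [symmetric] mult_ac)

lemma nome_of_int [simp]: "nome (of_int n) = 1"
  by (simp add: nome_def exp_eq_1)

lemma nome_of_nat [simp]: "nome (of_nat n) = 1"
  using nome_of_int [of "int n"] by simp

lemma nome_1 [simp]: "nome 1 = 1"
  using nome_of_int [of 1] by simp

lemma nome_surj:
  assumes "q \<noteq> 0" "norm q < 1"
  obtains z where "Im z > 0" "nome z = q"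
proof -
  define z where "z = Ln q / (2 * of_real pi * \<i>)"
  have 1: "nome z = q" using assms(1) by (simp add: nome_def z_def)
  have "exp (- 2 * pi * Im z) < 1"
    using assms(2) norm_nome [of z] 1 by simp
  hence "Im z > 0" by (simp add: zero_less_mult_iff)
  with 1 that show ?thesis by blast
qed

lemma nome_less_radius:
  "Im z > 0 \<Longrightarrow> fps_conv_radius F \<ge> 1 \<Longrightarrow> ereal (norm (nome z)) < fps_conv_radius F"
  using norm_nome_less_1 [of z] by (metis ereal_less(3) less_le_trans)

lemma radius_ge_1_add: "fps_conv_radius F \<ge> 1 \<Longrightarrow> fps_conv_radius G \<ge> 1 \<Longrightarrow> fps_conv_radius (F + G) \<ge> 1"
  for F G :: "complex fps"
  by (meson fps_conv_radius_add min.boundedI order_trans)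

lemma radius_ge_1_diff: "fps_conv_radius F \<ge> 1 \<Longrightarrow> fps_conv_radius G \<ge> 1 \<Longrightarrow> fps_conv_radius (F - G) \<ge> 1"
  for F G :: "complex fps"
  by (meson fps_conv_radius_diff min.boundedI order_trans)

lemma radius_ge_1_mult: "fps_conv_radius F \<ge> 1 \<Longrightarrow> fps_conv_radius G \<ge> 1 \<Longrightarrow> fps_conv_radius (F * G) \<ge> 1"
  for F G :: "complex fps"
  by (meson fps_conv_radius_mult min.boundedI order_trans)

lemma radius_ge_1_power: "fps_conv_radius F \<ge> 1 \<Longrightarrow> fps_conv_radius (F ^ n) \<ge> 1"
  for F :: "complex fps"
  by (meson fps_conv_radius_power order_trans)

lemmas radius_ge_1 = radius_ge_1_add radius_ge_1_diff radius_ge_1_mult radius_ge_1_power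

lemma qev_add: "fps_conv_radius F \<ge> 1 \<Longrightarrow> fps_conv_radius G \<ge> 1 \<Longrightarrow> Im z > 0 \<Longrightarrow> qev (F + G) z = qev F z + qev G z"
  by (simp add: qev_def eval_fps_add nome_less_radius)

lemma qev_diff: "fps_conv_radius F \<ge> 1 \<Longrightarrow> fps_conv_radius G \<ge> 1 \<Longrightarrow> Im z > 0 \<Longrightarrow> qev (F - G) z = qev F z - qev G z"
  by (simp add: qev_def eval_fps_diff nome_less_radius)

lemma qev_mult: "fps_conv_radius F \<ge> 1 \<Longrightarrow> fps_conv_radius G \<ge> 1 \<Longrightarrow> Im z > 0 \<Longrightarrow> qev (F * G) z = qev F z * qev G z"
  by (simp add: qev_def eval_fps_mult nome_less_radius)

lemma qev_power: "fps_conv_radius F \<ge> 1 \<Longrightarrow> Im z > 0 \<Longrightarrow> qev (F ^ n) z = qev F z ^ n"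
  by (simp add: qev_def eval_fps_power nome_less_radius)

lemma qev_uminus: "fps_conv_radius F \<ge> 1 \<Longrightarrow> Im z > 0 \<Longrightarrow> qev (- F) z = - qev F z"
  by (simp add: qev_def eval_fps_minus nome_less_radius)

lemma qev_const [simp]: "qev (fps_const c) z = c"
  by (simp add: qev_def)

lemma qev_0 [simp]: "qev 0 z = 0"
  by (simp add: qev_def)

lemma qev_1 [simp]: "qev 1 z = 1"
  by (simp add: qev_def)

lemma qev_numeral [simp]: "qev (numeral n) z = numeral n"
  by (simp add: qev_def)

lemma qev_sums:
  "fps_conv_radius F \<ge> 1 \<Longrightarrow> Im z > 0 \<Longrightarrow> (\<lambda>n. fps_nth F n * nome z ^ n) sums qev F z"
  unfolding qev_def by (intro sums_eval_fps nome_less_radius)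

lemma qev_periodic: "qev F (z + of_int n) = qev F z"
  by (simp add: qev_def nome_add)

lemma holomorphic_eval_fps_disc: "fps_conv_radius F \<ge> 1 \<Longrightarrow> eval_fps F holomorphic_on ball 0 1"
  using ball_eball_mono [of 1 "fps_conv_radius F" 0]
  by (auto simp: one_ereal_def intro!: holomorphic_on_eval_fps)

lemma holomorphic_qev:
  assumes "fps_conv_radius F \<ge> 1"
  shows "qev F holomorphic_on {z. Im z > 0}"
proof -
  have "(eval_fps F \<circ> nome) holomorphic_on {z. Im z > 0}"
    by (rule holomorphic_on_compose_gen [OF _ holomorphic_eval_fps_disc [OF assms]])
       (auto simp: nome_def [abs_def] norm_exp_eq_Re intro!: holomorphic_intros)
  thus ?thesis by (simp add: o_def qev_def [abs_def])
qed

lemma radius_ge_1I: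
  fixes F :: "complex fps"
  assumes "\<And>z. Im z > 0 \<Longrightarrow> summable (\<lambda>n. fps_nth F n * nome z ^ n)"
  shows "fps_conv_radius F \<ge> 1"
  unfolding fps_conv_radius_def one_ereal_def
proof (rule conv_radius_geI_ex)
  fix r :: real assume "0 < r" "ereal r < ereal 1"
  then obtain z where "Im z > 0" "nome z = of_real r"
    using nome_surj [of "of_real r"] by auto
  with assms [of z] show "\<exists>w. norm w = r \<and> summable (\<lambda>n. fps_nth F n * w ^ n)"
    using \<open>0 < r\<close> by (intro exI [of _ "of_real r"]) auto
qed

text \<open>\<open>nome\<close> takes every value in the punctured unit disc but omits 0, so the two
  sums agree there and continuity supplies the centre.\<close>

lemma qev_eqI:
  assumes F: "fps_conv_radius F \<ge> 1" and G: "fps_conv_radius G \<ge> 1"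
    and eq: "\<And>z. Im z > 0 \<Longrightarrow> qev F z = qev G z"
  shows "F = G"
proof (rule eval_fps_eqD)
  have 0: "(0::ereal) < 1" by simp
  show "fps_conv_radius F > 0" using 0 F by (rule less_le_trans)
  show "fps_conv_radius G > 0" using 0 G by (rule less_le_trans)
  have ne: "eval_fps F q = eval_fps G q" if "q \<noteq> 0" "norm q < 1" for q
    using nome_surj [OF that] eq unfolding qev_def by metis
  have "continuous_on (ball 0 1) (eval_fps F)" "continuous_on (ball 0 1) (eval_fps G)"
    using F G by (auto intro: holomorphic_on_imp_continuous_on holomorphic_eval_fps_disc)
  hence c: "isCont (eval_fps F) 0" "isCont (eval_fps G) 0"
    by (auto simp: continuous_on_eq_continuous_at)
  have "eventually (\<lambda>q. eval_fps F q = eval_fps G q) (at 0)"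
    unfolding eventually_at using ne by (intro exI [of _ 1]) (auto simp: dist_norm)
  hence "eval_fps F 0 = eval_fps G 0"
    using c unfolding isCont_def by (metis at_neq_bot tendsto_cong tendsto_unique)
  hence "eval_fps F q = eval_fps G q" if "norm q < 1" for q
    using ne that by (cases "q = 0") auto
  thus "eventually (\<lambda>z. eval_fps F z = eval_fps G z) (nhds 0)"
    unfolding eventually_nhds_metric by (intro exI [of _ 1]) (auto simp: dist_norm)
qed

lemma Im_minus_inverse: "Im z > 0 \<Longrightarrow> Im (- 1 / z) = Im z / (norm z)\<^sup>2"
  by (simp add: Im_divide cmod_power2)

lemma Im_minus_inverse_pos: "Im z > 0 \<Longrightarrow> Im (- 1 / z) > 0"
  by (subst Im_minus_inverse) (auto intro!: divide_pos_pos)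

lemma modular_fps_radius: "modular_fps k F \<Longrightarrow> fps_conv_radius F \<ge> 1"
  by (simp add: modular_fps_def)

lemma modular_fps_inverse: "modular_fps k F \<Longrightarrow> Im z > 0 \<Longrightarrow> qev F (- 1 / z) = z ^ k * qev F z"
  by (simp add: modular_fps_def)

lemma modular_fps_const [simp]: "modular_fps 0 (fps_const c)"
  by (simp add: modular_fps_def)

lemma modular_fps_0 [simp]: "modular_fps k 0"
  by (simp add: modular_fps_def)

lemma modular_fps_1 [simp]: "modular_fps 0 1"
  by (simp add: modular_fps_def)

lemma modular_fps_add: "modular_fps k F \<Longrightarrow> modular_fps k G \<Longrightarrow> modular_fps k (F + G)"
  unfolding modular_fps_def
  using Im_minus_inverse_pos
  by (auto intro!: radius_ge_1 simp: qev_add ring_distribs)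

lemma modular_fps_diff: "modular_fps k F \<Longrightarrow> modular_fps k G \<Longrightarrow> modular_fps k (F - G)"
  unfolding modular_fps_def
  using Im_minus_inverse_pos
  by (auto intro!: radius_ge_1 simp: qev_diff ring_distribs)

lemma modular_fps_mult: "modular_fps k F \<Longrightarrow> modular_fps l G \<Longrightarrow> modular_fps (k + l) (F * G)"
  unfolding modular_fps_def
  using Im_minus_inverse_pos
  by (auto intro!: radius_ge_1 simp: qev_mult power_add mult_ac)

lemma modular_fps_power: "modular_fps k F \<Longrightarrow> modular_fps (k * n) (F ^ n)"
  by (induction n) (auto dest: modular_fps_mult)

lemma modular_fps_cmult: "modular_fps k F \<Longrightarrow> modular_fps k (fps_const c * F)"
  using modular_fps_mult [OF modular_fps_const] by simp

lemma modular_fps_sum: "(\<And>i. i \<in> I \<Longrightarrow> modular_fps k (F i)) \<Longrightarrow> modular_fps k (\<Sum>i\<in>I. F i)"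
  by (induction I rule: infinite_finite_induct) (auto intro: modular_fps_add)

section \<open>Moebius invariance and Hecke operators\<close>

lemma moebius_denominator_nonzero:
  assumes "Im z > 0" "(c::int) \<noteq> 0 \<or> d \<noteq> 0"
  shows "of_int c * z + of_int d \<noteq> 0"
proof
  assume "of_int c * z + of_int d = 0"
  hence "Im (of_int c * z + of_int d) = 0" "Re (of_int c * z + of_int d) = 0" by simp_all
  thus False using assms by auto
qed

lemma Im_moebius_pos:
  assumes "Im z > 0" "(a::int) * d - b * c = 1"
  shows "Im ((of_int a * z + of_int b) / (of_int c * z + of_int d)) > 0"
proof -
  have "c \<noteq> 0 \<or> d \<noteq> 0" using assms(2) by auto
  hence nz: "of_int c * z + of_int d \<noteq> 0" by (rule moebius_denominator_nonzero [OF assms(1)])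
  have "Im ((of_int a * z + of_int b) / (of_int c * z + of_int d)) =
        (of_int (a * d - b * c)) * Im z / (norm (of_int c * z + of_int d))\<^sup>2"
    unfolding Im_divide cmod_power2 by (simp add: algebra_simps)
  also have "\<dots> > 0" using assms nz by (simp add: assms(2) del: of_int_diff of_int_mult)
  finally show ?thesis .
qed

text \<open>Two inversions compose to the identity map, but their automorphy factors multiply to
  (-1)^k. This is invariance under the matrix -I, which the base case of Euclid's algorithm
  meets.\<close>

lemma modular_fps_sign:
  assumes "modular_fps k F" "Im z > 0"
  shows "(- 1) ^ k * qev F z = qev F z"
proof -
  have z: "z \<noteq> 0" using assms(2) by auto
  have "qev F (- 1 / (- 1 / z)) = (- 1 / z) ^ k * (z ^ k * qev F z)"
    using assms Im_minus_inverse_pos [of z] by (simp only: modular_fps_inverse)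
  also have "\<dots> = (- 1) ^ k * qev F z"
    using z by (simp add: power_divide power_minus' flip: power_mult_distrib)
  finally show ?thesis using z by simp
qed

text \<open>Euclid's algorithm on the first column writes a unimodular matrix in terms of
  \<open>z \<mapsto> z + 1\<close> and \<open>z \<mapsto> - 1 / z\<close>.\<close>

lemma modular_fps_moebius:
  assumes "modular_fps k F" "Im z > 0" "(a::int) * d - b * c = 1"
  shows "qev F ((of_int a * z + of_int b) / (of_int c * z + of_int d)) =
         (of_int c * z + of_int d) ^ k * qev F z"
  using assms(3)
proof (induction "nat \<bar>c\<bar>" arbitrary: a b c d rule: less_induct)
  case less
  note F = assms(1) and z = assms(2)
  show ?case
  proof (cases "c = 0")
    case True
    with less.prems have "a = 1 \<and> d = 1 \<or> a = -1 \<and> d = -1"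
      by (simp add: zmult_eq_1_iff)
    thus ?thesis
    proof
      assume "a = 1 \<and> d = 1" thus ?thesis using True by (simp add: qev_periodic)
    next
      assume "a = -1 \<and> d = -1"
      thus ?thesis using True qev_periodic [of F z "-b"] modular_fps_sign [OF F z] by simp
    qed
  next
    case False
    define n where "n = a div c"
    define a' where "a' = a - n * c"
    define b' where "b' = b - n * d"
    have det: "c * (- b') - d * (- a') = 1"
      using less.prems by (simp add: a'_def b'_def algebra_simps)
    have "a' = a mod c" by (simp add: a'_def n_def minus_div_mult_eq_mod)
    hence small: "nat \<bar>- a'\<bar> < nat \<bar>c\<bar>"
      using False by (simp add: abs_mod_less)
    \<comment> \<open>\<open>w\<close> is chosen so that the fraction in the goal is
      \<open>- 1 / w + of_int n\<close>. The leading coefficient of its denominator is minus the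
      remainder of \<open>a\<close> by \<open>c\<close>, so the induction descends.\<close>
    define w where "w = (of_int c * z + of_int d) / (of_int (- a') * z + of_int (- b'))"
    have IH: "qev F w = (of_int (- a') * z + of_int (- b')) ^ k * qev F z"
      unfolding w_def by (rule less.hyps [OF small det])
    have Imw: "Im w > 0" unfolding w_def by (rule Im_moebius_pos [OF z det])
    have "- a' \<noteq> 0 \<or> - b' \<noteq> 0" using det by auto
    hence nz: "of_int (- a') * z + of_int (- b') \<noteq> 0"
      by (rule moebius_denominator_nonzero [OF z])
    have nz': "of_int c * z + of_int d \<noteq> 0"
      using False by (intro moebius_denominator_nonzero [OF z]) auto
    have "(of_int a * z + of_int b) / (of_int c * z + of_int d) = - 1 / w + of_int n"
      using nz nz' unfolding w_def a'_def b'_def by (simp add: field_simps)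
    hence "qev F ((of_int a * z + of_int b) / (of_int c * z + of_int d)) = qev F (- 1 / w)"
      by (simp only: qev_periodic)
    also have "\<dots> = w ^ k * qev F w"
      by (rule modular_fps_inverse [OF F Imw])
    also have "\<dots> = (w * (of_int (- a') * z + of_int (- b'))) ^ k * qev F z"
      by (simp only: IH power_mult_distrib mult.assoc)
    also have "w * (of_int (- a') * z + of_int (- b')) = of_int c * z + of_int d"
      using nz unfolding w_def by simp
    finally show ?thesis .
  qed
qed

text \<open>The usual factor p^(k-1) is written as a quotient so that weight 0 is included: there
  natural subtraction would give 1 instead of 1/p. Weight 0 is met in
  \<open>hecke_low_form\<close>.\<close>

definition hecke_fps :: "nat \<Rightarrow> nat \<Rightarrow> complex fps \<Rightarrow> complex fps" where
  "hecke_fps p k F = Abs_fps (\<lambda>n. fps_nth F (p * n) +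
     of_nat p ^ k / of_nat p * (if p dvd n then fps_nth F (n div p) else 0))"

definition hecke_sum :: "nat \<Rightarrow> nat \<Rightarrow> (complex \<Rightarrow> complex) \<Rightarrow> complex \<Rightarrow> complex" where
  "hecke_sum p k f z = of_nat p ^ k / of_nat p * f (of_nat p * z) +
     1 / of_nat p * (\<Sum>b<p. f ((z + of_nat b) / of_nat p))"

lemma sum_roots_of_unity:
  assumes "p > 0"
  shows "(\<Sum>b<p. nome (of_nat b / of_nat p) ^ n) = (if p dvd n then of_nat p else 0)"
proof -
  define w where "w = nome (of_nat n / of_nat p)"
  have "nome (of_nat b / of_nat p) ^ n = w ^ b" for b
    unfolding w_def by (simp add: nome_of_nat_mult [symmetric] mult_ac)
  hence eq: "(\<Sum>b<p. nome (of_nat b / of_nat p) ^ n) = (\<Sum>b<p. w ^ b)" by simp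
  have wp: "w ^ p = 1"
    unfolding w_def using assms by (simp add: nome_of_nat_mult [symmetric])
  have w1: "w = 1 \<longleftrightarrow> p dvd n"
  proof
    assume "w = 1"
    then obtain m :: int where "2 * pi * (of_nat n / of_nat p) = of_int (2 * m) * pi"
      by (auto simp: w_def nome_def exp_eq_1 Im_divide_of_nat)
    hence "real n = of_int m * real p" using assms by (simp add: field_simps)
    hence "of_int (int n) = (of_int (m * int p) :: real)" by simp
    hence "int n = m * int p" by (simp only: of_int_eq_iff)
    thus "p dvd n" by (metis dvd_triv_right int_dvd_int_iff)
  next
    assume "p dvd n"
    then obtain m where "n = p * m" by blast
    thus "w = 1" using assms by (simp add: w_def)
  qed
  show ?thesis
  proof (cases "p dvd n")
    case True thus ?thesis using w1 eq by simp
  next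
    case False
    hence "w \<noteq> 1" using w1 by simp
    thus ?thesis using False eq wp geometric_sum [of w p] by simp
  qed
qed

text \<open>The average over \<open>b\<close> is a sum over p-th roots of unity, which deletes all
  exponents not divisible by \<open>p\<close>; the value at \<open>of_nat p * z\<close> has only
  exponents divisible by \<open>p\<close> to begin with. Both series are reindexed along the
  multiples of \<open>p\<close>.\<close>

lemma hecke_fps_sums:
  assumes F: "fps_conv_radius F \<ge> 1" and p: "p > 0" and z: "Im z > 0"
  shows "(\<lambda>n. fps_nth (hecke_fps p k F) n * nome z ^ n) sums hecke_sum p k (qev F) z"
proof -
  have "Im (of_nat p * z) > 0" using p z by simp
  from qev_sums [OF F this]
  have *: "(\<lambda>n. fps_nth F n * nome z ^ (p * n)) sums qev F (of_nat p * z)"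
    by (simp add: nome_of_nat_mult power_mult)
  define f where "f = (\<lambda>m. (if p dvd m then fps_nth F (m div p) else 0) * nome z ^ m)"
  have "(\<lambda>n. f (p * n)) sums qev F (of_nat p * z)"
    using * p by (simp add: f_def)
  hence V: "f sums qev F (of_nat p * z)"
    by (subst (asm) sums_mono_reindex) (use p in \<open>auto simp: strict_mono_def f_def\<close>)
  define x where "x = nome (z / of_nat p)"
  have xp: "x ^ p = nome z" using p by (simp add: x_def nome_of_nat_mult [symmetric])
  have "(\<lambda>n. fps_nth F n * (x * nome (of_nat b / of_nat p)) ^ n) sums qev F ((z + of_nat b) / of_nat p)" for b
  proof -
    have "Im ((z + of_nat b) / of_nat p) > 0" using p z by (simp add: Im_divide_of_nat)
    from qev_sums [OF F this] show ?thesis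
      by (simp add: x_def nome_add [symmetric] add_divide_distrib)
  qed
  hence "(\<lambda>n. \<Sum>b<p. fps_nth F n * (x * nome (of_nat b / of_nat p)) ^ n) sums
         (\<Sum>b<p. qev F ((z + of_nat b) / of_nat p))"
    by (intro sums_sum) auto
  hence "(\<lambda>n. 1 / of_nat p * (\<Sum>b<p. fps_nth F n * (x * nome (of_nat b / of_nat p)) ^ n)) sums
         (1 / of_nat p * (\<Sum>b<p. qev F ((z + of_nat b) / of_nat p)))"
    by (rule sums_mult)
  also have "(\<lambda>n. 1 / of_nat p * (\<Sum>b<p. fps_nth F n * (x * nome (of_nat b / of_nat p)) ^ n)) =
             (\<lambda>n. if p dvd n then fps_nth F n * x ^ n else 0)"
  proof
    fix n
    have "(\<Sum>b<p. fps_nth F n * (x * nome (of_nat b / of_nat p)) ^ n) =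
          fps_nth F n * x ^ n * (\<Sum>b<p. nome (of_nat b / of_nat p) ^ n)"
      by (simp add: sum_distrib_left power_mult_distrib mult_ac)
    thus "1 / of_nat p * (\<Sum>b<p. fps_nth F n * (x * nome (of_nat b / of_nat p)) ^ n) =
          (if p dvd n then fps_nth F n * x ^ n else 0)"
      using p by (simp add: sum_roots_of_unity)
  qed
  finally have "(\<lambda>n. if p dvd n then fps_nth F n * x ^ n else 0) sums
         (1 / of_nat p * (\<Sum>b<p. qev F ((z + of_nat b) / of_nat p)))" .
  hence "(\<lambda>n. if p dvd p * n then fps_nth F (p * n) * x ^ (p * n) else 0) sums
         (1 / of_nat p * (\<Sum>b<p. qev F ((z + of_nat b) / of_nat p)))"
    by (subst sums_mono_reindex [where g = "\<lambda>n. p * n"])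
       (use p in \<open>auto simp: strict_mono_def\<close>)
  hence U: "(\<lambda>n. fps_nth F (p * n) * nome z ^ n) sums
         (1 / of_nat p * (\<Sum>b<p. qev F ((z + of_nat b) / of_nat p)))"
    by (simp add: power_mult xp)
  show ?thesis
    using sums_add [OF sums_mult [OF V, of "of_nat p ^ k / of_nat p"] U]
    by (simp add: hecke_sum_def hecke_fps_def f_def algebra_simps)
qed

lemma hecke_fps_radius:
  assumes "fps_conv_radius F \<ge> 1" "p > 0"
  shows "fps_conv_radius (hecke_fps p k F) \<ge> 1"
  using hecke_fps_sums [OF assms] by (intro radius_ge_1I) (auto simp: sums_iff)

lemma qev_hecke_fps:
  assumes "fps_conv_radius F \<ge> 1" "p > 0" "Im z > 0"
  shows "qev (hecke_fps p k F) z = hecke_sum p k (qev F) z"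
  using hecke_fps_sums [OF assms] qev_sums [OF hecke_fps_radius [OF assms(1,2)] assms(3)]
  by (metis sums_unique2)

text \<open>The inversion permutes the p + 1 conjugates of \<open>F\<close>: it exchanges those at p
  z and z / p, and it pairs the translate by b with the translate by b', where b b' is -1 modulo
  p.\<close>

theorem modular_fps_hecke:
  assumes F: "modular_fps k F" and p: "prime (p::nat)"
  shows "modular_fps k (hecke_fps p k F)"
  unfolding modular_fps_def
proof (intro conjI allI impI)
  have p0: "p > 0" using p by (simp add: prime_gt_0_nat)
  have R: "fps_conv_radius F \<ge> 1" by (rule modular_fps_radius [OF F])
  show "fps_conv_radius (hecke_fps p k F) \<ge> 1" by (rule hecke_fps_radius [OF R p0])
  fix z :: complex assume z: "Im z > 0"
  hence z0: "z \<noteq> 0" by auto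
  define g where "g b = qev F ((z + of_nat b) / of_nat p)" for b
  define h where "h b = qev F ((- 1 / z + of_nat b) / of_nat p)" for b
  define iv where "iv b = (THE b'. b' \<in> {1..<p} \<and> p dvd b * b' + 1)" for b
  have ex1: "\<exists>!b'. b' \<in> {1..<p} \<and> p dvd b * b' + 1" if b: "b \<in> {1..<p}" for b
  proof -
    have "coprime b p" using b p
      by (metis atLeastLessThan_iff coprime_commute not_le not_one_le_zero nat_dvd_not_less prime_imp_coprime_nat zero_less_iff_neq_zero)
    hence cop: "coprime (int b) (int p)" by simp
    then obtain x where x: "[int b * x = 1] (mod int p)"
      using cong_solve_coprime_int by blast
    define b' where "b' = nat ((- x) mod int p)"
    have b': "int b' = (- x) mod int p" using p0 by (simp add: b'_def)
    have "[int b * int b' = int b * (- x)] (mod int p)"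
      unfolding b' by (intro cong_scalar_left) (simp add: cong_def)
    also have "[int b * (- x) = - 1] (mod int p)"
      using x by (metis cong_minus_minus_iff mult_minus_right)
    finally have "int p dvd int b * int b' + 1"
      by (simp add: cong_iff_dvd_diff)
    hence d: "p dvd b * b' + 1"
      by (metis int_dvd_int_iff of_nat_1 of_nat_add of_nat_mult)
    have "b' < p" using b' p0 by (metis of_nat_0_less_iff of_nat_less_iff pos_mod_bound)
    moreover have "b' \<noteq> 0" using d p by (metis add_0 mult_0_right nat_dvd_1_iff_1 not_prime_1)
    ultimately have m: "b' \<in> {1..<p}" by auto
    show ?thesis
    proof (rule ex1I [of _ b'])
      show "b' \<in> {1..<p} \<and> p dvd b * b' + 1" using m d by simp
      fix c assume c: "c \<in> {1..<p} \<and> p dvd b * c + 1"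
      hence "int p dvd (int b * int c + 1)"
        by (metis int_dvd_int_iff of_nat_1 of_nat_add of_nat_mult)
      moreover have "int p dvd (int b * int b' + 1)"
        using d by (metis int_dvd_int_iff of_nat_1 of_nat_add of_nat_mult)
      ultimately have "int p dvd (int b * int c + 1) - (int b * int b' + 1)" by (rule dvd_diff)
      hence "int p dvd int b * (int c - int b')" by (simp add: algebra_simps)
      hence "int p dvd int c - int b'" using cop
        by (metis coprime_commute coprime_dvd_mult_right_iff)
      hence "[int c = int b'] (mod int p)" by (simp add: cong_iff_dvd_diff)
      thus "c = b'" using c m by (auto simp: cong_def)
    qed
  qed
  have iv: "iv b \<in> {1..<p}" "p dvd b * iv b + 1" if "b \<in> {1..<p}" for b
    using theI' [OF ex1 [OF that]] unfolding iv_def by blast+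
  have iv_iv: "iv (iv b) = b" if "b \<in> {1..<p}" for b
  proof -
    have "iv (iv b) \<in> {1..<p}" "p dvd iv b * iv (iv b) + 1"
      using iv [OF iv(1) [OF that]] by auto
    moreover have "p dvd iv b * b + 1" using iv(2) [OF that] by (simp add: mult.commute)
    ultimately show ?thesis using ex1 [OF iv(1) [OF that]] that by blast
  qed
  have bij: "bij_betw iv {1..<p} {1..<p}"
    by (rule bij_betw_byWitness [where f' = iv]) (use iv iv_iv in auto)
  have main: "h b = z ^ k * g (iv b)" if b: "b \<in> {1..<p}" for b
  proof -
    obtain m where m: "b * iv b + 1 = p * m" using iv(2) [OF b] by blast
    define w where "w = (z + of_nat (iv b)) / of_nat p"
    have w: "Im w > 0" using z p0 by (simp add: w_def Im_divide_of_nat)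
    have pw: "of_nat p * w - of_nat (iv b) = z" using p0 by (simp add: w_def)
    \<comment> \<open>The matrix with rows (b, -m) and (p, -iv b) carries \<open>w\<close> to (-1/z
      + b) / p; its determinant is 1 because b * iv b + 1 = p m.\<close>
    have det: "int b * (- int (iv b)) - (- int m) * int p = 1"
    proof -
      have "int b * int (iv b) + 1 = int p * int m"
        by (metis m of_nat_1 of_nat_add of_nat_mult)
      thus ?thesis by (simp add: algebra_simps)
    qed
    have m': "of_nat b * of_nat (iv b) + 1 = (of_nat p * of_nat m :: complex)"
      by (metis m of_nat_1 of_nat_add of_nat_mult)
    have "(- 1 / z + of_nat b) / of_nat p = (of_nat b * z - 1) / (of_nat p * z)"
      using z0 p0 by (simp add: field_simps)
    also have "of_nat b * z - 1 = of_nat p * (of_nat b * w - of_nat m)"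
      using m' unfolding pw [symmetric] by (simp add: algebra_simps)
    also have "\<dots> / (of_nat p * z) = (of_nat b * w - of_nat m) / (of_nat p * w - of_nat (iv b))"
      unfolding pw using p0 by simp
    also have "\<dots> = (of_int (int b) * w + of_int (- int m)) / (of_int (int p) * w + of_int (- int (iv b)))"
      by simp
    finally have "h b = (of_int (int p) * w + of_int (- int (iv b))) ^ k * qev F w"
      unfolding h_def using modular_fps_moebius [OF F w det] by simp
    thus ?thesis using pw by (simp add: g_def w_def)
  qed
  have split: "(\<Sum>b<p. f b) = f 0 + (\<Sum>b\<in>{1..<p}. f b)" for f :: "nat \<Rightarrow> complex"
    using p0 by (simp add: lessThan_atLeast0 sum.atLeast_Suc_lessThan)
  have "(\<Sum>b\<in>{1..<p}. h b) = (\<Sum>b\<in>{1..<p}. z ^ k * g (iv b))"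
    by (intro sum.cong main refl)
  also have "\<dots> = (\<Sum>b\<in>{1..<p}. z ^ k * g b)"
    by (rule sum.reindex_bij_betw [OF bij])
  finally have S: "(\<Sum>b\<in>{1..<p}. h b) = z ^ k * (\<Sum>b\<in>{1..<p}. g b)"
    by (simp add: sum_distrib_left)
  have h0: "h 0 = (of_nat p * z) ^ k * qev F (of_nat p * z)"
  proof -
    have "Im (of_nat p * z) > 0" using z p0 by simp
    from modular_fps_inverse [OF F this] show ?thesis
      by (simp add: h_def mult.commute)
  qed
  have g0: "qev F (of_nat p * (- 1 / z)) = (z / of_nat p) ^ k * g 0"
  proof -
    have "Im (z / of_nat p) > 0" using z p0 by (simp add: Im_divide_of_nat)
    from modular_fps_inverse [OF F this] show ?thesis
      by (simp add: g_def)
  qed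
  have Iz: "Im (- 1 / z) > 0" by (rule Im_minus_inverse_pos [OF z])
  have "qev (hecke_fps p k F) (- 1 / z) =
        of_nat p ^ k / of_nat p * qev F (of_nat p * (- 1 / z)) + 1 / of_nat p * (\<Sum>b<p. h b)"
    unfolding qev_hecke_fps [OF R p0 Iz] hecke_sum_def h_def ..
  also have "\<dots> = z ^ k * (of_nat p ^ k / of_nat p * qev F (of_nat p * z) + 1 / of_nat p * (\<Sum>b<p. g b))"
    unfolding split S h0 g0 using p0 by (simp add: field_simps power_mult_distrib)
  also have "\<dots> = z ^ k * qev (hecke_fps p k F) z"
    unfolding qev_hecke_fps [OF R p0 z] hecke_sum_def g_def ..
  finally show "qev (hecke_fps p k F) (- 1 / z) = z ^ k * qev (hecke_fps p k F) z" .
qed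

section \<open>Vanishing of forms with a zero of high order at the cusp\<close>

text \<open>Below height 17/20 a point of the strip has norm at most \<open>sqrt (39/40)\<close>, so \<open>z \<mapsto> - 1 / z\<close>
  raises it by a fixed factor; the sharp height \<open>sqrt 3 / 2\<close> would not give a uniform factor.\<close>

lemma reduce_to_high_strip:
  fixes h :: "complex \<Rightarrow> 'a"
  assumes T: "\<And>z n. Im z > 0 \<Longrightarrow> h (z + of_int n) = h z"
    and S: "\<And>z. Im z > 0 \<Longrightarrow> h (- 1 / z) = h z"
    and z: "Im z > 0"
  obtains w where "Im w \<ge> 17/20" "\<bar>Re w\<bar> \<le> 1/2" "h w = h z"
proof -
  have "\<exists>w. Im w \<ge> 17/20 \<and> \<bar>Re w\<bar> \<le> 1/2 \<and> h w = h z"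
    if "Im z > 0" "Im z \<ge> 17/20 * (39/40) ^ n" for n z
    using that
  proof (induction n arbitrary: z)
    case 0
    define w where "w = z + of_int (- round (Re z))"
    have "\<bar>Re w\<bar> \<le> 1/2" using of_int_round_abs_le [of "Re z"] by (simp add: w_def abs_minus_commute)
    moreover have "h w = h z" unfolding w_def by (rule T [OF 0(1)])
    ultimately show ?case using 0 by (intro exI [of _ w]) (simp add: w_def)
  next
    case (Suc n)
    define w where "w = z + of_int (- round (Re z))"
    have Re: "\<bar>Re w\<bar> \<le> 1/2" using of_int_round_abs_le [of "Re z"] by (simp add: w_def abs_minus_commute)
    have hw: "h w = h z" unfolding w_def by (rule T [OF Suc.prems(1)])
    have Im: "Im w = Im z" by (simp add: w_def)
    show ?case
    proof (cases "Im w \<ge> 17/20")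
      case True thus ?thesis using Re hw by blast
    next
      case False
      have "(norm w)\<^sup>2 = (Re w)\<^sup>2 + (Im w)\<^sup>2" by (simp add: cmod_power2)
      also have "(Re w)\<^sup>2 \<le> (1/2)\<^sup>2" using Re by (metis abs_le_square_iff abs_of_nonneg zero_le_divide_1_iff zero_le_numeral)
      also have "(Im w)\<^sup>2 \<le> (17/20)\<^sup>2" using False Im Suc.prems by (intro power_mono) auto
      \<comment> \<open>1/4 + (17/20)^2 = 389/400, just below 39/40.\<close>
      finally have n: "(norm w)\<^sup>2 \<le> 39/40" by (simp add: power2_eq_square)
      have pos: "(norm w)\<^sup>2 > 0" using Im Suc.prems by auto
      have "17/20 * (39/40) ^ n * (norm w)\<^sup>2 \<le> 17/20 * (39/40) ^ n * (39/40)"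
        using n by (intro mult_left_mono) auto
      also have "\<dots> \<le> Im w" using Im Suc.prems by simp
      finally have "Im (- 1 / w) \<ge> 17/20 * (39/40) ^ n"
        using Im Suc.prems pos by (subst Im_minus_inverse) (auto simp: field_simps)
      moreover have "Im (- 1 / w) > 0" using Im Suc.prems by (intro Im_minus_inverse_pos) auto
      ultimately have "\<exists>v. Im v \<ge> 17/20 \<and> \<bar>Re v\<bar> \<le> 1/2 \<and> h v = h (- 1 / w)"
        by (rule Suc.IH[rotated])
      thus ?thesis using S [of w] hw Im Suc.prems by auto
    qed
  qed
  moreover obtain n where "(39/40 :: real) ^ n < Im z"
    using real_arch_pow_inv [of "Im z" "39/40"] z by auto
  hence "Im z \<ge> 17/20 * (39/40) ^ n"
    by (smt (verit) divide_le_eq_1 mult_left_le_one_le zero_le_divide_iff zero_le_power)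
  ultimately show ?thesis using that z by blast
qed

text \<open>The factor 10 is a lower bound for \<open>4 * pi * (5/6)\<close>, where \<open>5/6 < 17/20\<close> is the height of the
  circle to which the maximum principle is applied.\<close>

theorem modular_fps_eq_0_weak:
  assumes F: "modular_fps k F" and ord: "\<And>i. i < m \<Longrightarrow> fps_nth F i = 0"
    and m: "m \<ge> 1" and km: "k \<le> 10 * m"
  shows "F = 0"
proof (rule ccontr)
  assume "F \<noteq> 0"
  have R: "fps_conv_radius F \<ge> 1" by (rule modular_fps_radius [OF F])
  define G where "G = fps_shift m F"
  have sub: "m \<le> subdegree F" using \<open>F \<noteq> 0\<close> ord by (intro subdegree_geI) auto
  have RG: "fps_conv_radius G \<ge> 1" using R by (simp add: G_def)
  define g where "g = eval_fps G"
  have holg: "g holomorphic_on ball 0 1"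
    unfolding g_def by (rule holomorphic_eval_fps_disc [OF RG])
  have Fg: "qev F z = nome z ^ m * g (nome z)" if "Im z > 0" for z
    using that eval_fps_shift [OF sub nome_less_radius [OF that R]]
    by (simp add: qev_def g_def G_def)
  \<comment> \<open>The invariant |F(z)| (Im z)^(k/2) is squared to keep the exponent a natural
    number for odd \<open>k\<close> as well.\<close>
  define h where "h z = (norm (qev F z))\<^sup>2 * Im z ^ k" for z
  have hg: "h z = exp (- (4 * pi * m * Im z)) * (norm (g (nome z)))\<^sup>2 * Im z ^ k" if "Im z > 0" for z
    using Fg [OF that]
    by (simp add: h_def norm_mult norm_power norm_nome power_mult_distrib algebra_simps flip: exp_of_nat_mult)
  have hT: "h (z + of_int n) = h z" for z n
    by (simp add: h_def qev_periodic)
  have hS: "h (- 1 / z) = h z" if z: "Im z > 0" for z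
  proof -
    have nz: "norm z > 0" using z by auto
    have "h (- 1 / z) = (norm (z ^ k * qev F z))\<^sup>2 * (Im z / (norm z)\<^sup>2) ^ k"
      unfolding h_def by (simp only: modular_fps_inverse [OF F z] Im_minus_inverse [OF z])
    also have "\<dots> = h z" using nz
      by (simp add: h_def norm_mult norm_power power_mult_distrib power_divide field_simps
          flip: power_mult)
    finally show ?thesis .
  qed
  obtain z' where z': "Im z' > 0" "qev F z' \<noteq> 0"
    using qev_eqI [of F 0] R \<open>F \<noteq> 0\<close> by auto
  obtain z1 where z1: "Im z1 \<ge> 17/20" "\<bar>Re z1\<bar> \<le> 1/2" "h z1 = h z'"
    using reduce_to_high_strip [of h z'] hT hS z' by metis
  have s: "h z1 > 0" using z' z1(3) by (simp add: h_def)
  define r where "r = exp (- 2 * pi * (17/20))"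
  have r: "r < 1" by (simp add: r_def)
  have "continuous_on (cball 0 r) g"
    using holg r by (intro holomorphic_on_imp_continuous_on) (auto elim!: holomorphic_on_subset)
  hence "compact (g ` cball 0 r)" by (intro compact_continuous_image) auto
  hence "bounded (g ` cball 0 r)" by (rule compact_imp_bounded)
  then obtain B where "\<forall>x \<in> g ` cball 0 r. norm x \<le> B" unfolding bounded_iff by blast
  hence B: "norm (g q) \<le> B" if "q \<in> cball 0 r" for q using that by blast
  have r_in: "nome z \<in> cball 0 r" if "Im z \<ge> 17/20" for z
    using that by (simp add: norm_nome r_def)
  have B2: "h z \<le> B\<^sup>2 * (Im z ^ k / exp (Im z))" if z: "Im z \<ge> 17/20" for z
  proof -
    have "Im z * 1 \<le> Im z * (4 * pi * m)"
      using z m pi_gt3 by (intro mult_left_mono) (auto intro: order_trans [of _ "4 * pi"])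
    hence "exp (- (4 * pi * m * Im z)) \<le> exp (- Im z)" by (simp add: mult_ac)
    moreover have "(norm (g (nome z)))\<^sup>2 \<le> B\<^sup>2"
      using B [OF r_in [OF z]] by (intro power_mono) auto
    ultimately have "exp (- (4 * pi * m * Im z)) * (norm (g (nome z)))\<^sup>2 * Im z ^ k \<le>
          exp (- Im z) * B\<^sup>2 * Im z ^ k"
      using z by (intro mult_right_mono mult_mono) auto
    also have "\<dots> = B\<^sup>2 * (Im z ^ k / exp (Im z))" by (simp add: exp_minus field_simps)
    finally show ?thesis using hg [of z] z by simp
  qed
  \<comment> \<open>Exponential decay beats the power of Im z, so \<open>h\<close> stays below
    \<open>h z1\<close> above some height of the strip. Its maximum is therefore attained in the
    compact rectangle \<open>K\<close>, and invariance makes it a maximum on the whole half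
    plane.\<close>
  have "((\<lambda>y. B\<^sup>2 * (y ^ k / exp y)) \<longlongrightarrow> B\<^sup>2 * 0) at_top"
    by (intro tendsto_intros tendsto_power_div_exp_0)
  hence "eventually (\<lambda>y. B\<^sup>2 * (y ^ k / exp y) < h z1) at_top"
    using s by (intro order_tendstoD(2)) auto
  then obtain Y0 where Y0: "\<And>y. y \<ge> Y0 \<Longrightarrow> B\<^sup>2 * (y ^ k / exp y) < h z1"
    by (auto simp: eventually_at_top_linorder)
  define Y where "Y = max Y0 (Im z1)"
  define K where "K = cbox (Complex (- 1/2) (17/20)) (Complex (1/2) Y)"
  have K: "z \<in> K \<longleftrightarrow> \<bar>Re z\<bar> \<le> 1/2 \<and> Im z \<ge> 17/20 \<and> Im z \<le> Y" for z
    by (auto simp: K_def in_cbox_complex_iff)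
  have "continuous_on K (\<lambda>z. qev F z)"
    by (rule continuous_on_subset [OF holomorphic_on_imp_continuous_on [OF holomorphic_qev [OF R]]])
       (auto simp: K)
  hence cont: "continuous_on K h"
    unfolding h_def by (intro continuous_intros)
  have z1K: "z1 \<in> K" using z1 by (simp add: K Y_def)
  obtain z0 where z0: "z0 \<in> K" "\<And>z. z \<in> K \<Longrightarrow> h z \<le> h z0"
    using continuous_attains_sup [OF _ _ cont] z1K unfolding K_def by (metis compact_cbox empty_iff)
  have max: "h z \<le> h z0" if z: "Im z > 0" for z
  proof -
    obtain w where w: "Im w \<ge> 17/20" "\<bar>Re w\<bar> \<le> 1/2" "h w = h z"
      using reduce_to_high_strip [of h z] hT hS z by metis
    show ?thesis
    proof (cases "Im w \<le> Y")
      case True thus ?thesis using w z0(2) [of w] by (simp add: K)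
    next
      case False
      hence "Y0 \<le> Im w" by (simp add: Y_def)
      hence "h w < h z1" using B2 [OF w(1)] Y0 [of "Im w"] by linarith
      also have "\<dots> \<le> h z0" by (rule z0(2) [OF z1K])
      finally show ?thesis using w by simp
    qed
  qed
  define y where "y = Im z0"
  define y1 :: real where "y1 = 5/6"
  have y: "y > y1" "y1 > 0" using z0(1) by (auto simp: K y_def y1_def)
  have h0: "h z0 > 0" using s z0(2) [OF z1K] by simp
  \<comment> \<open>The bound for \<open>g\<close> on the circle of height \<open>y1\<close> that
    follows from \<open>h\<close> being at most \<open>h z0\<close>. Since \<open>z0\<close> lies
    higher, its nome is inside the circle and the maximum principle applies to it.\<close>
  define M where "M = sqrt (h z0 * exp (4 * pi * m * y1) / y1 ^ k)"
  have circ: "norm (g q) \<le> M" if q: "norm q = exp (- 2 * pi * y1)" for q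
  proof -
    have "q \<noteq> 0" "norm q < 1" using q y by auto
    then obtain z where z: "Im z > 0" "nome z = q" by (rule nome_surj)
    have "Im z = y1" using q z(2) norm_nome [of z] by simp
    hence "h z0 \<ge> exp (- (4 * pi * m * y1)) * (norm (g q))\<^sup>2 * y1 ^ k"
      using max [OF z(1)] hg [OF z(1)] z by simp
    hence "(norm (g q))\<^sup>2 \<le> h z0 * exp (4 * pi * m * y1) / y1 ^ k"
      using y by (simp add: exp_minus field_simps)
    thus ?thesis unfolding M_def by (rule real_le_rsqrt)
  qed
  define R' where "R' = exp (- 2 * pi * y1)"
  have R': "R' < 1" "R' > 0" using y by (simp_all add: R'_def)
  have "norm (g (nome z0)) \<le> M"
  proof (rule maximum_modulus_frontier [where S = "ball 0 R'" and f = g])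
    show "continuous_on (closure (ball 0 R')) g"
      using holg R' by (auto intro!: holomorphic_on_imp_continuous_on elim!: holomorphic_on_subset)
    show "g holomorphic_on interior (ball 0 R')"
      using R' by (intro holomorphic_on_subset [OF holg]) auto
    show "nome z0 \<in> ball 0 R'"
      using y by (simp add: norm_nome y_def R'_def)
    show "norm (g q) \<le> M" if "q \<in> frontier (ball 0 R')" for q
      using that circ R' by (simp add: frontier_ball R'_def)
  qed auto
  hence "(norm (g (nome z0)))\<^sup>2 \<le> M\<^sup>2" by (intro power_mono) auto
  also have "M\<^sup>2 = h z0 * exp (4 * pi * m * y1) / y1 ^ k"
    unfolding M_def using h0 y by (intro real_sqrt_pow2) auto
  also have "(norm (g (nome z0)))\<^sup>2 = h z0 * exp (4 * pi * m * y) / y ^ k"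
    using hg [of z0] y by (simp add: y_def exp_minus field_simps)
  finally have "exp (4 * pi * m * y) / y ^ k \<le> exp (4 * pi * m * y1) / y1 ^ k"
    using h0 by (simp only: times_divide_eq_right [symmetric] mult_le_cancel_left_pos)
  hence "exp (4 * pi * m * y) / exp (4 * pi * m * y1) \<le> y ^ k / y1 ^ k"
    using y by (simp add: field_simps)
  hence "exp (4 * pi * m * (y - y1)) \<le> (y / y1) ^ k"
    by (simp add: exp_diff power_divide algebra_simps)
  \<comment> \<open>By ln t <= t - 1, both sides become multiples of the positive number y - y1;
    cancelling it leaves 4 pi m <= k / y1.\<close>
  hence "4 * pi * m * (y - y1) \<le> ln ((y / y1) ^ k)"
    using y by (subst ln_ge_iff) auto
  also have "\<dots> = k * ln (y / y1)" using y by (simp add: ln_realpow)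
  also have "\<dots> \<le> k * (y / y1 - 1)" using y by (intro mult_left_mono ln_le_minus_one) auto
  also have "\<dots> = k / y1 * (y - y1)" using y by (simp add: field_simps)
  finally have "4 * pi * m \<le> k / y1" by (rule mult_right_le_imp_le) (use y in simp)
  hence "4 * pi * (5/6) * m \<le> k" by (simp add: y1_def field_simps)
  also have "real k \<le> 10 * m" using km by (metis of_nat_le_iff of_nat_mult of_nat_numeral)
  also have "\<dots> < 4 * pi * (5/6) * m" using pi_gt3 m by simp
  finally show False by simp
qed

section \<open>Eisenstein series\<close>

text \<open>A periodic function descends along \<open>nome\<close> to the punctured disc.
  Boundedness near the cusp makes 0 a removable singularity, and the Taylor expansion there is the
  wanted series.\<close>

lemma periodic_bounded_imp_qev:
  assumes hol: "f holomorphic_on {z. Im z > 0}"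
    and T: "\<And>z. Im z > 0 \<Longrightarrow> f (z + 1) = f z"
    and bdd: "\<And>z. Im z \<ge> 1 \<Longrightarrow> norm (f z) \<le> B"
  obtains F where "fps_conv_radius F \<ge> 1" "\<And>z. Im z > 0 \<Longrightarrow> qev F z = f z"
proof -
  have Tn: "f (z + of_nat n) = f z" if "Im z > 0" for z n
  proof (induction n)
    case (Suc n)
    have "f (z + of_nat (Suc n)) = f ((z + of_nat n) + 1)" by (simp add: algebra_simps)
    also have "\<dots> = f (z + of_nat n)" using that by (intro T) simp
    finally show ?case using Suc by simp
  qed simp
  have Ti: "f (z + of_int n) = f z" if z: "Im z > 0" for z n
  proof (cases "n \<ge> 0")
    case True thus ?thesis using Tn [OF z, of "nat n"] by simp
  next
    case False
    have "f (z + of_int n) = f ((z + of_int n) + of_nat (nat (- n)))"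
      using z by (intro Tn [symmetric]) simp
    thus ?thesis using False by simp
  qed
  have same: "f z = f w" if eq: "nome z = nome w" "Im z > 0" "Im w > 0" for z w
  proof -
    obtain n :: int where "2 * of_real pi * \<i> * z = 2 * of_real pi * \<i> * w + (of_int (2 * n) * pi) * \<i>"
      using eq(1) unfolding nome_def exp_eq by blast
    hence "2 * of_real pi * \<i> * z = 2 * of_real pi * \<i> * (w + of_int n)"
      by (simp add: algebra_simps)
    hence "z = w + of_int n" by (subst (asm) mult_cancel_left) simp
    thus ?thesis using Ti eq(3) by simp
  qed
  define L where "L q = Ln q / (2 * of_real pi * \<i>)" for q
  \<comment> \<open>A second branch of the logarithm, cut along the positive axis. The domains of
    the two branches cover the punctured disc, and periodicity makes both give the same function
    \<open>g\<close>.\<close>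
  define L' where "L' q = Ln (- q) / (2 * of_real pi * \<i>) + 1 / 2" for q
  have nL: "nome (L q) = q" if "q \<noteq> 0" for q using that by (simp add: nome_def L_def)
  have nL': "nome (L' q) = q" if "q \<noteq> 0" for q
    using that by (simp add: nome_def L'_def ring_distribs exp_add)
  have Im_pos: "Im z > 0" if "norm (nome z) < 1" for z
    using that by (simp add: norm_nome zero_less_mult_iff)
  define g where "g q = f (L q)" for q
  have gL': "g q = f (L' q)" if "q \<noteq> 0" "norm q < 1" for q
    unfolding g_def by (rule same) (use that nL nL' Im_pos in auto)
  define A where "A = ball 0 1 - (\<real>\<^sub>\<le>\<^sub>0 :: complex set)"
  define A' where "A' = ball 0 1 - (\<real>\<^sub>\<ge>\<^sub>0 :: complex set)"
  have "(f \<circ> L) holomorphic_on A"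
  proof (rule holomorphic_on_compose_gen [OF _ hol])
    show "L holomorphic_on A" unfolding L_def A_def by (intro holomorphic_intros) auto
    show "L ` A \<subseteq> {z. 0 < Im z}"
    proof clarify
      fix q assume "q \<in> A"
      hence "q \<noteq> 0" "norm q < 1" by (auto simp: A_def)
      thus "0 < Im (L q)" using nL Im_pos by simp
    qed
  qed
  hence 1: "g holomorphic_on A" by (simp add: o_def g_def [abs_def])
  have "(f \<circ> L') holomorphic_on A'"
  proof (rule holomorphic_on_compose_gen [OF _ hol])
    show "L' holomorphic_on A'" unfolding L'_def A'_def
      by (intro holomorphic_intros) auto
    show "L' ` A' \<subseteq> {z. 0 < Im z}"
    proof clarify
      fix q assume "q \<in> A'"
      hence "q \<noteq> 0" "norm q < 1" by (auto simp: A'_def)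
      thus "0 < Im (L' q)" using nL' Im_pos by simp
    qed
  qed
  hence 2: "g holomorphic_on A'"
  proof (rule holomorphic_transform)
    fix q assume "q \<in> A'"
    hence "q \<noteq> 0" "norm q < 1" by (auto simp: A'_def)
    thus "(f \<circ> L') q = g q" using gL' by simp
  qed
  have "A \<union> A' = ball 0 1 - {0}"
  proof -
    have "x = 0" if "x \<in> \<real>\<^sub>\<le>\<^sub>0" "x \<in> \<real>\<^sub>\<ge>\<^sub>0" for x :: complex
      using that by (auto simp: complex_nonpos_Reals_iff complex_nonneg_Reals_iff complex_eq_iff)
    thus ?thesis by (auto simp: A_def A'_def)
  qed
  moreover have "g holomorphic_on A \<union> A'"
    by (intro holomorphic_on_Un 1 2)
       (auto simp: A_def A'_def intro!: open_Diff)
  ultimately have holg: "g holomorphic_on ball 0 1 - {0}" by simp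
  have "eventually (\<lambda>q. norm (g q) \<le> B) (at 0)"
    unfolding eventually_at
  proof (intro exI [of _ "exp (- 2 * pi)"] conjI ballI impI)
    fix q :: complex assume q: "q \<noteq> 0 \<and> dist q 0 < exp (- 2 * pi)"
    have "norm (nome (L q)) < exp (- 2 * pi)" using q nL by simp
    hence "Im (L q) \<ge> 1" by (simp add: norm_nome)
    thus "norm (g q) \<le> B" unfolding g_def by (rule bdd)
  qed auto
  then obtain G where G: "G holomorphic_on ball 0 1" "\<And>q. q \<in> ball 0 1 - {0} \<Longrightarrow> G q = g q"
    using holomorphic_on_extend_bounded [OF holg] by (auto simp: interior_open)
  hence G': "G holomorphic_on eball 0 1" by (metis eball_ereal one_ereal_def)
  show ?thesis
  proof (rule that)
    show "fps_conv_radius (fps_expansion G 0) \<ge> 1"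
      by (rule conv_radius_fps_expansion [OF G'])
    fix z :: complex assume z: "Im z > 0"
    have "qev (fps_expansion G 0) z = G (nome z)"
      unfolding qev_def using eval_fps_expansion' [OF G', of "nome z"] norm_nome_less_1 [OF z]
      by (simp add: one_ereal_def)
    also have "\<dots> = g (nome z)" using norm_nome_less_1 [OF z] by (intro G(2)) auto
    also have "\<dots> = f z" unfolding g_def
      by (rule same) (use nL z norm_nome_less_1 [OF z] Im_pos in auto)
    finally show "qev (fps_expansion G 0) z = f z" .
  qed
qed

section \<open>Sums over the lattice spanned by 1 and z\<close>

definition eis_term :: "nat \<Rightarrow> complex \<Rightarrow> int \<times> int \<Rightarrow> complex" where
  "eis_term k z = (\<lambda>(m, n). 1 / (of_int m * z + of_int n) ^ k)"

text \<open>A majorant in product form, so that its sum over pairs reduces to a sum over the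
  integers. It serves every weight from 4 on: away from (0, 0), (1 + m^2)(1 + n^2) is at most 4
  max(|m|, |n|)^4.\<close>

definition eis_bound :: "int \<times> int \<Rightarrow> real" where
  "eis_bound = (\<lambda>(m, n). 1 / (1 + (of_int m)\<^sup>2) * (1 / (1 + (of_int n)\<^sup>2)))"

lemma summable_on_inverse_square_int: "(\<lambda>m::int. 1 / (1 + (of_int m)\<^sup>2) :: real) summable_on UNIV"
proof -
  have "summable (\<lambda>n. 1 / (1 + real n)\<^sup>2)"
    using inverse_squares_sums by (simp add: sums_iff add_ac)
  hence "summable (\<lambda>n. 1 / (real (Suc n))\<^sup>2)" by (simp add: add_ac)
  hence s: "summable (\<lambda>n. 1 / (real n)\<^sup>2)" by (subst (asm) summable_Suc_iff)
  have "summable (\<lambda>n. norm (1 / (1 + (real n)\<^sup>2)))"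
  proof (rule summable_comparison_test_ev [OF _ s], rule eventually_sequentiallyI [of 1])
    fix n :: nat assume "n \<ge> 1"
    thus "norm (norm (1 / (1 + (real n)\<^sup>2))) \<le> 1 / (real n)\<^sup>2"
      by (simp add: frac_le)
  qed
  hence nat: "(\<lambda>n. 1 / (1 + (real n)\<^sup>2)) summable_on UNIV"
    by (rule norm_summable_imp_summable_on)
  have "(\<lambda>m::int. 1 / (1 + (of_int m)\<^sup>2) :: real) summable_on range int"
    by (subst summable_on_reindex) (use nat in \<open>auto simp: o_def\<close>)
  moreover have "(\<lambda>m::int. 1 / (1 + (of_int m)\<^sup>2) :: real) summable_on range (\<lambda>n. - int n)"
    by (subst summable_on_reindex) (use nat in \<open>auto simp: o_def inj_on_def\<close>)
  moreover have "(UNIV :: int set) = range int \<union> range (\<lambda>n. - int n)"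
    by (metis (no_types, lifting) UNIV_eq_I UnI1 UnI2 int_cases2 rangeI)
  ultimately show ?thesis by (metis summable_on_union)
qed

lemma summable_on_eis_bound: "eis_bound summable_on A"
proof -
  let ?u = "\<lambda>m::int. 1 / (1 + (of_int m)\<^sup>2) :: real"
  have n: "norm (eis_bound (m, n)) = ?u m * ?u n" for m n
    unfolding eis_bound_def prod.case real_norm_def
    by (intro abs_of_nonneg mult_nonneg_nonneg) auto
  have "(\<lambda>x. norm (eis_bound x)) summable_on (UNIV \<times> UNIV)"
    unfolding Infinite_Sum.abs_summable_on_Sigma_iff
  proof (intro conjI ballI)
    fix m :: int
    show "(\<lambda>n. norm (eis_bound (m, n))) summable_on UNIV"
      unfolding n by (rule summable_on_cmult_right [OF summable_on_inverse_square_int])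
  next
    have 1: "infsum (\<lambda>n. norm (eis_bound (m, n))) UNIV = ?u m * infsum ?u UNIV" for m
      by (simp only: n infsum_cmult_right')
    have 2: "norm (?u m * infsum ?u UNIV) = ?u m * infsum ?u UNIV" for m
      unfolding real_norm_def by (intro abs_of_nonneg mult_nonneg_nonneg infsum_nonneg) auto
    show "(\<lambda>m. norm (infsum (\<lambda>n. norm (eis_bound (m, n))) UNIV)) summable_on UNIV"
      unfolding 1 2 by (rule summable_on_cmult_left [OF summable_on_inverse_square_int])
  qed
  hence "(\<lambda>x. norm (eis_bound x)) summable_on A" by (rule summable_on_subset_banach) auto
  thus ?thesis by (rule abs_summable_summable)
qed

lemma norm_eis_term_le:
  assumes d: "0 < \<delta>" "\<delta> \<le> 1" and k: "k \<ge> 4" and mn: "mn \<noteq> (0, 0)"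
    and le: "\<And>m n. norm (of_int m * z + of_int n) \<ge> \<delta> * max \<bar>of_int m\<bar> \<bar>of_int n\<bar>"
  shows "norm (eis_term k z mn) \<le> 4 / \<delta> ^ k * eis_bound mn"
proof -
  obtain m n where eq: "mn = (m, n)" by (cases mn)
  define M :: real where "M = max \<bar>of_int m\<bar> \<bar>of_int n\<bar>"
  have M1: "M \<ge> 1" using mn eq unfolding M_def by (cases "m = 0") auto
  have "1 + (of_int m)\<^sup>2 \<le> 2 * M\<^sup>2" "1 + (of_int n)\<^sup>2 \<le> 2 * M\<^sup>2"
  proof -
    have "(of_int m)\<^sup>2 \<le> M\<^sup>2" "(of_int n)\<^sup>2 \<le> M\<^sup>2" "1\<^sup>2 \<le> M\<^sup>2"
      using M1 by (auto simp: M_def simp flip: abs_le_square_iff)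
    thus "1 + (of_int m)\<^sup>2 \<le> 2 * M\<^sup>2" "1 + (of_int n)\<^sup>2 \<le> 2 * M\<^sup>2" by auto
  qed
  hence "(1 + (of_int m)\<^sup>2) * (1 + (of_int n)\<^sup>2) \<le> (2 * M\<^sup>2) * (2 * M\<^sup>2)"
    by (intro mult_mono) auto
  also have "\<dots> = 4 * M ^ 4" by (simp add: power4_eq_xxxx power2_eq_square)
  also have "M ^ 4 \<le> M ^ k" using M1 k by (rule power_increasing [rotated])
  finally have b: "(1 + (of_int m)\<^sup>2) * (1 + (of_int n)\<^sup>2) \<le> 4 * M ^ k" by simp
  have "(\<delta> * M) ^ k \<le> norm (of_int m * z + of_int n) ^ k"
    using le [of m n] d M1 by (intro power_mono) (auto simp: M_def)
  moreover have "(\<delta> * M) ^ k > 0" using d M1 by simp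
  ultimately have "norm (eis_term k z mn) \<le> 1 / (\<delta> * M) ^ k"
    by (simp add: eq eis_term_def norm_divide norm_power frac_le)
  also have "\<dots> = 4 / \<delta> ^ k * (1 / (4 * M ^ k))" by (simp add: power_mult_distrib)
  also have "\<dots> \<le> 4 / \<delta> ^ k * (1 / ((1 + (of_int m)\<^sup>2) * (1 + (of_int n)\<^sup>2)))"
    using b d by (intro mult_left_mono frac_le) (auto intro!: mult_pos_pos add_pos_nonneg)
  finally show ?thesis by (simp add: eis_bound_def eq)
qed

text \<open>The imaginary part bounds the norm below by y |m|. If |n| >= 2 B |m|, then n dominates m
  z; otherwise |n| is itself controlled by |m|. The constant is uniform on bounded sets away from
  the real axis, as the Weierstrass test for holomorphy requires.\<close>

lemma lattice_lower_bound:
  assumes y: "0 < y" "y \<le> 1" "y \<le> Im z" and B: "1 \<le> B" "norm z \<le> B"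
  shows "norm (of_int m * z + of_int n) \<ge> y / (2 * B) * max \<bar>of_int m\<bar> \<bar>of_int n\<bar>"
proof -
  have "\<bar>Im (of_int m * z + of_int n)\<bar> \<le> norm (of_int m * z + of_int n)" by (rule abs_Im_le_cmod)
  moreover have "\<bar>Im (of_int m * z + of_int n)\<bar> = \<bar>of_int m\<bar> * Im z" using y by (simp add: abs_mult)
  moreover have "\<bar>of_int m\<bar> * y \<le> \<bar>of_int m\<bar> * Im z" using y by (intro mult_left_mono) auto
  ultimately have 1: "norm (of_int m * z + of_int n) \<ge> \<bar>of_int m\<bar> * y" by linarith
  have "norm (of_int n :: complex) \<le> norm (of_int m * z + of_int n) + norm (of_int m * z)"
    by (metis add_diff_cancel_left' norm_triangle_ineq4)
  moreover have "norm (of_int m * z) \<le> \<bar>of_int m\<bar> * B" using B by (simp add: norm_mult mult_left_mono)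
  ultimately have 2: "norm (of_int m * z + of_int n) \<ge> \<bar>of_int n\<bar> - \<bar>of_int m\<bar> * B" by simp
  have yB: "y / (2 * B) \<le> 1 / 2" "y / (2 * B) \<le> y" using y B by (auto simp: field_simps)
  have m: "norm (of_int m * z + of_int n) \<ge> y / (2 * B) * \<bar>of_int m\<bar>"
  proof -
    have "y / (2 * B) * \<bar>of_int m\<bar> \<le> y * \<bar>of_int m\<bar>" using yB(2) by (intro mult_right_mono) auto
    thus ?thesis using 1 by (simp add: mult.commute)
  qed
  have n: "norm (of_int m * z + of_int n) \<ge> y / (2 * B) * \<bar>of_int n\<bar>"
  proof (cases "\<bar>of_int n\<bar> \<ge> 2 * B * \<bar>of_int m :: real\<bar>")
    case True
    have "y / (2 * B) * \<bar>of_int n\<bar> \<le> 1 / 2 * \<bar>of_int n\<bar>" using yB by (intro mult_right_mono) auto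
    thus ?thesis using 2 True by (simp add: algebra_simps)
  next
    case False
    hence "y / (2 * B) * \<bar>of_int n\<bar> \<le> y / (2 * B) * (2 * B * \<bar>of_int m\<bar>)"
      using y B by (intro mult_left_mono) auto
    also have "\<dots> = \<bar>of_int m\<bar> * y" using B by simp
    finally show ?thesis using 1 by simp
  qed
  show ?thesis using m n by (simp add: max_def)
qed

text \<open>Here the constant is uniform on a half strip reaching up to the cusp, which gives
  boundedness there.\<close>

lemma lattice_lower_bound':
  assumes "Im z \<ge> 1" "\<bar>Re z\<bar> \<le> 1"
  shows "norm (of_int m * z + of_int n) \<ge> 1 / 2 * max \<bar>of_int m\<bar> \<bar>of_int n\<bar>"
proof -
  have "\<bar>Im (of_int m * z + of_int n)\<bar> \<le> norm (of_int m * z + of_int n)" by (rule abs_Im_le_cmod)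
  moreover have "\<bar>Im (of_int m * z + of_int n)\<bar> = \<bar>of_int m\<bar> * Im z" using assms by (simp add: abs_mult)
  moreover have "\<bar>of_int m\<bar> * 1 \<le> \<bar>of_int m\<bar> * Im z" using assms by (intro mult_left_mono) auto
  ultimately have 1: "norm (of_int m * z + of_int n) \<ge> \<bar>of_int m\<bar>" by linarith
  have "\<bar>Re (of_int m * z + of_int n)\<bar> \<le> norm (of_int m * z + of_int n)" by (rule abs_Re_le_cmod)
  moreover have "\<bar>of_int m * Re z\<bar> \<le> \<bar>of_int m\<bar> * 1"
    unfolding abs_mult using assms by (intro mult_left_mono) auto
  ultimately have 2: "norm (of_int m * z + of_int n) \<ge> \<bar>of_int n\<bar> - \<bar>of_int m\<bar>" by simp
  have "0 \<le> \<bar>of_int m :: real\<bar>" by simp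
  with 1 2 show ?thesis by (simp only: max_def split: if_split) linarith
qed

text \<open>The lattice sum has constant term 2 zeta(k). This value is only shown to be nonzero, by
  a limit along the imaginary axis, and then divided out.\<close>

theorem ex_modular_fps_constant_1:
  assumes k: "k \<ge> 4" "even k"
  obtains F where "modular_fps k F" "fps_nth F 0 = 1"
proof -
  define A where "A = (UNIV - {(0, 0)} :: (int \<times> int) set)"
  define f where "f z = infsum (eis_term k z) A" for z
  have bound: "norm (eis_term k z mn) \<le> 4 / \<delta> ^ k * eis_bound mn"
    if "mn \<in> A" "0 < \<delta>" "\<delta> \<le> 1" "\<And>m n. norm (of_int m * z + of_int n) \<ge> \<delta> * max \<bar>of_int m\<bar> \<bar>of_int n\<bar>" for z mn \<delta>
    using that k by (intro norm_eis_term_le) (auto simp: A_def)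
  have sb: "(\<lambda>mn. c * eis_bound mn) summable_on A" for c
    by (intro summable_on_cmult_right summable_on_eis_bound)
  have hol: "f holomorphic_on {z. Im z > 0}"
  proof -
    have "\<exists>r>0. f holomorphic_on ball z0 r" if z0: "Im z0 > 0" for z0
    proof -
      define r where "r = Im z0 / 2"
      define y where "y = min r 1"
      define B where "B = norm z0 + r + 1"
      have r: "r > 0" using z0 by (simp add: r_def)
      have y: "0 < y" "y \<le> 1" using r by (auto simp: y_def)
      have B1: "B \<ge> 1" using r by (auto simp: B_def intro: add_nonneg_nonneg)
      have in_H: "Im z \<ge> r" "norm z \<le> B" if "z \<in> cball z0 r" for z
      proof -
        have "\<bar>Im (z0 - z)\<bar> \<le> r" using that abs_Im_le_cmod [of "z0 - z"] by (simp add: dist_norm)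
        hence "Im z0 - Im z \<le> Im z0 / 2" unfolding r_def minus_complex.sel by linarith
        thus "Im z \<ge> r" by (simp add: r_def)
        show "norm z \<le> B" using that norm_triangle_ineq2 [of z z0]
          by (simp add: dist_norm norm_minus_commute B_def)
      qed
      define \<delta> where "\<delta> = y / (2 * B)"
      have d: "0 < \<delta>" "\<delta> \<le> 1" using y B1 by (auto simp: \<delta>_def field_simps)
      have ul: "uniform_limit (cball z0 r) (\<lambda>X z. \<Sum>mn\<in>X. eis_term k z mn)
              (\<lambda>z. \<Sum>\<^sub>\<infinity>mn\<in>A. eis_term k z mn) (finite_subsets_at_top A)"
      proof (rule Weierstrass_m_test_general [OF _ sb [of "4 / \<delta> ^ k"]])
        fix mn z assume *: "mn \<in> A" "z \<in> cball z0 r"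
        show "norm (eis_term k z mn) \<le> 4 / \<delta> ^ k * eis_bound mn"
        proof (rule bound [OF *(1) d])
          fix m n
          have "y \<le> Im z" using in_H [OF *(2)] by (simp add: y_def)
          thus "\<delta> * max \<bar>of_int m\<bar> \<bar>of_int n\<bar> \<le> norm (of_int m * z + of_int n)"
            unfolding \<delta>_def using in_H [OF *(2)] y B1 by (intro lattice_lower_bound) auto
        qed
      qed
      have holX: "(\<lambda>z. \<Sum>mn\<in>X. eis_term k z mn) holomorphic_on cball z0 r" if XA: "X \<subseteq> A" for X
      proof (intro holomorphic_on_sum)
        fix mn assume "mn \<in> X"
        then obtain m n where mn: "mn = (m, n)" "m \<noteq> 0 \<or> n \<noteq> 0" using XA by (cases mn) (auto simp: A_def)
        have "of_int m * z + of_int n \<noteq> 0" if "z \<in> cball z0 r" for z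
        proof
          assume "of_int m * z + of_int n = 0"
          hence "Im (of_int m * z + of_int n) = 0" "Re (of_int m * z + of_int n) = 0" by simp_all
          thus False using mn(2) in_H(1) [OF that] r by auto
        qed
        thus "(\<lambda>z. eis_term k z mn) holomorphic_on cball z0 r"
          unfolding eis_term_def mn(1) by (auto intro!: holomorphic_intros)
      qed
      have ev: "\<forall>\<^sub>F X in finite_subsets_at_top A. continuous_on (cball z0 r) (\<lambda>z. \<Sum>mn\<in>X. eis_term k z mn)
               \<and> (\<lambda>z. \<Sum>mn\<in>X. eis_term k z mn) holomorphic_on ball z0 r"
        using eventually_finite_subsets_at_top_weakI [of A]
        by (rule eventually_mono [where P = "\<lambda>X. X \<subseteq> A"])
           (auto intro!: holomorphic_on_imp_continuous_on holX holomorphic_on_subset [OF holX])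
      have "f holomorphic_on ball z0 r"
        unfolding f_def by (rule holomorphic_uniform_limit [OF ev ul]) simp_all
      thus ?thesis using r by blast
    qed
    thus ?thesis unfolding holomorphic_on_def
      by (metis (no_types, lifting) centre_in_ball field_differentiable_at_within
          holomorphic_on_imp_differentiable_at mem_Collect_eq open_ball holomorphic_on_def)
  qed
  have T: "f (z + 1) = f z" for z
  proof -
    have "bij_betw (\<lambda>(m, n). (m, m + n)) A A"
      by (rule bij_betw_byWitness [where f' = "\<lambda>(m, n). (m, n - m)"]) (auto simp: A_def)
    from infsum_reindex_bij_betw [OF this, of "eis_term k z"]
    have "infsum (\<lambda>x. eis_term k z (case x of (m, n) \<Rightarrow> (m, m + n))) A = f z" by (simp add: f_def)
    moreover have "(\<lambda>x. eis_term k z (case x of (m, n) \<Rightarrow> (m, m + n))) = eis_term k (z + 1)"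
      by (auto simp: eis_term_def algebra_simps)
    ultimately show ?thesis by (simp add: f_def)
  qed
  have S: "f (- 1 / z) = z ^ k * f z" if z: "Im z > 0" for z
  proof -
    have z0: "z \<noteq> 0" using z by auto
    have "bij_betw (\<lambda>(m, n). (n, - m)) A A"
      by (rule bij_betw_byWitness [where f' = "\<lambda>(m, n). (- n, m)"]) (auto simp: A_def)
    from infsum_reindex_bij_betw [OF this, of "eis_term k z"]
    have "infsum (\<lambda>x. eis_term k z (case x of (m, n) \<Rightarrow> (n, - m))) A = f z" by (simp add: f_def)
    moreover have "eis_term k (- 1 / z) x = z ^ k * eis_term k z (case x of (m, n) \<Rightarrow> (n, - m))" for x
    proof -
      obtain m n where x: "x = (m, n)" by (cases x)
      have "of_int m * (- 1 / z) + of_int n = (of_int n * z - of_int m) / z"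
        using z0 by (simp add: field_simps)
      thus ?thesis by (simp add: x eis_term_def power_divide)
    qed
    ultimately show ?thesis by (simp only: f_def infsum_cmult_right' cong: infsum_cong)
  qed
  define B where "B = infsum (\<lambda>mn. 4 / (1 / 2) ^ k * eis_bound mn) A"
  have bdd0: "norm (f z) \<le> B" if z: "Im z \<ge> 1" "\<bar>Re z\<bar> \<le> 1" for z
  proof -
    have le: "norm (eis_term k z mn) \<le> 4 / (1 / 2) ^ k * eis_bound mn" if "mn \<in> A" for mn
      by (rule bound [OF that]) (use lattice_lower_bound' [OF z] in auto)
    have s: "(\<lambda>x. norm (eis_term k z x)) summable_on A"
      by (rule summable_on_comparison_test [OF sb le]) auto
    have "norm (f z) \<le> infsum (\<lambda>x. norm (eis_term k z x)) A"
      unfolding f_def by (rule norm_infsum_bound [OF s])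
    also have "\<dots> \<le> B" unfolding B_def by (rule infsum_mono [OF s sb le])
    finally show ?thesis .
  qed
  have Tn: "f (z + of_nat n) = f z" for z n
  proof (induction n)
    case (Suc n)
    thus ?case using T [of "z + of_nat n"] by (simp add: algebra_simps)
  qed simp
  have bdd: "norm (f z) \<le> B" if z: "Im z \<ge> 1" for z
  proof (cases "Re z \<ge> 0")
    case True
    define w where "w = z - of_nat (nat \<lfloor>Re z\<rfloor>)"
    have "f z = f w" using Tn [of w "nat \<lfloor>Re z\<rfloor>"] by (simp add: w_def)
    moreover have "\<bar>Re w\<bar> \<le> 1" using True by (simp add: w_def) linarith
    ultimately show ?thesis using bdd0 [of w] z by (simp add: w_def)
  next
    case False
    define w where "w = z + of_nat (nat (- \<lfloor>Re z\<rfloor>))"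
    have "f z = f w" using Tn [of z "nat (- \<lfloor>Re z\<rfloor>)"] by (simp add: w_def)
    moreover have "\<bar>Re w\<bar> \<le> 1" using False by (simp add: w_def) linarith
    ultimately show ?thesis using bdd0 [of w] z by (simp add: w_def)
  qed
  obtain F where F: "fps_conv_radius F \<ge> 1" "\<And>z. Im z > 0 \<Longrightarrow> qev F z = f z"
    using periodic_bounded_imp_qev [OF hol T bdd] by blast
  have mod: "modular_fps k F"
    using F S Im_minus_inverse_pos by (auto simp: modular_fps_def)
  \<comment> \<open>The termwise limit as z moves up the imaginary axis: only the terms with m = 0
    survive.\<close>
  define l where "l = (\<lambda>(m, n). if m = (0::int) then 1 / of_int n ^ k else (0 :: complex))"
  have tl: "((\<lambda>t. eis_term k (\<i> * of_real t) mn) \<longlongrightarrow> l mn) at_top" if "mn \<in> A" for mn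
  proof -
    obtain m n where mn: "mn = (m, n)" by (cases mn)
    show ?thesis
    proof (cases "m = 0")
      case True thus ?thesis by (simp add: mn l_def eis_term_def)
    next
      case False
      have "filterlim (\<lambda>t. norm (of_int m * (\<i> * of_real t) + of_int n :: complex)) at_top at_top"
      proof (rule filterlim_at_top_mono [OF filterlim_ident])
        show "\<forall>\<^sub>F t in at_top. t \<le> norm (of_int m * (\<i> * of_real t) + of_int n :: complex)"
          using eventually_ge_at_top [of 0]
        proof eventually_elim
          case (elim t)
          have "t * 1 \<le> t * \<bar>of_int m\<bar>" using elim False by (intro mult_left_mono) auto
          also have "\<dots> = \<bar>Im (of_int m * (\<i> * of_real t) + of_int n)\<bar>" using elim by (simp add: abs_mult)
          also have "\<dots> \<le> norm (of_int m * (\<i> * of_real t) + of_int n)" by (rule abs_Im_le_cmod)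
          finally show ?case by simp
        qed
      qed
      hence "filterlim (\<lambda>t. of_int m * (\<i> * of_real t) + of_int n :: complex) at_infinity at_top"
        by (rule filterlim_norm_at_top_imp_at_infinity)
      hence "((\<lambda>t. 1 / (of_int m * (\<i> * of_real t) + of_int n :: complex)) \<longlongrightarrow> 0) at_top"
        by (intro tendsto_divide_0 [OF tendsto_const])
      hence "((\<lambda>t. (1 / (of_int m * (\<i> * of_real t) + of_int n :: complex)) ^ k) \<longlongrightarrow> 0 ^ k) at_top"
        by (rule tendsto_power)
      hence "((\<lambda>t. 1 / (of_int m * (\<i> * of_real t) + of_int n :: complex) ^ k) \<longlongrightarrow> 0) at_top"
        using k by (simp add: power_one_over power_0_left)
      thus ?thesis using False by (simp add: mn l_def eis_term_def)
    qed
  qed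
  have ge: "1 * max \<bar>of_int m\<bar> \<bar>of_int n\<bar> \<le> norm (of_int m * (\<i> * of_real t) + of_int n :: complex)"
    if "t \<ge> 1" for t m n
  proof -
    have "\<bar>of_int m\<bar> * 1 \<le> \<bar>of_int m\<bar> * t" using that by (intro mult_left_mono) auto
    also have "\<dots> = \<bar>Im (of_int m * (\<i> * of_real t) + of_int n)\<bar>" using that by (simp add: abs_mult)
    also have "\<dots> \<le> norm (of_int m * (\<i> * of_real t) + of_int n :: complex)" by (rule abs_Im_le_cmod)
    finally show ?thesis using abs_Re_le_cmod [of "of_int m * (\<i> * of_real t) + of_int n"] by simp
  qed
  have uni: "uniform_limit {1..} (\<lambda>X t. \<Sum>mn\<in>X. eis_term k (\<i> * of_real t) mn)
              (\<lambda>t. \<Sum>\<^sub>\<infinity>mn\<in>A. eis_term k (\<i> * of_real t) mn) (finite_subsets_at_top A)"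
    by (rule Weierstrass_m_test_general [OF _ sb [of "4 / 1 ^ k"]], rule bound) (use ge in auto)
  have l_le: "norm (l mn) \<le> 4 / 1 ^ k * eis_bound mn" if "mn \<in> A" for mn
  proof (rule tendsto_upperbound [OF tendsto_norm [OF tl [OF that]]])
    show "\<forall>\<^sub>F t in at_top. norm (eis_term k (\<i> * of_real t) mn) \<le> 4 / 1 ^ k * eis_bound mn"
      using eventually_ge_at_top [of 1] by eventually_elim (rule bound [OF that], use ge in auto)
  qed auto
  have l_sum: "l summable_on A"
    by (rule abs_summable_summable, rule summable_on_comparison_test [OF sb l_le]) auto
  have lim: "((\<lambda>t. f (\<i> * of_real t)) \<longlongrightarrow> infsum l A) at_top"
    unfolding f_def
  proof (rule swap_uniform_limit' [OF _ _ uni])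
    show "\<forall>\<^sub>F X in finite_subsets_at_top A.
        ((\<lambda>t. \<Sum>mn\<in>X. eis_term k (\<i> * of_real t) mn) \<longlongrightarrow> (\<Sum>mn\<in>X. l mn)) at_top"
      using eventually_finite_subsets_at_top_weakI [of A]
      by (rule eventually_mono [where P = "\<lambda>X. X \<subseteq> A"]) (auto intro!: tendsto_sum tl)
    show "(sum l \<longlongrightarrow> infsum l A) (finite_subsets_at_top A)"
      using has_sum_infsum [OF l_sum] by (simp add: has_sum_def)
    show "\<forall>\<^sub>F t in at_top. t \<in> {1::real..}" using eventually_ge_at_top [of 1] by simp
  qed auto
  \<comment> \<open>For even \<open>k\<close> all real parts are nonnegative, and the term at (0, 1)
    contributes 1.\<close>
  have nz: "infsum l A \<noteq> 0"
  proof -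
    have "Re (infsum l A) = infsum (\<lambda>x. Re (l x)) A"
      using has_sum_Re [OF has_sum_infsum [OF l_sum]] by (simp add: infsumI)
    moreover have sRe: "(\<lambda>x. Re (l x)) summable_on A"
      using has_sum_Re [OF has_sum_infsum [OF l_sum]] by (auto simp: summable_on_def)
    moreover have pos: "Re (l x) \<ge> 0" for x
    proof -
      have "Re (1 / of_int n ^ k) \<ge> 0" for n :: int
      proof -
        have "(1 / of_int n ^ k :: complex) = of_real (1 / of_int n ^ k)" by simp
        hence "Re (1 / of_int n ^ k) = 1 / of_int n ^ k" by (metis Re_complex_of_real)
        thus ?thesis using k by (simp add: zero_le_even_power)
      qed
      thus ?thesis by (simp add: l_def split: prod.split)
    qed
    have "infsum (\<lambda>x. Re (l x)) {(0, 1)} \<le> infsum (\<lambda>x. Re (l x)) A"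
      by (rule infsum_mono2) (use sRe pos in \<open>auto simp: A_def\<close>)
    ultimately show ?thesis by (auto simp: l_def)
  qed
  have "((\<lambda>t. nome (\<i> * of_real t)) \<longlongrightarrow> 0) at_top"
  proof (rule tendsto_norm_zero_cancel)
    have "((\<lambda>t. exp (- (2 * pi) * t)) \<longlongrightarrow> 0) at_top" by real_asymp
    thus "((\<lambda>t. norm (nome (\<i> * of_real t))) \<longlongrightarrow> 0) at_top" by (simp add: norm_nome)
  qed
  moreover have "isCont (eval_fps F) 0"
    using holomorphic_on_imp_continuous_on [OF holomorphic_eval_fps_disc [OF F(1)]]
    by (auto simp: continuous_on_eq_continuous_at)
  ultimately have "((\<lambda>t. eval_fps F (nome (\<i> * of_real t))) \<longlongrightarrow> eval_fps F 0) at_top"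
    by (rule isCont_tendsto_compose [rotated])
  hence "((\<lambda>t. eval_fps F (nome (\<i> * of_real t))) \<longlongrightarrow> fps_nth F 0) at_top"
    by (simp add: eval_fps_at_0)
  hence "((\<lambda>t. f (\<i> * of_real t)) \<longlongrightarrow> fps_nth F 0) at_top"
    by (rule Lim_transform_eventually)
       (rule eventually_mono [OF eventually_gt_at_top [of 0]], use F(2) in \<open>simp add: qev_def\<close>)
  with lim have "fps_nth F 0 = infsum l A" by (metis tendsto_unique trivial_limit_at_top_linorder)
  hence c: "fps_nth F 0 \<noteq> 0" using nz by simp
  show ?thesis
    by (rule that [OF modular_fps_cmult [OF mod, of "1 / fps_nth F 0"]]) (use c in simp)
qed

section \<open>Characteristic polynomials\<close>

lemma cfun_sum_apply: "(\<Sum>i\<in>I. (\<lambda>z. a i * (f i :: complex \<Rightarrow> complex) z)) = (\<lambda>z. \<Sum>i\<in>I. a i * f i z)"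
  by (induction I rule: infinite_finite_induct) (auto simp: fun_eq_iff)

lemma basis_list_expand:
  assumes bs: "is_basis_list bs V" and f: "f \<in> V"
  shows "f = (\<lambda>z. \<Sum>i<length bs. cfun.representation (set bs) f (bs ! i) * (bs ! i) z)"
proof -
  have ind: "cfun.independent (set bs)" and sp: "cfun.span (set bs) = V" and d: "distinct bs"
    using bs by (auto simp: is_basis_list_def)
  have "f = (\<Sum>b\<in>set bs. (\<lambda>z. cfun.representation (set bs) f b * b z))"
    using cfun.sum_representation_eq [OF ind, of f "set bs"] f sp by simp
  also have "\<dots> = (\<Sum>i<length bs. (\<lambda>z. cfun.representation (set bs) f (bs ! i) * (bs ! i) z))"
    by (rule sum.reindex_bij_betw [symmetric, OF bij_betw_nth [OF d refl refl]])
  finally show ?thesis unfolding cfun_sum_apply .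
qed

lemma representation_basis_list:
  assumes bs: "is_basis_list bs V" and j: "j < length bs" and i: "i < length bs"
  shows "cfun.representation (set bs) (bs ! j) (bs ! i) = (if i = j then 1 else 0)"
proof -
  have ind: "cfun.independent (set bs)" and d: "distinct bs"
    using bs by (auto simp: is_basis_list_def)
  show ?thesis using cfun.representation_basis [OF ind, of "bs ! j"] j i d
    by (auto simp: nth_eq_iff_index_eq)
qed

lemma basis_list_in: "is_basis_list bs V \<Longrightarrow> i < length bs \<Longrightarrow> bs ! i \<in> V"
  by (metis cfun.span_base is_basis_list_def nth_mem)

lemma basis_list_comb_in: "is_basis_list bs V \<Longrightarrow> (\<And>i. i \<in> I \<Longrightarrow> f i \<in> V) \<Longrightarrow> (\<lambda>z. \<Sum>i\<in>I. a i * f i z) \<in> V"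
  unfolding cfun_sum_apply [symmetric] is_basis_list_def
  by (elim conjE, hypsubst, rule cfun.span_sum, rule cfun.span_scale) simp

lemma representation_comb:
  assumes bs: "is_basis_list bs V" and f: "\<And>i. i \<in> I \<Longrightarrow> f i \<in> V"
  shows "cfun.representation (set bs) (\<lambda>z. \<Sum>i\<in>I. a i * f i z) b =
         (\<Sum>i\<in>I. a i * cfun.representation (set bs) (f i) b)"
proof -
  have ind: "cfun.independent (set bs)" and sp: "cfun.span (set bs) = V"
    using bs by (auto simp: is_basis_list_def)
  have "cfun.representation (set bs) (\<Sum>i\<in>I. (\<lambda>z. a i * f i z)) =
        (\<lambda>b. \<Sum>i\<in>I. cfun.representation (set bs) (\<lambda>z. a i * f i z) b)"
    by (rule cfun.representation_sum [OF ind]) (use f sp in \<open>auto intro: cfun.span_scale\<close>)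
  also have "\<dots> = (\<lambda>b. \<Sum>i\<in>I. a i * cfun.representation (set bs) (f i) b)"
    by (intro ext sum.cong refl) (use f sp cfun.representation_scale [OF ind] in auto)
  finally show ?thesis unfolding cfun_sum_apply by simp
qed

lemma basis_list_length:
  assumes "is_basis_list bs V"
  shows "length bs = cfun.dim V"
proof -
  have d: "distinct bs" and ind: "cfun.independent (set bs)" and sp: "cfun.span (set bs) = V"
    using assms by (auto simp: is_basis_list_def)
  have "cfun.span (set bs) = cfun.span V" unfolding sp [symmetric] by (simp add: cfun.span_span)
  hence "cfun.dim V = card (set bs)" using ind by (rule cfun.dim_eq_card)
  thus ?thesis using d by (simp add: distinct_card)
qed

text \<open>\<open>operator_char_poly\<close> refers to an unspecified basis. The coordinate
  matrices \<open>P\<close> and \<open>Q\<close> between that basis and \<open>cs\<close> are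
  inverse to each other, so the two matrices of \<open>T\<close> are similar and the polynomial may
  be computed from \<open>cs\<close>.\<close>

theorem operator_char_poly_eq:
  assumes cs: "is_basis_list cs V"
    and lin: "\<And>(a :: nat \<Rightarrow> complex) f (n::nat). T (\<lambda>z. \<Sum>i<n. a i * f i z) = (\<lambda>z. \<Sum>i<n. a i * T (f i) z)"
    and act: "\<And>j. j < length cs \<Longrightarrow> T (cs ! j) = (\<lambda>z. \<Sum>i<length cs. N i j * (cs ! i) z)"
  shows "operator_char_poly V T = char_poly (Matrix.mat (length cs) (length cs) (\<lambda>(i, j). N i j))"
proof -
  define bs where "bs = (SOME bs. is_basis_list bs V)"
  have bs: "is_basis_list bs V" unfolding bs_def using cs by (rule someI)
  define n where "n = length cs"
  have lb: "length bs = n" and lc: "length cs = n"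
    using basis_list_length [OF bs] basis_list_length [OF cs] by (simp_all add: n_def)
  define P where "P = Matrix.mat n n (\<lambda>(i, j). cfun.representation (set bs) (cs ! j) (bs ! i))"
  define Q where "Q = Matrix.mat n n (\<lambda>(i, j). cfun.representation (set cs) (bs ! j) (cs ! i))"
  define M where "M = Matrix.mat n n (\<lambda>(i, j). N i j)"
  have carr: "P \<in> carrier_mat n n" "Q \<in> carrier_mat n n" "M \<in> carrier_mat n n"
    by (simp_all add: P_def Q_def M_def)
  have bexp: "bs ! j = (\<lambda>z. \<Sum>l<n. cfun.representation (set cs) (bs ! j) (cs ! l) * (cs ! l) z)" if "j < n" for j
    by (rule basis_list_expand [OF cs basis_list_in [OF bs], unfolded lb lc, OF that])
  have cexp: "cs ! j = (\<lambda>z. \<Sum>l<n. cfun.representation (set bs) (cs ! j) (bs ! l) * (bs ! l) z)" if "j < n" for j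
    by (rule basis_list_expand [OF bs basis_list_in [OF cs], unfolded lb lc, OF that])
  have bV: "bs ! i \<in> V" if "i < n" for i using basis_list_in [OF bs] that lb by simp
  have cV: "cs ! i \<in> V" if "i < n" for i using basis_list_in [OF cs] that lc by simp
  have PQ: "P * Q = 1\<^sub>m n"
  proof (rule eq_matI)
    fix i j assume "i < dim_row (1\<^sub>m n :: complex mat)" "j < dim_col (1\<^sub>m n :: complex mat)"
    hence ij: "i < n" "j < n" by auto
    have "(P * Q) $$ (i, j) = (\<Sum>l<n. cfun.representation (set cs) (bs ! j) (cs ! l) *
            cfun.representation (set bs) (cs ! l) (bs ! i))"
      using ij by (simp add: P_def Q_def scalar_prod_def lessThan_atLeast0 mult.commute)
    also have "\<dots> = cfun.representation (set bs)
        (\<lambda>z. \<Sum>l<n. cfun.representation (set cs) (bs ! j) (cs ! l) * (cs ! l) z) (bs ! i)"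
      by (rule representation_comb [OF bs, symmetric]) (use cV in auto)
    also have "\<dots> = cfun.representation (set bs) (bs ! j) (bs ! i)"
      using bexp [OF ij(2)] by simp
    finally show "(P * Q) $$ (i, j) = 1\<^sub>m n $$ (i, j)"
      using representation_basis_list [OF bs] ij lb by simp
  qed (use carr in auto)
  have QP: "Q * P = 1\<^sub>m n"
  proof (rule eq_matI)
    fix i j assume "i < dim_row (1\<^sub>m n :: complex mat)" "j < dim_col (1\<^sub>m n :: complex mat)"
    hence ij: "i < n" "j < n" by auto
    have "(Q * P) $$ (i, j) = (\<Sum>l<n. cfun.representation (set bs) (cs ! j) (bs ! l) *
            cfun.representation (set cs) (bs ! l) (cs ! i))"
      using ij by (simp add: P_def Q_def scalar_prod_def lessThan_atLeast0 mult.commute)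
    also have "\<dots> = cfun.representation (set cs)
        (\<lambda>z. \<Sum>l<n. cfun.representation (set bs) (cs ! j) (bs ! l) * (bs ! l) z) (cs ! i)"
      by (rule representation_comb [OF cs, symmetric]) (use bV in auto)
    also have "\<dots> = cfun.representation (set cs) (cs ! j) (cs ! i)"
      using cexp [OF ij(2)] by simp
    finally show "(Q * P) $$ (i, j) = 1\<^sub>m n $$ (i, j)"
      using representation_basis_list [OF cs] ij lc by simp
  qed (use carr in auto)
  have "operator_matrix bs T = P * M * Q"
  proof (rule eq_matI)
    fix i j assume "i < dim_row (P * M * Q)" "j < dim_col (P * M * Q)"
    hence ij: "i < n" "j < n" using carr by auto
    let ?q = "\<lambda>l. cfun.representation (set cs) (bs ! j) (cs ! l)"
    have Tc: "T (cs ! l) \<in> V" if "l < n" for l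
      using act [of l] that lc basis_list_comb_in [OF cs, of "{..<n}" "\<lambda>i. cs ! i"] cV by simp
    have "T (bs ! j) = (\<lambda>z. \<Sum>l<n. ?q l * T (cs ! l) z)"
      by (subst bexp [OF ij(2)]) (rule lin)
    hence "operator_matrix bs T $$ (i, j) = cfun.representation (set bs) (\<lambda>z. \<Sum>l<n. ?q l * T (cs ! l) z) (bs ! i)"
      using ij lb by (simp add: operator_matrix_def)
    also have "\<dots> = (\<Sum>l<n. ?q l * cfun.representation (set bs) (T (cs ! l)) (bs ! i))"
      by (rule representation_comb [OF bs]) (use Tc in auto)
    also have "\<dots> = (\<Sum>l<n. ?q l * (\<Sum>m<n. N m l * cfun.representation (set bs) (cs ! m) (bs ! i)))"
    proof (intro sum.cong refl)
      fix l assume "l \<in> {..<n}"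
      hence "cfun.representation (set bs) (T (cs ! l)) (bs ! i) =
             cfun.representation (set bs) (\<lambda>z. \<Sum>m<n. N m l * (cs ! m) z) (bs ! i)"
        using act lc by simp
      also have "\<dots> = (\<Sum>m<n. N m l * cfun.representation (set bs) (cs ! m) (bs ! i))"
        by (rule representation_comb [OF bs]) (use cV in auto)
      finally show "?q l * cfun.representation (set bs) (T (cs ! l)) (bs ! i) =
            ?q l * (\<Sum>m<n. N m l * cfun.representation (set bs) (cs ! m) (bs ! i))" by simp
    qed
    also have "\<dots> = (P * M * Q) $$ (i, j)"
      using ij by (simp add: P_def Q_def M_def scalar_prod_def lessThan_atLeast0 mult.commute)
    finally show "operator_matrix bs T $$ (i, j) = (P * M * Q) $$ (i, j)" .
  qed (use carr lb in \<open>auto simp: operator_matrix_def\<close>)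
  moreover have "operator_matrix bs T \<in> carrier_mat n n"
    by (simp add: operator_matrix_def lb)
  ultimately have "similar_mat (operator_matrix bs T) M"
    using carr PQ QP by (intro similar_matI [of _ _ P Q n]) auto
  from char_poly_similar [OF this] show ?thesis
    by (simp add: operator_char_poly_def bs_def M_def n_def)
qed

section \<open>Characteristic polynomials modulo an integer\<close>

lemma dvd_prod_diff:
  fixes f g :: "'b \<Rightarrow> 'a :: comm_ring_1"
  assumes "\<And>i. i \<in> I \<Longrightarrow> c dvd f i - g i"
  shows "c dvd prod f I - prod g I"
  using assms
proof (induction I rule: infinite_finite_induct)
  case (insert x I)
  have "prod f (insert x I) - prod g (insert x I) = f x * (prod f I - prod g I) + (f x - g x) * prod g I"
    using insert.hyps by (simp add: algebra_simps)
  thus ?case using insert by simp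
qed auto

text \<open>The Leibniz formula reduces this to products of entries. The ring is general because the
  matrices to be compared have polynomial entries, with a constant polynomial as divisor.\<close>

lemma dvd_det_diff:
  fixes A B :: "'a :: comm_ring_1 mat"
  assumes A: "A \<in> carrier_mat n n" and B: "B \<in> carrier_mat n n"
    and dvd: "\<And>i j. i < n \<Longrightarrow> j < n \<Longrightarrow> c dvd A $$ (i, j) - B $$ (i, j)"
  shows "c dvd det A - det B"
proof -
  have "det A - det B = (\<Sum>p | p permutes {0..<n}. signof p *
          ((\<Prod>i = 0..<n. A $$ (i, p i)) - (\<Prod>i = 0..<n. B $$ (i, p i))))"
    unfolding det_def' [OF A] det_def' [OF B] by (simp add: sum_subtractf right_diff_distrib)
  also have "c dvd \<dots>"
  proof (intro dvd_sum dvd_mult dvd_prod_diff dvd)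
    fix p i assume "p \<in> {p. p permutes {0..<n}}" "i \<in> {0..<n}"
    thus "p i < n" using permutes_in_image [of p "{0..<n}" i] by simp
  qed auto
  finally show ?thesis .
qed

lemma char_poly_cong:
  fixes A B :: "int mat"
  assumes A: "A \<in> carrier_mat n n" and B: "B \<in> carrier_mat n n"
    and dvd: "\<And>i j. i < n \<Longrightarrow> j < n \<Longrightarrow> [A $$ (i, j) = B $$ (i, j)] (mod m)"
  shows "poly_cong (char_poly A) (char_poly B) m"
proof -
  have "[:m:] dvd char_poly A - char_poly B"
    unfolding char_poly_def
  proof (rule dvd_det_diff)
    fix i j assume ij: "i < n" "j < n"
    have "char_poly_matrix A $$ (i, j) - char_poly_matrix B $$ (i, j) = [:B $$ (i, j) - A $$ (i, j):]"
      using A B ij by (simp add: char_poly_matrix_def)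
    moreover have "m dvd B $$ (i, j) - A $$ (i, j)"
      using dvd [OF ij] by (metis cong_iff_dvd_diff cong_sym)
    ultimately show "[:m:] dvd char_poly_matrix A $$ (i, j) - char_poly_matrix B $$ (i, j)"
      by (simp add: const_poly_dvd)
  qed (use A B in auto)
  thus ?thesis by (simp add: poly_cong_def cong_iff_dvd_diff const_poly_dvd_iff)
qed

section \<open>Forms with integral coefficients\<close>

definition cfps :: "int fps \<Rightarrow> complex fps" where
  "cfps G = Abs_fps (\<lambda>n. of_int (fps_nth G n))"

lemma cfps_nth [simp]: "fps_nth (cfps G) n = of_int (fps_nth G n)"
  by (simp add: cfps_def)

lemma cfps_0 [simp]: "cfps 0 = 0"
  by (simp add: fps_eq_iff)

lemma cfps_1 [simp]: "cfps 1 = 1"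
  by (simp add: fps_eq_iff)

lemma cfps_add: "cfps (F + G) = cfps F + cfps G"
  by (simp add: fps_eq_iff)

lemma cfps_diff: "cfps (F - G) = cfps F - cfps G"
  by (simp add: fps_eq_iff)

lemma cfps_uminus: "cfps (- F) = - cfps F"
  by (simp add: fps_eq_iff)

lemma cfps_mult: "cfps (F * G) = cfps F * cfps G"
  by (simp add: fps_eq_iff fps_mult_nth)

lemma cfps_power: "cfps (F ^ n) = cfps F ^ n"
  by (induction n) (simp_all add: cfps_mult)

lemma cfps_sum: "cfps (\<Sum>i\<in>I. F i) = (\<Sum>i\<in>I. cfps (F i))"
  by (induction I rule: infinite_finite_induct) (simp_all add: cfps_add)

lemma cfps_const: "cfps (fps_const c) = fps_const (of_int c)"
  by (auto simp: fps_eq_iff)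

lemma cfps_of_int: "cfps (of_int c) = fps_const (of_int c)"
  by (simp add: fps_of_int [symmetric] cfps_const)

lemma cfps_numeral: "cfps (numeral c) = numeral c"
  by (simp add: numeral_fps_const cfps_const)

lemma cfps_eq_iff [simp]: "cfps F = cfps G \<longleftrightarrow> F = G"
  by (simp add: fps_eq_iff)

lemmas cfps_hom = cfps_add cfps_diff cfps_uminus cfps_mult cfps_power cfps_numeral

abbreviation mf :: "nat \<Rightarrow> int fps \<Rightarrow> bool" where
  "mf k G \<equiv> modular_fps k (cfps G)"

lemma mf_add: "mf k F \<Longrightarrow> mf k G \<Longrightarrow> mf k (F + G)"
  by (simp add: cfps_add modular_fps_add)

lemma mf_diff: "mf k F \<Longrightarrow> mf k G \<Longrightarrow> mf k (F - G)"
  by (simp add: cfps_diff modular_fps_diff)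

lemma mf_mult: "mf k F \<Longrightarrow> mf l G \<Longrightarrow> mf (k + l) (F * G)"
  by (simp add: cfps_mult modular_fps_mult)

lemma mf_power: "mf k F \<Longrightarrow> mf (k * n) (F ^ n)"
  by (simp add: cfps_power modular_fps_power)

lemma mf_of_int_mult: "mf k F \<Longrightarrow> mf k (of_int c * F)"
  by (simp add: cfps_mult cfps_of_int modular_fps_cmult)

lemma mf_numeral_mult: "mf k F \<Longrightarrow> mf k (numeral c * F)"
  using mf_of_int_mult [of k F "numeral c"] by simp

lemma mf_eq_0_weak: "mf k F \<Longrightarrow> (\<And>i. i < m \<Longrightarrow> fps_nth F i = 0) \<Longrightarrow> m \<ge> 1 \<Longrightarrow> k \<le> 10 * m \<Longrightarrow> F = 0"
  using modular_fps_eq_0_weak [of k "cfps F" m] by (metis cfps_0 cfps_eq_iff cfps_nth of_int_0)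

lemma mf_eqI_weak:
  assumes "mf k F" "mf k G" "\<And>i. i < m \<Longrightarrow> fps_nth F i = fps_nth G i" "m \<ge> 1" "k \<le> 10 * m"
  shows "F = G"
  using mf_eq_0_weak [OF mf_diff [OF assms(1,2)], of m] assms by simp

text \<open>The operator on integral series; with the truncated exponent \<open>k - 1\<close> it
  agrees with \<open>hecke_fps\<close> from weight 1 on.\<close>

definition hecke_int :: "nat \<Rightarrow> nat \<Rightarrow> int fps \<Rightarrow> int fps" where
  "hecke_int p k G = Abs_fps (\<lambda>n. fps_nth G (p * n) +
     int p ^ (k - 1) * (if p dvd n then fps_nth G (n div p) else 0))"

lemma hecke_int_nth: "fps_nth (hecke_int p k G) n =
    fps_nth G (p * n) + int p ^ (k - 1) * (if p dvd n then fps_nth G (n div p) else 0)"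
  by (simp add: hecke_int_def)

lemma hecke_fps_nth: "fps_nth (hecke_fps p k F) n =
    fps_nth F (p * n) + of_nat p ^ k / of_nat p * (if p dvd n then fps_nth F (n div p) else 0)"
  by (simp add: hecke_fps_def)

lemma cfps_hecke_int:
  assumes "k \<ge> 1" "p > 0"
  shows "cfps (hecke_int p k G) = hecke_fps p k (cfps G)"
proof -
  have "(of_nat p ^ k / of_nat p :: complex) = of_nat p ^ (k - 1)"
    using assms by (cases k) auto
  thus ?thesis by (simp add: fps_eq_iff hecke_int_nth hecke_fps_nth)
qed

lemma mf_hecke_int: "mf k G \<Longrightarrow> k \<ge> 1 \<Longrightarrow> prime p \<Longrightarrow> mf k (hecke_int p k G)"
  by (simp add: cfps_hecke_int modular_fps_hecke prime_gt_0_nat)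

section \<open>Low coefficients, and Hecke eigenforms of small weight\<close>

lemma fps_nth_of_int_mult: "fps_nth (of_int c * F) n = c * fps_nth F n" for F :: "int fps"
  by (simp add: fps_of_int [symmetric])

lemma fps_mult_nth_2: "fps_nth (f * g) 2 = fps_nth f 0 * fps_nth g 2 + fps_nth f 1 * fps_nth g 1 + fps_nth f 2 * fps_nth g 0"
  by (simp add: fps_mult_nth numeral_eq_Suc)

lemma fps_mult_nth_3: "fps_nth (f * g) 3 = fps_nth f 0 * fps_nth g 3 + fps_nth f 1 * fps_nth g 2 + fps_nth f 2 * fps_nth g 1 + fps_nth f 3 * fps_nth g 0"
  by (simp add: fps_mult_nth numeral_eq_Suc)

lemma fps_mult_nth_4: "fps_nth (f * g) 4 = fps_nth f 0 * fps_nth g 4 + fps_nth f 1 * fps_nth g 3 + fps_nth f 2 * fps_nth g 2 + fps_nth f 3 * fps_nth g 1 + fps_nth f 4 * fps_nth g 0"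
  by (simp add: fps_mult_nth numeral_eq_Suc)

lemma fps_mult_nth_5: "fps_nth (f * g) 5 = fps_nth f 0 * fps_nth g 5 + fps_nth f 1 * fps_nth g 4 + fps_nth f 2 * fps_nth g 3 + fps_nth f 3 * fps_nth g 2 + fps_nth f 4 * fps_nth g 1 + fps_nth f 5 * fps_nth g 0"
  by (simp add: fps_mult_nth numeral_eq_Suc)

lemma fps_mult_nth_6: "fps_nth (f * g) 6 = fps_nth f 0 * fps_nth g 6 + fps_nth f 1 * fps_nth g 5 + fps_nth f 2 * fps_nth g 4 + fps_nth f 3 * fps_nth g 3 + fps_nth f 4 * fps_nth g 2 + fps_nth f 5 * fps_nth g 1 + fps_nth f 6 * fps_nth g 0"
  by (simp add: fps_mult_nth numeral_eq_Suc)

lemma fps_mult_nth_one: "fps_nth (f * g) 1 = fps_nth f 0 * fps_nth g 1 + fps_nth f 1 * fps_nth g 0"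
  by (simp add: fps_mult_nth)

lemmas fps_mult_nths = fps_mult_nth_0 fps_mult_nth_one fps_mult_nth_2 fps_mult_nth_3 fps_mult_nth_4
  fps_mult_nth_5 fps_mult_nth_6

text \<open>The factor is the one by which the operator acts on constant terms. The difference of
  the two sides thus vanishes at the cusp, and up to weight 10 the weak bound then makes it
  zero.\<close>

lemma hecke_fps_eigen:
  assumes F: "modular_fps k F" and k: "k \<le> 10" and p: "prime p"
  shows "hecke_fps p k F = fps_const (1 + of_nat p ^ k / of_nat p) * F"
proof -
  have "hecke_fps p k F - fps_const (1 + of_nat p ^ k / of_nat p) * F = 0"
  proof (rule modular_fps_eq_0_weak [where m = 1])
    show "modular_fps k (hecke_fps p k F - fps_const (1 + of_nat p ^ k / of_nat p) * F)"
      by (intro modular_fps_diff modular_fps_hecke modular_fps_cmult F p)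
    show "fps_nth (hecke_fps p k F - fps_const (1 + of_nat p ^ k / of_nat p) * F) i = 0" if "i < 1" for i
      using that by (simp add: hecke_fps_nth algebra_simps)
  qed (use k in auto)
  thus ?thesis by simp
qed

lemma eigen_coeff:
  assumes F: "modular_fps (Suc k) F" and k: "Suc k \<le> 10" and p: "prime p"
  shows "fps_nth F (p * n) = (1 + of_nat p ^ k) * fps_nth F n -
           of_nat p ^ k * (if p dvd n then fps_nth F (n div p) else 0)"
proof -
  have "(of_nat p ^ Suc k / of_nat p :: complex) = of_nat p ^ k" using p by (auto simp: prime_gt_0_nat)
  with arg_cong [OF hecke_fps_eigen [OF F k p], of "\<lambda>G. fps_nth G n"] show ?thesis
    by (simp only: hecke_fps_nth fps_mult_left_const_nth) (simp add: algebra_simps)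
qed

lemma eigen_coeff_2_3_4:
  assumes F: "modular_fps (Suc k) F" and k: "Suc k \<le> 10"
  shows "fps_nth F 2 = (1 + 2 ^ k) * fps_nth F 1" "fps_nth F 3 = (1 + 3 ^ k) * fps_nth F 1"
    "fps_nth F 4 = ((1 + 2 ^ k)\<^sup>2 - 2 ^ k) * fps_nth F 1"
proof -
  show 2: "fps_nth F 2 = (1 + 2 ^ k) * fps_nth F 1"
    using eigen_coeff [OF F k two_is_prime_nat, of 1] by simp
  show "fps_nth F 3 = (1 + 3 ^ k) * fps_nth F 1"
    using eigen_coeff [OF F k, of 3 1] by simp
  show "fps_nth F 4 = ((1 + 2 ^ k)\<^sup>2 - 2 ^ k) * fps_nth F 1"
    using eigen_coeff [OF F k two_is_prime_nat, of 2] 2 by (simp add: algebra_simps power2_eq_square)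
qed

text \<open>The first coefficient \<open>a\<close> comes from a relation between eigenforms instead
  of a zeta value: \<open>E * E\<close> is an eigenform of weight 8, and comparing its first two
  coefficients gives a (a - 240) = 0.\<close>

lemma weight_4_coeff_1:
  assumes E: "modular_fps 4 E" and E0: "fps_nth E 0 = 1"
  shows "fps_nth E 1 = 240"
proof -
  define a where "a = fps_nth E 1"
  have E2: "fps_nth E 2 = 9 * a" using eigen_coeff_2_3_4(1) [of 3 E] E by (simp add: a_def)
  have "modular_fps 8 (E * E)" using modular_fps_mult [OF E E] by simp
  hence "fps_nth (E * E) 2 = 129 * fps_nth (E * E) 1"
    using eigen_coeff_2_3_4(1) [of 7 "E * E"] by simp
  hence "a * (a - 240) = 0"
    unfolding fps_mult_nths E0 E2 a_def [symmetric] by (simp add: algebra_simps)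
  hence "a = 0 \<or> a = 240" by simp
  \<comment> \<open>If a = 0, the Hecke relations annihilate all later coefficients and leave
    \<open>E = 1\<close>; but a constant does not have weight 4, as the inversion at 2i would give 1
    = 16.\<close>
  moreover have "a \<noteq> 0"
  proof
    assume a: "a = 0"
    have "fps_nth E n = 0" if "n \<ge> 1" for n
      using that
    proof (induction n rule: less_induct)
      case (less n)
      show ?case
      proof (cases "n = 1")
        case True thus ?thesis using a by (simp add: a_def)
      next
        case False
        then obtain p where p: "prime p" "p dvd n" using prime_factor_nat by blast
        then obtain m where m: "n = p * m" by blast
        have p1: "p > 1" using p prime_gt_1_nat by blast
        have "fps_nth E m = 0" by (rule less.IH) (use m p1 less.prems in auto)
        moreover have "fps_nth E (m div p) = 0" if "p dvd m"
        proof (rule less.IH)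
          show "m div p < n" using m p1 less.prems by (intro le_less_trans [OF div_le_dividend]) auto
          show "m div p \<ge> 1" using m less.prems that dvd_imp_le [of p m] p1 by (simp add: Suc_le_eq div_greater_zero_iff)
        qed
        ultimately show ?thesis using eigen_coeff [of 3 E p m] E p m by simp
      qed
    qed
    hence "E = 1" using E0 by (auto simp: fps_eq_iff)
    hence "(1::complex) = (2 * \<i>) ^ 4" using modular_fps_inverse [OF E, of "2 * \<i>"] by simp
    thus False by (simp add: power_mult_distrib)
  qed
  ultimately show ?thesis by (simp add: a_def)
qed

text \<open>The product \<open>E * G\<close> is an eigenform of weight 10; comparing its first two
  coefficients gives an equation that is linear in the unknown.\<close>

lemma weight_6_coeff_1:
  assumes E: "modular_fps 4 E" "fps_nth E 0 = 1" and G: "modular_fps 6 G" "fps_nth G 0 = 1"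
  shows "fps_nth G 1 = - 504"
proof -
  define b where "b = fps_nth G 1"
  have a: "fps_nth E 1 = 240" by (rule weight_4_coeff_1 [OF E])
  have E2: "fps_nth E 2 = 2160" using eigen_coeff_2_3_4(1) [of 3 E] E a by simp
  have G2: "fps_nth G 2 = 33 * b" using eigen_coeff_2_3_4(1) [of 5 G] G by (simp add: b_def)
  have "modular_fps 10 (E * G)" using modular_fps_mult [OF E(1) G(1)] by simp
  hence "fps_nth (E * G) 2 = 513 * fps_nth (E * G) 1"
    using eigen_coeff_2_3_4(1) [of 9 "E * G"] by simp
  hence "240 * (b + 504) = 0"
    unfolding fps_mult_nths E(2) G(2) E2 G2 a b_def [symmetric] by (simp add: algebra_simps)
  hence "b + 504 = 0" by (simp only: mult_eq_0_iff) simp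
  thus ?thesis by (simp only: b_def eq_neg_iff_add_eq_0)
qed

lemma twelve_dvd_cube_diff: "(12::int) dvd x ^ 5 - x ^ 3"
proof -
  have "\<forall>m\<in>{..<12::nat}. (int m ^ 5 - int m ^ 3) mod 12 = 0"
    by (simp add: lessThan_nat_numeral lessThan_Suc)
  moreover have "nat (x mod 12) \<in> {..<12}" "int (nat (x mod 12)) = x mod 12"
    by (simp_all add: nat_less_iff)
  ultimately have "((x mod 12) ^ 5 - (x mod 12) ^ 3) mod 12 = 0" by metis
  moreover have "[(x mod 12) ^ 5 - (x mod 12) ^ 3 = x ^ 5 - x ^ 3] (mod 12)"
    by (intro cong_diff cong_pow) (simp_all add: cong_def)
  ultimately show ?thesis by (simp only: cong_def dvd_eq_mod_eq_0)
qed

text \<open>The congruence between the two divisor sums is what makes the discriminant integral.\<close>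

lemma eisenstein_coeff_integral:
  assumes E: "modular_fps 4 E" "fps_nth E 0 = 1" and G: "modular_fps 6 G" "fps_nth G 0 = 1"
  shows "n \<ge> 1 \<Longrightarrow> \<exists>u v w :: int. fps_nth E n = of_int (240 * u) \<and> fps_nth G n = of_int (- 504 * v) \<and> u = v + 12 * w"
proof (induction n rule: less_induct)
  case (less n)
  show ?case
  proof (cases "n = 1")
    case True thus ?thesis using weight_4_coeff_1 [OF E] weight_6_coeff_1 [OF E G]
      by (intro exI [of _ 1] exI [of _ 0]) auto
  next
    case False
    then obtain p where p: "prime p" "p dvd n" using prime_factor_nat by blast
    then obtain m where m: "n = p * m" by blast
    have p1: "p > 1" using p prime_gt_1_nat by blast
    have "m < n" "m \<ge> 1" using m p1 less.prems by auto
    from less.IH [OF this] obtain u v w where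
      1: "fps_nth E m = of_int (240 * u)" "fps_nth G m = of_int (- 504 * v)" "u = v + 12 * w" by blast
    have "\<exists>u' v' w' :: int. (if p dvd m then fps_nth E (m div p) else 0) = of_int (240 * u') \<and>
        (if p dvd m then fps_nth G (m div p) else 0) = of_int (- 504 * v') \<and> u' = v' + 12 * w'"
    proof (cases "p dvd m")
      case True
      have "m div p < n" using m p1 less.prems by (intro le_less_trans [OF div_le_dividend]) auto
      moreover have "m div p \<ge> 1" using m less.prems True dvd_imp_le [of p m] p1 by (simp add: Suc_le_eq div_greater_zero_iff)
      ultimately have "m div p < n" "m div p \<ge> 1" .
      from less.IH [OF this] True show ?thesis by simp
    next
      case False thus ?thesis by (intro exI [of _ 0]) simp
    qed
    then obtain u' v' w' where
      2: "(if p dvd m then fps_nth E (m div p) else 0) = of_int (240 * u')"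
         "(if p dvd m then fps_nth G (m div p) else 0) = of_int (- 504 * v')" "u' = v' + 12 * w'" by blast
    obtain x where x: "int p ^ 5 - int p ^ 3 = 12 * x" using twelve_dvd_cube_diff by blast
    have 3: "fps_nth E n = of_int (240 * ((1 + int p ^ 3) * u - int p ^ 3 * u'))"
      using eigen_coeff [of 3 E p m] E p unfolding m 1 2 by (simp add: algebra_simps)
    have 4: "fps_nth G n = of_int (- 504 * ((1 + int p ^ 5) * v - int p ^ 5 * v'))"
      using eigen_coeff [of 5 G p m] G p unfolding m 1 2 by (simp add: algebra_simps)
    have "(1 + int p ^ 3) * u - int p ^ 3 * u' = (1 + int p ^ 5) * v - int p ^ 5 * v' +
            12 * ((1 + int p ^ 3) * w - int p ^ 3 * w' - x * v + x * v')"
    proof -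
      have "int p ^ 5 = int p ^ 3 + 12 * x" using x by simp
      thus ?thesis unfolding 1 2 by (simp add: algebra_simps)
    qed
    with 3 4 show ?thesis by blast
  qed
qed

definition level_one_generators :: "int fps \<Rightarrow> int fps \<Rightarrow> int fps \<Rightarrow> bool" where
  "level_one_generators Q R D \<longleftrightarrow> mf 4 Q \<and> mf 6 R \<and> Q ^ 3 - R ^ 2 = 1728 * D \<and>
     fps_nth Q 0 = 1 \<and> fps_nth Q 1 = 240 \<and> fps_nth Q 2 = 2160 \<and>
     fps_nth R 0 = 1 \<and> fps_nth R 1 = - 504 \<and> fps_nth R 2 = - 16632 \<and>
     fps_nth D 0 = 0 \<and> fps_nth D 1 = 1 \<and> fps_nth D 2 = - 24 \<and> fps_nth D 3 = 252 \<and> fps_nth D 4 = - 1472"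

theorem ex_level_one_generators: "\<exists>Q R D. level_one_generators Q R D"
proof -
  obtain E where E: "modular_fps 4 E" "fps_nth E 0 = 1" using ex_modular_fps_constant_1 [of 4] by auto
  obtain G where G: "modular_fps 6 G" "fps_nth G 0 = 1" using ex_modular_fps_constant_1 [of 6] by auto
  have E1: "fps_nth E 1 = 240" by (rule weight_4_coeff_1 [OF E])
  have G1: "fps_nth G 1 = - 504" by (rule weight_6_coeff_1 [OF E G])
  have Es: "fps_nth E 2 = 2160" "fps_nth E 3 = 6720" "fps_nth E 4 = 17520"
    using eigen_coeff_2_3_4 [of 3 E] E E1 by simp_all
  have Gs: "fps_nth G 2 = - 16632" "fps_nth G 3 = - 122976" "fps_nth G 4 = - 532728"
    using eigen_coeff_2_3_4 [of 5 G] G G1 by simp_all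
  obtain u v w :: "nat \<Rightarrow> int" where uvw: "\<And>n. n \<ge> 1 \<Longrightarrow> fps_nth E n = of_int (240 * u n) \<and>
      fps_nth G n = of_int (- 504 * v n) \<and> u n = v n + 12 * w n"
    using eisenstein_coeff_integral [OF E G] by metis
  define A where "A = Abs_fps (\<lambda>n. if n = 0 then 0 else u n)"
  define B where "B = Abs_fps (\<lambda>n. if n = 0 then 0 else v n)"
  define W where "W = Abs_fps (\<lambda>n. if n = 0 then 0 else w n)"
  have AB: "A = B + 12 * W" using uvw by (simp add: A_def B_def W_def fps_eq_iff fps_mult_numeral_left)
  define Q where "Q = 1 + 240 * A"
  define R where "R = 1 - 504 * B"
  \<comment> \<open>In the expansion of Q^3 - R^2 the terms of degree 2 and 3 in A and B are
    divisible by 1728 as they stand. The linear part is 720 A + 1008 B, which A = B + 12 W turns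
    into 1728 (5 W + B).\<close>
  define D where "D = 5 * W + B + 100 * A ^ 2 + 8000 * A ^ 3 - 147 * B ^ 2"
  have QE: "cfps Q = E"
    using uvw E by (auto simp: fps_eq_iff Q_def A_def fps_mult_numeral_left)
  have RG: "cfps R = G"
    using uvw G by (auto simp: fps_eq_iff R_def B_def fps_mult_numeral_left)
  have QRD: "Q ^ 3 - R ^ 2 = 1728 * D"
    unfolding Q_def R_def D_def AB by (simp add: power2_eq_square power3_eq_cube algebra_simps)
  have Qn: "fps_nth Q n = z" if "fps_nth E n = of_int z" for n z
    using that QE by (metis cfps_nth of_int_eq_iff)
  have Rn: "fps_nth R n = z" if "fps_nth G n = of_int z" for n z
    using that RG by (metis cfps_nth of_int_eq_iff)
  have Qs: "fps_nth Q 0 = 1" "fps_nth Q 1 = 240" "fps_nth Q 2 = 2160" "fps_nth Q 3 = 6720" "fps_nth Q 4 = 17520"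
    using E(2) E1 Es by (auto intro!: Qn)
  have Rs: "fps_nth R 0 = 1" "fps_nth R 1 = - 504" "fps_nth R 2 = - 16632" "fps_nth R 3 = - 122976" "fps_nth R 4 = - 532728"
    using G(2) G1 Gs by (auto intro!: Rn)
  have "1728 * fps_nth D n = fps_nth (Q * (Q * Q) - R * R) n" for n
  proof -
    have "1728 * D = Q * (Q * Q) - R * R"
      using QRD by (simp only: power2_eq_square power3_eq_cube mult.assoc)
    from arg_cong [OF this, of "\<lambda>F. fps_nth F n"] show ?thesis
      by (simp only: fps_mult_numeral_left)
  qed
  from this [of 0] this [of 1] this [of 2] this [of 3] this [of 4]
  have "fps_nth D 0 = 0" "fps_nth D 1 = 1" "fps_nth D 2 = - 24" "fps_nth D 3 = 252" "fps_nth D 4 = - 1472"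
    unfolding fps_sub_nth fps_mult_nths Qs Rs by simp_all
  with QRD Qs Rs E G show ?thesis
    unfolding level_one_generators_def QE [symmetric] RG [symmetric] by blast
qed

section \<open>The discriminant\<close>

definition generators :: "int fps \<times> int fps \<times> int fps" where
  "generators = (SOME (Q, R, D). level_one_generators Q R D)"

definition E4 :: "int fps" where "E4 = fst generators"
definition E6 :: "int fps" where "E6 = fst (snd generators)"
definition Delta :: "int fps" where "Delta = snd (snd generators)"

lemma generators:
  "mf 4 E4" "mf 6 E6" "E4 ^ 3 - E6 ^ 2 = 1728 * Delta"
  "fps_nth E4 0 = 1" "fps_nth E4 1 = 240" "fps_nth E4 2 = 2160"
  "fps_nth E6 0 = 1" "fps_nth E6 1 = - 504" "fps_nth E6 2 = - 16632"
  "fps_nth Delta 0 = 0" "fps_nth Delta 1 = 1" "fps_nth Delta 2 = - 24"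
  "fps_nth Delta 3 = 252" "fps_nth Delta 4 = - 1472"
proof -
  have "case generators of (Q, R, D) \<Rightarrow> level_one_generators Q R D"
    unfolding generators_def
    by (rule someI_ex) (use ex_level_one_generators in auto)
  hence "level_one_generators E4 E6 Delta"
    by (simp add: E4_def E6_def Delta_def case_prod_beta)
  thus
    "mf 4 E4" "mf 6 E6" "E4 ^ 3 - E6 ^ 2 = 1728 * Delta"
    "fps_nth E4 0 = 1" "fps_nth E4 1 = 240" "fps_nth E4 2 = 2160"
    "fps_nth E6 0 = 1" "fps_nth E6 1 = - 504" "fps_nth E6 2 = - 16632"
    "fps_nth Delta 0 = 0" "fps_nth Delta 1 = 1" "fps_nth Delta 2 = - 24"
    "fps_nth Delta 3 = 252" "fps_nth Delta 4 = - 1472"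
    unfolding level_one_generators_def by blast+
qed

lemmas generators_Suc_0 = generators(5,8,11) [unfolded One_nat_def]

lemma mf_Delta: "mf 12 Delta"
proof -
  have "mf 12 (E4 ^ 3 - E6 ^ 2)"
    using mf_power [OF generators(1), of 3] mf_power [OF generators(2), of 2] by (intro mf_diff) simp_all
  hence "modular_fps 12 (fps_const (1 / 1728) * cfps (1728 * Delta))"
    unfolding generators(3) by (rule modular_fps_cmult)
  also have "fps_const (1 / 1728) * cfps (1728 * Delta) = cfps Delta"
    by (simp add: fps_eq_iff fps_mult_numeral_left)
  finally show ?thesis .
qed

section \<open>The Hecke operator at 2 on the first three powers of Delta\<close>

lemma Delta_square_nth:
  "fps_nth (Delta ^ 2) 0 = 0" "fps_nth (Delta ^ 2) 1 = 0" "fps_nth (Delta ^ 2) 2 = 1"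
  "fps_nth (Delta ^ 2) 3 = - 48" "fps_nth (Delta ^ 2) 4 = 1080" "fps_nth (Delta ^ 2) 5 = - 15040"
  unfolding power2_eq_square fps_mult_nths generators by simp_all

lemma Delta_cube_nth:
  "fps_nth (Delta ^ 3) 0 = 0" "fps_nth (Delta ^ 3) 1 = 0" "fps_nth (Delta ^ 3) 2 = 0"
  "fps_nth (Delta ^ 3) 3 = 1" "fps_nth (Delta ^ 3) 4 = - 72" "fps_nth (Delta ^ 3) 6 = - 54528"
  unfolding power3_eq_cube power2_eq_square [symmetric] fps_mult_nths generators Delta_square_nth by simp_all

lemma E4_cube_nth: "fps_nth (E4 ^ 3) 0 = 1" "fps_nth (E4 ^ 3) 1 = 720"
  unfolding power3_eq_cube fps_mult_nths generators by simp_all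

lemma Delta_E4_cube_nth:
  "fps_nth (Delta * E4 ^ 3) 0 = 0" "fps_nth (Delta * E4 ^ 3) 1 = 1" "fps_nth (Delta * E4 ^ 3) 2 = 696"
  unfolding fps_mult_nths generators E4_cube_nth by simp_all

lemma Delta_square_E4_cube_nth:
  "fps_nth (Delta ^ 2 * E4 ^ 3) 0 = 0" "fps_nth (Delta ^ 2 * E4 ^ 3) 1 = 0"
  "fps_nth (Delta ^ 2 * E4 ^ 3) 2 = 1" "fps_nth (Delta ^ 2 * E4 ^ 3) 3 = 672"
  unfolding fps_mult_nths generators E4_cube_nth Delta_square_nth by simp_all

lemma less_2_cases: "(i::nat) < 2 \<Longrightarrow> i = 0 \<or> i = 1" by auto
lemma less_3_cases: "(i::nat) < 3 \<Longrightarrow> i = 0 \<or> i = 1 \<or> i = 2" by auto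
lemma less_4_cases: "(i::nat) < 4 \<Longrightarrow> i = 0 \<or> i = 1 \<or> i = 2 \<or> i = 3" by auto

lemma hecke_int_2_nths:
  "fps_nth (hecke_int 2 k G) 0 = (1 + 2 ^ (k - 1)) * fps_nth G 0"
  "fps_nth (hecke_int 2 k G) 1 = fps_nth G 2"
  "fps_nth (hecke_int 2 k G) 2 = fps_nth G 4 + 2 ^ (k - 1) * fps_nth G 1"
  "fps_nth (hecke_int 2 k G) 3 = fps_nth G 6"
  by (simp_all add: hecke_int_nth algebra_simps numeral_2_eq_2 [symmetric])

text \<open>The sharp valence bound is not yet available. Weights 12, 24 and 36 satisfy k <= 10 m
  with m = 2, 3 and 4, so the weak bound decides this identity and the next two.\<close>

lemma hecke_Delta: "hecke_int 2 12 Delta = - 24 * Delta"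
proof (rule mf_eqI_weak [of 12 _ _ 2])
  show "mf 12 (hecke_int 2 12 Delta)" by (intro mf_hecke_int mf_Delta) auto
  show "mf 12 (- 24 * Delta)" using mf_of_int_mult [OF mf_Delta, of "- 24"] by simp
  fix i :: nat assume "i < 2"
  from less_2_cases [OF this] show "fps_nth (hecke_int 2 12 Delta) i = fps_nth (- 24 * Delta) i"
    by (elim disjE; simp only: hecke_int_2_nths generators fps_neg_nth fps_mult_numeral_left mult_minus_left; simp?)
qed auto

lemma hecke_Delta_square: "hecke_int 2 24 (Delta ^ 2) = Delta * E4 ^ 3 + 384 * Delta ^ 2"
proof (rule mf_eqI_weak [of 24 _ _ 3])
  have D2: "mf 24 (Delta ^ 2)" using mf_power [OF mf_Delta, of 2] by simp
  show "mf 24 (hecke_int 2 24 (Delta ^ 2))" by (intro mf_hecke_int D2) auto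
  show "mf 24 (Delta * E4 ^ 3 + 384 * Delta ^ 2)"
    using mf_mult [OF mf_Delta mf_power [OF generators(1), of 3]] D2 by (intro mf_add mf_numeral_mult) auto
  fix i :: nat assume "i < 3"
  from less_3_cases [OF this] show "fps_nth (hecke_int 2 24 (Delta ^ 2)) i = fps_nth (Delta * E4 ^ 3 + 384 * Delta ^ 2) i"
    by (elim disjE; simp only: hecke_int_2_nths generators Delta_square_nth E4_cube_nth Delta_E4_cube_nth fps_add_nth fps_mult_numeral_left; simp?)
qed auto

lemma hecke_Delta_cube: "hecke_int 2 36 (Delta ^ 3) = - 6144 * Delta ^ 3 - 72 * (Delta ^ 2 * E4 ^ 3)"
proof (rule mf_eqI_weak [of 36 _ _ 4])
  have D3: "mf 36 (Delta ^ 3)" using mf_power [OF mf_Delta, of 3] by simp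
  show "mf 36 (hecke_int 2 36 (Delta ^ 3))" by (intro mf_hecke_int D3) auto
  show "mf 36 (- 6144 * Delta ^ 3 - 72 * (Delta ^ 2 * E4 ^ 3))"
    using mf_mult [OF mf_power [OF mf_Delta, of 2] mf_power [OF generators(1), of 3]]
      mf_of_int_mult [OF D3, of "- 6144"] by (intro mf_diff mf_numeral_mult) auto
  fix i :: nat assume "i < 4"
  from less_4_cases [OF this] show "fps_nth (hecke_int 2 36 (Delta ^ 3)) i = fps_nth (- 6144 * Delta ^ 3 - 72 * (Delta ^ 2 * E4 ^ 3)) i"
    by (elim disjE; simp only: hecke_int_2_nths generators Delta_square_nth Delta_cube_nth E4_cube_nth
        fps_sub_nth fps_neg_nth mult_minus_left fps_mult_numeral_left Delta_square_E4_cube_nth; simp?)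
qed auto

lemma hecke_sum_2: "hecke_sum 2 k f z = (2 ^ k * f (2 * z) + f (z / 2) + f ((z + 1) / 2)) / 2"
  by (simp add: hecke_sum_def numeral_eq_Suc add_divide_distrib)

lemma qev_hecke_int_2:
  assumes "mf k G" "k \<ge> 1" "Im z > 0"
  shows "2 * qev (cfps (hecke_int 2 k G)) z =
    2 ^ k * qev (cfps G) (2 * z) + qev (cfps G) (z / 2) + qev (cfps G) ((z + 1) / 2)"
  using assms modular_fps_radius [OF assms(1)]
  by (simp add: cfps_hecke_int qev_hecke_fps hecke_sum_2)

abbreviation qD :: "complex \<Rightarrow> complex" where "qD \<equiv> qev (cfps Delta)"
abbreviation qE4 :: "complex \<Rightarrow> complex" where "qE4 \<equiv> qev (cfps E4)"

text \<open>Newton's identities turn the values of the Hecke operator on the first three powers of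
  the discriminant into the elementary symmetric functions of its three conjugates.\<close>

lemma Delta_conjugates:
  assumes z: "Im z > 0"
  defines "X1 \<equiv> 2 ^ 12 * qD (2 * z)" and "X2 \<equiv> qD (z / 2)" and "X3 \<equiv> qD ((z + 1) / 2)"
  shows "X1 + X2 + X3 = - 48 * qD z"
    "X1 * X2 + X1 * X3 + X2 * X3 = 768 * qD z ^ 2 - qD z * qE4 z ^ 3"
    "X1 * X2 * X3 = - 4096 * qD z ^ 3"
proof -
  have R: "fps_conv_radius (cfps Delta) \<ge> 1" "fps_conv_radius (cfps E4) \<ge> 1"
    using modular_fps_radius mf_Delta generators(1) by blast+
  have I: "Im (2 * z) > 0" "Im (z / 2) > 0" "Im ((z + 1) / 2) > 0" using z by (simp_all add: Im_divide_numeral)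
  \<comment> \<open>In weight 12 n the factor 2^k is (2^12)^n, so the operator sends Delta^n to half
    the n-th power sum of the conjugates.\<close>
  have "2 * qev (cfps (hecke_int 2 (12 * n) (Delta ^ n))) z = X1 ^ n + X2 ^ n + X3 ^ n" if "n \<ge> 1" for n
    using qev_hecke_int_2 [OF mf_power [OF mf_Delta, of n] _ z] that I R
    by (simp add: cfps_power qev_power X1_def X2_def X3_def power_mult_distrib power_mult)
  from this [of 1] this [of 2] this [of 3]
  have p: "X1 + X2 + X3 = 2 * (- 24 * qD z)"
    "X1 ^ 2 + X2 ^ 2 + X3 ^ 2 = 2 * (qD z * qE4 z ^ 3 + 384 * qD z ^ 2)"
    "X1 ^ 3 + X2 ^ 3 + X3 ^ 3 = 2 * (- 6144 * qD z ^ 3 - 72 * (qD z ^ 2 * qE4 z ^ 3))"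
    using R z
    by (simp_all add: hecke_Delta hecke_Delta_square hecke_Delta_cube cfps_hom
        qev_add qev_diff qev_mult qev_power qev_uminus radius_ge_1)
  show 1: "X1 + X2 + X3 = - 48 * qD z" using p(1) by simp
  have "2 * (X1 * X2 + X1 * X3 + X2 * X3) = (X1 + X2 + X3) ^ 2 - (X1 ^ 2 + X2 ^ 2 + X3 ^ 2)"
    by (simp add: power2_eq_square algebra_simps)
  also have "\<dots> = 2 * (768 * qD z ^ 2 - qD z * qE4 z ^ 3)"
    unfolding 1 p(2) by (simp add: power2_eq_square algebra_simps)
  finally show 2: "X1 * X2 + X1 * X3 + X2 * X3 = 768 * qD z ^ 2 - qD z * qE4 z ^ 3"
    by (simp only: mult_cancel_left) simp
  have "3 * (X1 * X2 * X3) = (X1 ^ 3 + X2 ^ 3 + X3 ^ 3) - (X1 + X2 + X3) * ((X1 + X2 + X3) ^ 2 - 3 * (X1 * X2 + X1 * X3 + X2 * X3))"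
    by (simp add: power2_eq_square power3_eq_cube algebra_simps)
  also have "\<dots> = 3 * (- 4096 * qD z ^ 3)"
    unfolding 1 2 p(3) by (simp add: power2_eq_square power3_eq_cube algebra_simps)
  finally show "X1 * X2 * X3 = - 4096 * qD z ^ 3"
    by (simp only: mult_cancel_left) simp
qed

lemma Delta_conjugate_cubic:
  assumes z: "Im z > 0" and X: "X = 2 ^ 12 * qD (2 * z) \<or> X = qD (z / 2) \<or> X = qD ((z + 1) / 2)"
  shows "X ^ 3 = - 48 * qD z * X ^ 2 - (768 * qD z ^ 2 - qD z * qE4 z ^ 3) * X - 4096 * qD z ^ 3"
proof -
  define X1 X2 X3 where "X1 = 2 ^ 12 * qD (2 * z)" and "X2 = qD (z / 2)" and "X3 = qD ((z + 1) / 2)"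
  have "(X - X1) * (X - X2) * (X - X3) = 0" using X by (auto simp: X1_def X2_def X3_def)
  moreover have "(X - X1) * (X - X2) * (X - X3) =
      X ^ 3 - (X1 + X2 + X3) * X ^ 2 + (X1 * X2 + X1 * X3 + X2 * X3) * X - X1 * X2 * X3"
    by (simp add: power2_eq_square power3_eq_cube algebra_simps)
  ultimately show ?thesis
    unfolding X1_def X2_def X3_def Delta_conjugates [OF z] by (simp add: algebra_simps)
qed

text \<open>The zeros of the discriminant are closed under doubling, but near the cusp there are none.\<close>

lemma qD_nonzero:
  assumes z: "Im z > 0"
  shows "qD z \<noteq> 0"
proof
  assume zero: "qD z = 0"
  have R: "fps_conv_radius (cfps Delta) \<ge> 1" using modular_fps_radius mf_Delta by blast
  \<comment> \<open>At the point 2 w one of the conjugates is the value at w, and the product of the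
    conjugates is -4096 times the cube of the value at 2 w.\<close>
  have dbl: "qD (2 * w) = 0" if "Im w > 0" "qD w = 0" for w
    using Delta_conjugates(3) [of "2 * w"] that by simp
  have "qD (of_nat (2 ^ n) * z) = 0" for n
  proof (induction n)
    case (Suc n)
    thus ?case using dbl [of "of_nat (2 ^ n) * z"] z by (simp add: mult_ac)
  qed (use zero in simp)
  hence 0: "eval_fps (cfps Delta) (nome z ^ (2 ^ n)) = 0" for n
    unfolding qev_def nome_of_nat_mult by blast
  \<comment> \<open>Delta does vanish at the cusp, so its factor q is removed: \<open>H\<close> has
    constant term 1 but would vanish along a sequence tending to 0.\<close>
  define H where "H = fps_shift 1 (cfps Delta)"
  have nz: "cfps Delta \<noteq> 0" using generators(11) by (metis cfps_0 cfps_eq_iff fps_zero_nth zero_neq_one)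
  hence sub: "1 \<le> subdegree (cfps Delta)"
    by (intro subdegree_geI) (auto simp: generators)
  have RH: "fps_conv_radius H \<ge> 1" using R by (simp add: H_def)
  have "eval_fps H (nome z ^ (2 ^ n)) = 0" for n
  proof -
    have "Im (of_nat (2 ^ n) * z) > 0" using z by simp
    from nome_less_radius [OF this R] have "ereal (norm (nome z ^ (2 ^ n))) < fps_conv_radius (cfps Delta)"
      by (simp only: nome_of_nat_mult)
    from eval_fps_shift [OF sub this] 0 [of n] show ?thesis by (simp add: H_def)
  qed
  moreover have "(\<lambda>n. nome z ^ (2 ^ n)) \<longlonglongrightarrow> 0"
  proof -
    have "(\<lambda>n. nome z ^ n) \<longlonglongrightarrow> 0" by (rule LIMSEQ_power_zero [OF norm_nome_less_1 [OF z]])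
    moreover have "filterlim (\<lambda>n. 2 ^ n :: nat) sequentially sequentially"
      by (rule filterlim_subseq) (simp add: strict_mono_def)
    ultimately show ?thesis by (rule filterlim_compose)
  qed
  moreover have "isCont (eval_fps H) 0"
    using holomorphic_on_imp_continuous_on [OF holomorphic_eval_fps_disc [OF RH]]
    by (auto simp: continuous_on_eq_continuous_at)
  ultimately have "(\<lambda>n. 0) \<longlonglongrightarrow> eval_fps H 0"
    using isCont_tendsto_compose [of 0 "eval_fps H" "\<lambda>n. nome z ^ (2 ^ n)" sequentially] by simp
  hence "eval_fps H 0 = 0" by (metis LIMSEQ_const_iff)
  moreover have "eval_fps H 0 = 1" by (simp add: eval_fps_at_0 H_def generators_Suc_0)
  ultimately show False by simp
qed

text \<open>The quotient F^12 / Delta^k has weight 0 and order at least 12 m - k > 0 at the cusp. In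
  weight 0 one vanishing coefficient is enough for the weak bound.\<close>

theorem modular_fps_eq_0:
  assumes F: "modular_fps k F" and ord: "\<And>i. i < m \<Longrightarrow> fps_nth F i = 0" and km: "k < 12 * m"
  shows "F = 0"
proof (rule ccontr)
  assume "F \<noteq> 0"
  hence sub: "m \<le> subdegree F" using ord by (intro subdegree_geI) auto
  have RD: "fps_conv_radius (cfps Delta) \<ge> 1" using modular_fps_radius mf_Delta by blast
  have RF: "fps_conv_radius F \<ge> 1" by (rule modular_fps_radius [OF F])
  define D1 where "D1 = fps_shift 1 (cfps Delta)"
  have nz: "cfps Delta \<noteq> 0" using generators(11) by (metis cfps_0 cfps_eq_iff fps_zero_nth zero_neq_one)
  hence subD: "1 \<le> subdegree (cfps Delta)"
    by (intro subdegree_geI) (auto simp: generators)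
  have D: "cfps Delta = D1 * fps_X"
    using fps_shift_times_fps_X_power [OF subD] by (simp add: D1_def)
  have D10: "fps_nth D1 0 = 1" by (simp add: D1_def generators_Suc_0)
  have RD1: "fps_conv_radius D1 \<ge> 1" using RD by (simp add: D1_def)
  have evD1: "eval_fps D1 q \<noteq> 0" if "q \<in> eball 0 1" for q
  proof (cases "q = 0")
    case True thus ?thesis by (simp add: eval_fps_at_0 D10)
  next
    case False
    have "norm q < 1" using that by (simp add: one_ereal_def)
    with False obtain z where z: "Im z > 0" "nome z = q" by (rule nome_surj)
    have "qD z = eval_fps D1 q * q"
      unfolding qev_def D using nome_less_radius [OF z(1) RD1] z(2) by (subst eval_fps_mult) auto
    thus ?thesis using qD_nonzero [OF z(1)] by auto
  qed
  \<comment> \<open>Here the absence of zeros of Delta enters: the inverse of Delta / q converges on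
    the whole unit disc.\<close>
  have "fps_conv_radius (inverse D1) \<ge> min 1 (fps_conv_radius D1)"
    using evD1 D10 by (intro fps_conv_radius_inverse) auto
  hence RI: "fps_conv_radius (inverse D1) \<ge> 1" using RD1 by simp
  define F1 where "F1 = fps_shift m F"
  have F1: "F = F1 * fps_X ^ m" using fps_shift_times_fps_X_power [OF sub] by (simp add: F1_def)
  have RF1: "fps_conv_radius F1 \<ge> 1" using RF by (simp add: F1_def)
  define H where "H = F1 ^ 12 * fps_X ^ (12 * m - k) * inverse D1 ^ k"
  have RH: "fps_conv_radius H \<ge> 1" unfolding H_def using RF1 RI by (intro radius_ge_1) auto
  have HD: "H * cfps Delta ^ k = F ^ 12"
  proof -
    have "inverse D1 * D1 = 1" using D10 by (intro inverse_mult_eq_1) simp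
    hence 1: "inverse D1 ^ k * D1 ^ k = 1" by (simp flip: power_mult_distrib)
    have 2: "fps_X ^ (12 * m - k) * fps_X ^ k = (fps_X ^ m :: complex fps) ^ 12"
      using km by (simp flip: power_add power_mult add: mult.commute)
    have "H * cfps Delta ^ k = F1 ^ 12 * (fps_X ^ (12 * m - k) * fps_X ^ k) * (inverse D1 ^ k * D1 ^ k)"
      unfolding H_def D power_mult_distrib by (simp only: mult_ac)
    thus ?thesis unfolding 1 2 F1 power_mult_distrib by simp
  qed
  have qH: "qev H z * qD z ^ k = qev F z ^ 12" if "Im z > 0" for z
    using arg_cong [OF HD, of "\<lambda>G. qev G z"] that RH RD RF by (simp add: qev_mult qev_power radius_ge_1)
  have "modular_fps 0 H"
    unfolding modular_fps_def
  proof (intro conjI allI impI RH)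
    fix z :: complex assume z: "Im z > 0"
    have Iz: "Im (- 1 / z) > 0" by (rule Im_minus_inverse_pos [OF z])
    have "qev H (- 1 / z) * qD (- 1 / z) ^ k = qev F (- 1 / z) ^ 12" by (rule qH [OF Iz])
    also have "\<dots> = (z ^ k * qev F z) ^ 12" by (simp only: modular_fps_inverse [OF F z])
    also have "\<dots> = (z ^ 12) ^ k * (qev H z * qD z ^ k)"
      unfolding qH [OF z] power_mult_distrib by (simp add: mult.commute flip: power_mult)
    also have "\<dots> = qev H z * (z ^ 12 * qD z) ^ k" by (simp add: power_mult_distrib)
    also have "z ^ 12 * qD z = qD (- 1 / z)" by (rule modular_fps_inverse [OF mf_Delta z, symmetric])
    finally show "qev H (- 1 / z) = z ^ 0 * qev H z"
      using qD_nonzero [OF Iz] by simp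
  qed
  moreover have "fps_nth H i = 0" if "i < 1" for i
    using that km by (simp add: H_def fps_X_power_nth)
  ultimately have "H = 0" by (rule modular_fps_eq_0_weak [where m = 1]) auto
  hence "F ^ 12 = 0" using HD by simp
  thus False using \<open>F \<noteq> 0\<close> by simp
qed

section \<open>Integral bases and the prime 13\<close>

text \<open>Representatives of the even weights modulo 12, with 14 in place of 2 because there is no
  form of weight 2. With this choice every class has a form with constant term 1, and weight 12 d +
  r has cusp forms of dimension exactly d.\<close>

definition residual_weights :: "nat set" where
  "residual_weights = {0, 4, 6, 8, 10, 14}"

definition low_form :: "nat \<Rightarrow> int fps" where
  "low_form r = (if r = 0 then 1 else if r = 4 then E4 else if r = 6 then E6
     else if r = 8 then E4 * E4 else if r = 10 then E4 * E6 else E4 * E4 * E6)"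

text \<open>A substitute, with integral coefficients, for the Eisenstein series of weight 12.\<close>

definition CC :: "int fps" where
  "CC = E4 ^ 3 - 5 * Delta"

lemma residual_weightsE:
  assumes "r \<in> residual_weights"
  obtains "r = 0" | "r = 4" | "r = 6" | "r = 8" | "r = 10" | "r = 14"
  using assms by (auto simp: residual_weights_def)

lemma mf_low_form: "r \<in> residual_weights \<Longrightarrow> mf r (low_form r)"
  using mf_mult [OF generators(1) generators(1)] mf_mult [OF generators(1) generators(2)]
    mf_mult [OF mf_mult [OF generators(1) generators(1)] generators(2)] generators(1,2)
  by (elim residual_weightsE) (simp_all add: low_form_def)

lemma low_form_nth_0: "fps_nth (low_form r) 0 = 1"
  by (simp add: low_form_def generators)

lemma mf_CC: "mf 12 CC"
  unfolding CC_def using mf_power [OF generators(1), of 3] by (intro mf_diff mf_numeral_mult mf_Delta) simp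

lemma CC_nth: "fps_nth CC 0 = 1" "fps_nth CC 1 = 715" "fps_nth CC 2 = 179400"
proof -
  have "fps_nth (E4 ^ 3) 2 = 179280"
    unfolding power3_eq_cube fps_mult_nths generators by simp
  thus "fps_nth CC 0 = 1" "fps_nth CC 1 = 715" "fps_nth CC 2 = 179400"
    unfolding CC_def fps_sub_nth fps_mult_numeral_left E4_cube_nth generators by simp_all
qed

lemma Delta_power_mult_nth:
  "i < m \<Longrightarrow> fps_nth (Delta ^ m * G) i = 0"
  "fps_nth (Delta ^ m * G) m = fps_nth G 0"
proof -
  define D1 where "D1 = fps_shift 1 Delta"
  have "Delta = D1 * fps_X ^ 1"
    unfolding D1_def
    by (rule fps_shift_times_fps_X_power [symmetric], rule subdegree_geI)
       (use generators(10,11) in auto)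
  hence "Delta ^ m = (D1 * fps_X ^ 1) ^ m" by (rule arg_cong)
  hence "Delta ^ m * G = fps_X ^ m * (D1 ^ m * G)"
    by (simp only: power_mult_distrib power_one_right mult_ac)
  moreover have "fps_nth (D1 ^ m * G) 0 = fps_nth G 0"
    by (simp add: D1_def generators_Suc_0 fps_power_zeroth)
  ultimately show "i < m \<Longrightarrow> fps_nth (Delta ^ m * G) i = 0" "fps_nth (Delta ^ m * G) m = fps_nth G 0"
    by (simp_all only: fps_X_power_mult_nth) simp_all
qed

text \<open>There is no form of weight 2: comparing the products of such a form with \<open>E4\<close> and \<open>E6\<close>
  would make \<open>E4 ^ 3\<close> and \<open>E6 ^ 2\<close> proportional.\<close>

lemma modular_fps_eq_0_weight_2:
  assumes F: "modular_fps (12 * m + 2) F" and ord: "\<And>i. i < m \<Longrightarrow> fps_nth F i = 0"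
  shows "F = 0"
proof -
  define c where "c = fps_nth F m"
  have low: "fps_nth (F * G) i = 0" if "i < m" for i G
    using ord that by (simp add: fps_mult_nth)
  have lead: "fps_nth (F * G) m = c * fps_nth G 0" for G
  proof -
    have "fps_nth (F * G) m = (\<Sum>i=0..m. if i = m then c * fps_nth G 0 else 0)"
      unfolding fps_mult_nth using ord by (intro sum.cong) (auto simp: c_def)
    thus ?thesis by simp
  qed
  \<comment> \<open>Both sides have weight 12 m + l with l < 12, so the sharp bound reads the
    coefficients up to index m; the factor \<open>c\<close> makes the last one match.\<close>
  have zero: "F * cfps G = fps_const c * cfps (Delta ^ m * H)"
    if G: "mf k G" "fps_nth G 0 = 1" and H: "mf l H" "fps_nth H 0 = 1" and "l = k + 2" "l < 12" for G H k l
  proof -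
    have "F * cfps G - fps_const c * cfps (Delta ^ m * H) = 0"
    proof (rule modular_fps_eq_0 [where m = "Suc m"])
      have "modular_fps (12 * m + l) (F * cfps G)"
        using modular_fps_mult [OF F G(1)] that by (simp add: ac_simps)
      moreover have "mf (12 * m + l) (Delta ^ m * H)" by (intro mf_mult mf_power mf_Delta H)
      ultimately show "modular_fps (12 * m + l) (F * cfps G - fps_const c * cfps (Delta ^ m * H))"
        by (intro modular_fps_diff modular_fps_cmult)
      show "fps_nth (F * cfps G - fps_const c * cfps (Delta ^ m * H)) i = 0" if "i < Suc m" for i
        using that low lead G H Delta_power_mult_nth(1) [of i m H] Delta_power_mult_nth(2) [of m H]
        by (cases "i = m") auto
    qed (use \<open>l < 12\<close> in auto)
    thus ?thesis by simp
  qed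
  have 1: "F * cfps E4 = fps_const c * cfps (Delta ^ m * E6)"
    by (rule zero [OF generators(1,4) generators(2,7)]) auto
  have 2: "F * cfps E6 = fps_const c * cfps (Delta ^ m * (E4 * E4))"
    using zero [OF generators(2,7) mf_mult [OF generators(1) generators(1)]] generators(4) by simp
  have "fps_const c * cfps (Delta ^ m * (E4 ^ 3 - E6 ^ 2)) =
        fps_const c * cfps (Delta ^ m * (E4 * E4)) * cfps E4 - fps_const c * cfps (Delta ^ m * E6) * cfps E6"
    by (simp add: cfps_hom power2_eq_square power3_eq_cube algebra_simps)
  also have "\<dots> = 0" unfolding 1 [symmetric] 2 [symmetric] by (simp add: mult_ac)
  finally have "fps_const c * cfps (Delta ^ m * (1728 * Delta)) = 0" unfolding generators(3) .
  moreover have "Delta \<noteq> 0" using generators(11) by auto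
  hence "cfps (Delta ^ m * (1728 * Delta)) \<noteq> 0" by (metis cfps_0 cfps_eq_iff mult_eq_0_iff power_not_zero zero_neq_numeral)
  ultimately have "F * cfps E4 = 0" using 1 by simp
  moreover have "cfps E4 \<noteq> 0" using generators(4) by (metis cfps_0 cfps_eq_iff fps_zero_nth zero_neq_one)
  ultimately show ?thesis by simp
qed

text \<open>For r = 14 the general bound would ask for one more coefficient. Reading the weight as
  12 (d + 1) + 2 saves it, by \<open>modular_fps_eq_0_weight_2\<close>.\<close>

theorem modular_fps_valence:
  assumes F: "modular_fps (12 * d + r) F" and r: "r \<in> residual_weights"
    and ord: "\<And>i. i \<le> d \<Longrightarrow> fps_nth F i = 0"
  shows "F = 0"
proof (cases "r = 14")
  case True
  hence "12 * d + r = 12 * Suc d + 2" by simp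
  with F ord show ?thesis using modular_fps_eq_0_weight_2 [of "Suc d" F] by (metis less_Suc_eq_le)
next
  case False
  hence "r < 12" using r by (auto simp: residual_weights_def)
  thus ?thesis using F ord by (intro modular_fps_eq_0 [OF F, of "Suc d"]) auto
qed

lemma mf_valence:
  assumes "mf (12 * d + r) F" "mf (12 * d + r) G" and r: "r \<in> residual_weights"
    and "\<And>i. i \<le> d \<Longrightarrow> fps_nth F i = fps_nth G i"
  shows "F = G"
proof -
  have "cfps F - cfps G = 0"
    by (rule modular_fps_valence [OF modular_fps_diff [OF assms(1,2)] r]) (use assms(4) in simp)
  thus ?thesis by simp
qed

definition basis_form :: "nat \<Rightarrow> nat \<Rightarrow> nat \<Rightarrow> int fps" where
  "basis_form d r j = Delta ^ j * (CC ^ (d - j) * low_form r)"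

lemma mf_basis_form:
  assumes "r \<in> residual_weights" "j \<le> d"
  shows "mf (12 * d + r) (basis_form d r j)"
proof -
  have "mf (12 * j + (12 * (d - j) + r)) (basis_form d r j)"
    unfolding basis_form_def by (intro mf_mult mf_power mf_Delta mf_CC mf_low_form assms)
  moreover have "12 * j + (12 * (d - j) + r) = 12 * d + r" using assms(2) by simp
  ultimately show ?thesis by simp
qed

lemma basis_form_nth:
  "i < j \<Longrightarrow> fps_nth (basis_form d r j) i = 0"
  "fps_nth (basis_form d r j) j = 1"
  unfolding basis_form_def
  by (simp_all add: Delta_power_mult_nth low_form_nth_0 CC_nth fps_power_zeroth)

text \<open>The basis forms are in echelon shape, so subtracting multiples of them clears one
  coefficient at a time. Once those up to index d are gone, the valence bound removes the
  remainder.\<close>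

lemma basis_form_spans:
  assumes F: "modular_fps (12 * d + r) F" and r: "r \<in> residual_weights" and F0: "fps_nth F 0 = 0"
  obtains c where "F = (\<Sum>i<d. fps_const (c i) * cfps (basis_form d r (Suc i)))"
proof -
  have "\<exists>c. \<forall>i\<le>n. fps_nth (F - (\<Sum>i<n. fps_const (c i) * cfps (basis_form d r (Suc i)))) i = 0"
    if "n \<le> d" for n
    using that
  proof (induction n)
    case 0 thus ?case using F0 by simp
  next
    case (Suc n)
    then obtain c where c: "\<And>i. i \<le> n \<Longrightarrow> fps_nth (F - (\<Sum>i<n. fps_const (c i) * cfps (basis_form d r (Suc i)))) i = 0"
      by auto
    define a where "a = fps_nth (F - (\<Sum>i<n. fps_const (c i) * cfps (basis_form d r (Suc i)))) (Suc n)"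
    define c' where "c' = c(n := a)"
    have "(\<Sum>i<Suc n. fps_const (c' i) * cfps (basis_form d r (Suc i))) =
          (\<Sum>i<n. fps_const (c i) * cfps (basis_form d r (Suc i))) + fps_const a * cfps (basis_form d r (Suc n))"
      by (simp add: c'_def)
    hence eq: "F - (\<Sum>i<Suc n. fps_const (c' i) * cfps (basis_form d r (Suc i))) =
          (F - (\<Sum>i<n. fps_const (c i) * cfps (basis_form d r (Suc i)))) - fps_const a * cfps (basis_form d r (Suc n))"
      by simp
    have "fps_nth (F - (\<Sum>i<Suc n. fps_const (c' i) * cfps (basis_form d r (Suc i)))) i = 0" if "i \<le> Suc n" for i
    proof (cases "i = Suc n")
      case True
      thus ?thesis unfolding eq fps_sub_nth [of "F - _"] True a_def [symmetric] by (simp add: basis_form_nth)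
    next
      case False
      hence "i \<le> n" using that by simp
      from c [OF this] \<open>i \<le> n\<close> show ?thesis
        unfolding eq fps_sub_nth [of "F - _"] by (simp add: basis_form_nth)
    qed
    thus ?case by blast
  qed
  from this [of d] obtain c where
    c: "\<And>i. i \<le> d \<Longrightarrow> fps_nth (F - (\<Sum>i<d. fps_const (c i) * cfps (basis_form d r (Suc i)))) i = 0" by auto
  have "F - (\<Sum>i<d. fps_const (c i) * cfps (basis_form d r (Suc i))) = 0"
  proof (rule modular_fps_valence [OF _ r c])
    have "modular_fps (12 * d + r) (\<Sum>i<d. fps_const (c i) * cfps (basis_form d r (Suc i)))"
      by (rule modular_fps_sum, rule modular_fps_cmult, rule mf_basis_form [OF r]) simp
    thus "modular_fps (12 * d + r) (F - (\<Sum>i<d. fps_const (c i) * cfps (basis_form d r (Suc i))))"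
      by (rule modular_fps_diff [OF F])
  qed
  thus ?thesis using that by simp
qed

text \<open>As the leading coefficients are 1, the coordinates can be solved for one by one without
  division, so a common divisor of the coefficients of \<open>G\<close> passes to them. With m = 13
  this carries congruences of forms over to the matrix; with m = 0 it is linear
  independence.\<close>

lemma basis_form_coeff_dvd:
  assumes eq: "(\<Sum>i<d. fps_const (c i) * cfps (basis_form d r (Suc i))) = cfps G"
    and dvd: "\<And>n. m dvd fps_nth G n"
  shows "i < d \<Longrightarrow> \<exists>z. c i = of_int (m * z)"
proof (induction i rule: less_induct)
  case (less i)
  have "\<exists>z. \<forall>j<i. c j = of_int (m * z j)" using less by (metis less_trans)
  then obtain z where z: "\<And>j. j < i \<Longrightarrow> c j = of_int (m * z j)" by blast
  obtain g where g: "fps_nth G (Suc i) = m * g" using dvd by blast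
  have "of_int (fps_nth G (Suc i)) = (\<Sum>j<d. c j * of_int (fps_nth (basis_form d r (Suc j)) (Suc i)))"
    using arg_cong [OF eq, of "\<lambda>F. fps_nth F (Suc i)"] by (simp add: fps_sum_nth)
  also have "\<dots> = (\<Sum>j\<le>i. c j * of_int (fps_nth (basis_form d r (Suc j)) (Suc i)))"
    by (rule sum.mono_neutral_right) (use less.prems in \<open>auto simp: basis_form_nth\<close>)
  also have "\<dots> = c i + (\<Sum>j<i. c j * of_int (fps_nth (basis_form d r (Suc j)) (Suc i)))"
    by (simp add: lessThan_Suc_atMost [symmetric] basis_form_nth)
  also have "(\<Sum>j<i. c j * of_int (fps_nth (basis_form d r (Suc j)) (Suc i))) =
             of_int (m * (\<Sum>j<i. z j * fps_nth (basis_form d r (Suc j)) (Suc i)))"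
    using z by (simp add: sum_distrib_left mult.assoc)
  finally have "c i = of_int (m * (g - (\<Sum>j<i. z j * fps_nth (basis_form d r (Suc j)) (Suc i))))"
    by (simp add: g algebra_simps)
  thus ?case by blast
qed

section \<open>Congruences of power series, and \<open>CC\<close> modulo 13\<close>

definition fps_cong :: "int \<Rightarrow> int fps \<Rightarrow> int fps \<Rightarrow> bool" where
  "fps_cong m F G \<longleftrightarrow> (\<forall>n. [fps_nth F n = fps_nth G n] (mod m))"

lemma fps_cong_refl [simp, intro]: "fps_cong m F F"
  by (simp add: fps_cong_def)

lemma fps_cong_sym: "fps_cong m F G \<Longrightarrow> fps_cong m G F"
  by (simp add: fps_cong_def cong_sym)

lemma fps_cong_trans: "fps_cong m F G \<Longrightarrow> fps_cong m G H \<Longrightarrow> fps_cong m F H"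
  unfolding fps_cong_def by (meson cong_trans)

lemma fps_cong_mult: "fps_cong m F G \<Longrightarrow> fps_cong m F' G' \<Longrightarrow> fps_cong m (F * F') (G * G')"
  unfolding fps_cong_def fps_mult_nth by (intro allI cong_sum cong_mult) auto

lemma fps_cong_power: "fps_cong m F G \<Longrightarrow> fps_cong m (F ^ n) (G ^ n)"
  by (induction n) (auto intro: fps_cong_mult)

lemma fps_cong_sum: "(\<And>i. i \<in> I \<Longrightarrow> fps_cong m (F i) (G i)) \<Longrightarrow> fps_cong m (\<Sum>i\<in>I. F i) (\<Sum>i\<in>I. G i)"
  unfolding fps_cong_def fps_sum_nth by (intro allI cong_sum) auto

text \<open>The operator at \<open>p\<close> commutes with the one at 2, and the two eigenvalues \<open>1 + 2 ^ 11\<close> and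
  \<open>- 24\<close> of the latter are distinct modulo 13; hence \<open>CC\<close> is an eigenform modulo 13.\<close>

lemma hecke_CC:
  assumes p: "prime p"
  obtains y where "hecke_int p 12 CC = of_int (1 + int p ^ 11) * CC + of_int (13 * y) * Delta"
proof -
  have H: "hecke_int q 12 CC = of_int (1 + int q ^ 11) * CC + of_int (fps_nth CC q - (1 + int q ^ 11) * 715) * Delta"
    if q: "prime q" for q
  proof (rule mf_eqI_weak [where m = 2 and k = 12])
    show "mf 12 (hecke_int q 12 CC)" by (intro mf_hecke_int mf_CC q) auto
    show "mf 12 (of_int (1 + int q ^ 11) * CC + of_int (fps_nth CC q - (1 + int q ^ 11) * 715) * Delta)"
      by (intro mf_add mf_of_int_mult mf_CC mf_Delta)
    fix i :: nat assume "i < 2"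
    have "\<not> q dvd 1" using q by auto
    with less_2_cases [OF \<open>i < 2\<close>] show "fps_nth (hecke_int q 12 CC) i = fps_nth (of_int (1 + int q ^ 11) * CC +
        of_int (fps_nth CC q - (1 + int q ^ 11) * 715) * Delta) i"
      by (elim disjE; simp only: hecke_int_nth fps_add_nth fps_nth_of_int_mult CC_nth generators; simp add: CC_nth algebra_simps)
  qed auto
  define y where "y q = fps_nth CC q - (1 + int q ^ 11) * 715" for q
  have y2: "y 2 = - 1285635" by (simp add: y_def CC_nth)
  have "13 dvd y p"
  proof (cases "p = 2")
    case True thus ?thesis using y2 by simp
  next
    case False
    hence "\<not> p dvd 2" using p by (metis primes_dvd_imp_eq two_is_prime_nat)
    \<comment> \<open>The coefficient at 2 p is read off first from the operator at p, then from the
      operator at 2; this is how their commutation enters.\<close>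
    hence 1: "fps_nth CC (p * 2) = (1 + int p ^ 11) * 179400 + y p * (- 24)"
      using arg_cong [OF H [OF p], of "\<lambda>F. fps_nth F 2"]
      unfolding y_def [symmetric] fps_add_nth fps_nth_of_int_mult hecke_int_nth CC_nth generators by simp
    have "\<not> 2 dvd p" using False p by (metis primes_dvd_imp_eq two_is_prime_nat)
    hence 2: "fps_nth CC (2 * p) = 2049 * fps_nth CC p + y 2 * fps_nth Delta p"
      using arg_cong [OF H [OF two_is_prime_nat], of "\<lambda>F. fps_nth F p"]
      unfolding y_def [symmetric] fps_add_nth fps_nth_of_int_mult hecke_int_nth by simp
    have 3: "fps_nth CC p = y p + 715 * (1 + int p ^ 11)" by (simp add: y_def)
    have 4: "p * 2 = 2 * p" by simp
    define A where "A = 1 + int p ^ 11"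
    have "2073 * y p = 13 * (13800 * A - 112695 * A + 98895 * fps_nth Delta p)"
      using 1 2 3 unfolding y2 4 A_def [symmetric] by (simp add: algebra_simps)
    \<comment> \<open>11 inverts 2073 modulo 13, as 11 * 2073 = 13 * 1754 + 1. The factor 2073 =
      2049 + 24 is the difference of the two eigenvalues.\<close>
    hence "y p = 13 * (11 * (13800 * A - 112695 * A + 98895 * fps_nth Delta p) - 1754 * y p)"
      by simp
    thus ?thesis by (rule dvdI)
  qed
  then obtain z where "y p = 13 * z" by blast
  with H [OF p] that show ?thesis by (metis y_def)
qed

text \<open>The induction starts from 715 = 13 * 55. For n = p m the Hecke relation expresses the
  coefficient at n through those at m and m / p, up to a multiple of 13.\<close>

lemma CC_nth_dvd: "n \<ge> 1 \<Longrightarrow> 13 dvd fps_nth CC n"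
proof (induction n rule: less_induct)
  case (less n)
  show ?case
  proof (cases "n = 1")
    case True thus ?thesis by (simp add: CC_nth [unfolded One_nat_def])
  next
    case False
    then obtain p where p: "prime p" "p dvd n" using prime_factor_nat by blast
    then obtain m where m: "n = p * m" by blast
    have p1: "p > 1" using p prime_gt_1_nat by blast
    obtain y where y: "hecke_int p 12 CC = of_int (1 + int p ^ 11) * CC + of_int (13 * y) * Delta"
      using hecke_CC [OF p(1)] .
    have 1: "13 dvd fps_nth CC m" by (rule less.IH) (use m p1 less.prems in auto)
    have 2: "13 dvd (if p dvd m then fps_nth CC (m div p) else 0)"
    proof (cases "p dvd m")
      case True
      have "m div p < n" using m p1 less.prems by (intro le_less_trans [OF div_le_dividend]) auto
      moreover have "m div p \<ge> 1" using m less.prems True dvd_imp_le [of p m] p1 by (simp add: Suc_le_eq div_greater_zero_iff)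
      ultimately show ?thesis using less.IH True by simp
    qed simp
    have "fps_nth CC n = (1 + int p ^ 11) * fps_nth CC m + 13 * y * fps_nth Delta m -
            int p ^ 11 * (if p dvd m then fps_nth CC (m div p) else 0)"
      using arg_cong [OF y, of "\<lambda>F. fps_nth F m"]
      unfolding fps_add_nth fps_nth_of_int_mult hecke_int_nth m by simp
    also have "13 dvd \<dots>" using 1 2 by (intro dvd_diff dvd_add) (auto simp: mult.assoc)
    finally show ?thesis .
  qed
qed

lemma CC_cong_1: "fps_cong 13 CC 1"
  unfolding fps_cong_def
proof
  fix n show "[fps_nth CC n = fps_nth 1 n] (mod 13)"
    using CC_nth_dvd [of n] CC_nth(1) by (cases "n = 0") (auto simp: cong_0_iff)
qed

section \<open>The Hecke operator at 2 on powers of the discriminant\<close>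

text \<open>\<open>T n\<close> is half the sum of X^n Y over the three conjugates X of Delta and the
  matching conjugates Y of \<open>G\<close>, so the cubic equation for X becomes a linear
  recurrence. The constant 763 is 768 - 5, from E4^3 = CC + 5 Delta.\<close>

lemma hecke_Delta_power_recurrence:
  fixes w j :: nat
  assumes G: "fps_conv_radius G \<ge> 1"
  defines "T \<equiv> \<lambda>n. hecke_fps 2 (12 * n + w) (cfps Delta ^ n * G)"
  shows "T (j + 3) = - 48 * cfps Delta * T (j + 2)
    - (763 * cfps Delta ^ 2 - cfps Delta * cfps CC) * T (j + 1) - 4096 * cfps Delta ^ 3 * T j"
proof -
  let ?D = "cfps Delta"
  have R: "fps_conv_radius ?D \<ge> 1" "fps_conv_radius (cfps CC) \<ge> 1" "fps_conv_radius (cfps E4) \<ge> 1"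
    using modular_fps_radius mf_Delta mf_CC generators(1) by blast+
  have RT: "fps_conv_radius (T n) \<ge> 1" for n
    unfolding T_def by (intro hecke_fps_radius radius_ge_1 R G) simp
  have num: "fps_conv_radius (numeral n :: complex fps) \<ge> 1" for n by simp
  note rad = radius_ge_1 R RT num
  have "T (j + 3) + 48 * ?D * T (j + 2) + (763 * ?D ^ 2 - ?D * cfps CC) * T (j + 1) + 4096 * ?D ^ 3 * T j = 0"
  proof (rule qev_eqI)
    show "fps_conv_radius (T (j + 3) + 48 * ?D * T (j + 2) + (763 * ?D ^ 2 - ?D * cfps CC) * T (j + 1) + 4096 * ?D ^ 3 * T j) \<ge> 1"
      by (intro rad)
    fix z :: complex assume z: "Im z > 0"
    have I: "Im (2 * z) > 0" "Im (z / 2) > 0" "Im ((z + 1) / 2) > 0" using z by (simp_all add: Im_divide_numeral)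
    define X1 X2 X3 where "X1 = 2 ^ 12 * qD (2 * z)" and "X2 = qD (z / 2)" and "X3 = qD ((z + 1) / 2)"
    define Y1 Y2 Y3 where "Y1 = 2 ^ w * qev G (2 * z)" and "Y2 = qev G (z / 2)" and "Y3 = qev G ((z + 1) / 2)"
    define p where "p X = X ^ 3 + 48 * qD z * X ^ 2 + (768 * qD z ^ 2 - qD z * qE4 z ^ 3) * X + 4096 * qD z ^ 3" for X
    have T: "qev (T n) z = (X1 ^ n * Y1 + X2 ^ n * Y2 + X3 ^ n * Y3) / 2" for n
    proof -
      have "qev (T n) z = hecke_sum 2 (12 * n + w) (qev (?D ^ n * G)) z"
        unfolding T_def by (rule qev_hecke_fps) (use z in \<open>auto intro!: radius_ge_1 R G\<close>)
      moreover have "(2::complex) ^ (12 * n) = 4096 ^ n" by (simp add: power_mult)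
      ultimately show ?thesis using I R G
        by (simp add: hecke_sum_2 qev_mult qev_power radius_ge_1 X1_def X2_def X3_def Y1_def Y2_def Y3_def
            power_add power_mult_distrib mult_ac)
    qed
    have C: "qev (cfps CC) z = qE4 z ^ 3 - 5 * qD z"
      using z R by (simp add: CC_def cfps_hom qev_diff qev_mult qev_power radius_ge_1)
    have "p X = 0" if "X = 2 ^ 12 * qD (2 * z) \<or> X = qD (z / 2) \<or> X = qD ((z + 1) / 2)" for X
      unfolding p_def Delta_conjugate_cubic [OF z that] by (simp add: algebra_simps)
    hence p0: "p X1 = 0" "p X2 = 0" "p X3 = 0"
      by (simp_all add: X1_def X2_def X3_def)
    have "qev (T (j + 3) + 48 * ?D * T (j + 2) + (763 * ?D ^ 2 - ?D * cfps CC) * T (j + 1) + 4096 * ?D ^ 3 * T j) z =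
      qev (T (j + 3)) z + 48 * qD z * qev (T (j + 2)) z + (763 * qD z ^ 2 - qD z * qev (cfps CC) z) * qev (T (j + 1)) z
        + 4096 * qD z ^ 3 * qev (T j) z"
      using z rad by (simp add: qev_add qev_diff qev_mult qev_power)
    also have "\<dots> = (X1 ^ j * Y1 * p X1 + X2 ^ j * Y2 * p X2 + X3 ^ j * Y3 * p X3) / 2"
      unfolding T C p_def by (simp add: power_add power2_eq_square power3_eq_cube field_simps)
    finally show "qev (T (j + 3) + 48 * ?D * T (j + 2) + (763 * ?D ^ 2 - ?D * cfps CC) * T (j + 1) + 4096 * ?D ^ 3 * T j) z = qev 0 z"
      by (simp add: p0)
  qed simp
  thus ?thesis by (simp add: algebra_simps eq_neg_iff_add_eq_0)
qed

definition hecke_Delta_power :: "nat \<Rightarrow> nat \<Rightarrow> int fps" where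
  "hecke_Delta_power r j = hecke_int 2 (12 * j + r) (Delta ^ j * low_form r)"

lemma cfps_hecke_Delta_power:
  "j \<ge> 1 \<Longrightarrow> cfps (hecke_Delta_power r j) = hecke_fps 2 (12 * j + r) (cfps Delta ^ j * cfps (low_form r))"
  by (simp add: hecke_Delta_power_def cfps_hecke_int cfps_hom)

lemma hecke_Delta_power_rec:
  assumes r: "r \<in> residual_weights" and j: "j \<ge> 1"
  shows "hecke_Delta_power r (j + 3) = - 48 * Delta * hecke_Delta_power r (j + 2)
    - (763 * Delta ^ 2 - Delta * CC) * hecke_Delta_power r (j + 1) - 4096 * Delta ^ 3 * hecke_Delta_power r j"
proof -
  have "cfps (hecke_Delta_power r (j + 3)) = cfps (- 48 * Delta * hecke_Delta_power r (j + 2)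
    - (763 * Delta ^ 2 - Delta * CC) * hecke_Delta_power r (j + 1) - 4096 * Delta ^ 3 * hecke_Delta_power r j)"
    using hecke_Delta_power_recurrence [OF modular_fps_radius [OF mf_low_form [OF r]], where w = r and j = j] j
    by (simp only: cfps_hom cfps_hecke_Delta_power le_add2 trans_le_add1)
  thus ?thesis by (simp only: cfps_eq_iff)
qed

text \<open>With d = 0 the valence bound reads only the constant term. In weight 0 the eigenvalue is
  3/2, so the identity is one of complex series.\<close>

lemma hecke_low_form:
  assumes r: "r \<in> residual_weights"
  shows "hecke_fps 2 r (cfps (low_form r)) = fps_const (1 + 2 ^ r / 2) * cfps (low_form r)"
proof -
  have m: "modular_fps (12 * 0 + r) (cfps (low_form r))" using mf_low_form [OF r] by simp
  have "hecke_fps 2 r (cfps (low_form r)) - fps_const (1 + 2 ^ r / 2) * cfps (low_form r) = 0"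
  proof (rule modular_fps_valence [OF _ r])
    show "modular_fps (12 * 0 + r) (hecke_fps 2 r (cfps (low_form r)) - fps_const (1 + 2 ^ r / 2) * cfps (low_form r))"
      using modular_fps_hecke [OF m two_is_prime_nat] modular_fps_cmult [OF m] by (intro modular_fps_diff) simp_all
  qed (simp add: hecke_fps_nth low_form_nth_0)
  thus ?thesis by simp
qed

text \<open>The recurrence at index 0 involves the operator in weight r, whose eigenvalue 1 + 2^r /
  2 is not integral for r = 0; the factor 4096 restores integrality.\<close>

lemma hecke_Delta_power_3:
  assumes r: "r \<in> residual_weights"
  shows "hecke_Delta_power r 3 = - 48 * Delta * hecke_Delta_power r 2
    - (763 * Delta ^ 2 - Delta * CC) * hecke_Delta_power r 1
    - of_int (4096 + 2048 * 2 ^ r) * (Delta ^ 3 * low_form r)"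
proof -
  have 3: "cfps (hecke_Delta_power r 3) = hecke_fps 2 (12 * 3 + r) (cfps Delta ^ 3 * cfps (low_form r))"
    and 2: "cfps (hecke_Delta_power r 2) = hecke_fps 2 (12 * 2 + r) (cfps Delta ^ 2 * cfps (low_form r))"
    and 1: "cfps (hecke_Delta_power r 1) = hecke_fps 2 (12 * 1 + r) (cfps Delta ^ 1 * cfps (low_form r))"
    by (rule cfps_hecke_Delta_power, simp)+
  have c: "4096 * fps_const (1 + 2 ^ r / 2) = cfps (of_int (4096 + 2048 * 2 ^ r))"
    unfolding cfps_of_int by (simp add: numeral_fps_const algebra_simps)
  have "cfps (hecke_Delta_power r 3) = - 48 * cfps Delta * cfps (hecke_Delta_power r 2)
    - (763 * cfps Delta ^ 2 - cfps Delta * cfps CC) * cfps (hecke_Delta_power r 1)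
    - 4096 * cfps Delta ^ 3 * hecke_fps 2 r (cfps (low_form r))"
    using hecke_Delta_power_recurrence [OF modular_fps_radius [OF mf_low_form [OF r]], where w = r and j = 0]
    unfolding 1 2 3 by (simp add: power2_eq_square)
  also have "4096 * cfps Delta ^ 3 * hecke_fps 2 r (cfps (low_form r)) =
      (4096 * fps_const (1 + 2 ^ r / 2)) * (cfps Delta ^ 3 * cfps (low_form r))"
    unfolding hecke_low_form [OF r] by (simp only: mult_ac)
  finally have "cfps (hecke_Delta_power r 3) = cfps (- 48 * Delta * hecke_Delta_power r 2
    - (763 * Delta ^ 2 - Delta * CC) * hecke_Delta_power r 1
    - of_int (4096 + 2048 * 2 ^ r) * (Delta ^ 3 * low_form r))"
    unfolding c by (simp only: cfps_hom)
  thus ?thesis by (simp only: cfps_eq_iff)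
qed

text \<open>\<open>comb r j l F\<close>: the form \<open>F\<close> is an integral combination of the cuspidal basis forms of weight
  \<open>12 * j + r\<close>, with coefficient \<open>l\<close> at the one of highest order. As \<open>CC\<close> is 1 modulo 13, this
  coefficient is the eigenvalue on the quotient by the forms of weight smaller by 12.\<close>

definition comb :: "nat \<Rightarrow> nat \<Rightarrow> int \<Rightarrow> int fps \<Rightarrow> bool" where
  "comb r j l F \<longleftrightarrow> (\<exists>c. F = (\<Sum>i=1..j. of_int (c i) * basis_form j r i) \<and> c j = l)"

lemma comb_add:
  assumes "comb r j l F" "comb r j l' G"
  shows "comb r j (l + l') (F + G)"
proof -
  obtain c c' where "F = (\<Sum>i=1..j. of_int (c i) * basis_form j r i)" "c j = l"
    "G = (\<Sum>i=1..j. of_int (c' i) * basis_form j r i)" "c' j = l'"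
    using assms by (auto simp: comb_def)
  thus ?thesis unfolding comb_def
    by (intro exI [of _ "\<lambda>i. c i + c' i"]) (simp add: ring_distribs sum.distrib)
qed

lemma comb_scale:
  assumes "comb r j l F"
  shows "comb r j (a * l) (of_int a * F)"
proof -
  obtain c where "F = (\<Sum>i=1..j. of_int (c i) * basis_form j r i)" "c j = l"
    using assms by (auto simp: comb_def)
  thus ?thesis unfolding comb_def
    by (intro exI [of _ "\<lambda>i. a * c i"]) (simp add: sum_distrib_left mult.assoc)
qed

lemma comb_Delta:
  assumes "comb r j l F" "j \<ge> 1"
  shows "comb r (Suc j) l (Delta * F)"
proof -
  obtain c where c: "F = (\<Sum>i=1..j. of_int (c i) * basis_form j r i)" "c j = l"
    using assms by (auto simp: comb_def)
  define c' where "c' i = (if i = 1 then 0 else c (i - 1))" for i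
  have "(\<Sum>i=1..Suc j. of_int (c' i) * basis_form (Suc j) r i) =
        of_int (c' 1) * basis_form (Suc j) r 1 + (\<Sum>i=Suc 1..Suc j. of_int (c' i) * basis_form (Suc j) r i)"
    by (rule sum.atLeast_Suc_atMost) simp
  also have "\<dots> = (\<Sum>i=1..j. of_int (c' (Suc i)) * basis_form (Suc j) r (Suc i))"
    by (subst sum.shift_bounds_cl_Suc_ivl) (simp add: c'_def)
  also have "\<dots> = Delta * F"
    unfolding c sum_distrib_left
    by (intro sum.cong) (auto simp: c'_def basis_form_def mult_ac)
  finally show ?thesis unfolding comb_def using c(2) assms(2)
    by (intro exI [of _ c']) (auto simp: c'_def)
qed

text \<open>The factor \<open>CC\<close> raises the weight but not the order at the cusp, so the top
  coefficient in the new weight is 0. Hence the term with \<open>Delta * CC\<close> leaves no trace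
  in the recurrence for the eigenvalues.\<close>

lemma comb_CC:
  assumes "comb r j l F"
  shows "comb r (Suc j) 0 (CC * F)"
proof -
  obtain c where c: "F = (\<Sum>i=1..j. of_int (c i) * basis_form j r i)" "c j = l"
    using assms by (auto simp: comb_def)
  have "(\<Sum>i=1..Suc j. of_int ((c(Suc j := 0)) i) * basis_form (Suc j) r i) =
        (\<Sum>i=1..j. of_int (c i) * basis_form (Suc j) r i)"
    by (simp add: sum.cl_ivl_Suc)
  also have "\<dots> = CC * F"
    unfolding c sum_distrib_left
    by (intro sum.cong) (auto simp: basis_form_def Suc_diff_le mult_ac)
  finally show ?thesis unfolding comb_def
    by (intro exI [of _ "c(Suc j := 0)"]) simp
qed

text \<open>The period 14 stems from the recurrence: modulo 13 its characteristic polynomial is (X +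
  1)(X^2 + 8 X + 1), and the quadratic factor is irreducible with roots of norm 1 in the field with
  169 elements, so their order divides 14. As the table has period 14, fourteen instances settle the
  claim.\<close>

lemma root_seq_rec:
  assumes r: "r \<in> residual_weights" and j: "j \<ge> 1"
  shows "[- 48 * root_seq r (j + 2) - 763 * root_seq r (j + 1) - 4096 * root_seq r j = root_seq r (j + 3)] (mod 13)"
proof -
  define m where "m = (j - 1) mod 14"
  have "\<forall>m\<in>{..<14}. [- 48 * root_table (r mod 12) ! ((m + 2) mod 14) - 763 * root_table (r mod 12) ! ((m + 1) mod 14)
      - 4096 * root_table (r mod 12) ! m = root_table (r mod 12) ! ((m + 3) mod 14)] (mod 13)"
    using r by (elim residual_weightsE; simp add: root_table_def lessThan_nat_numeral lessThan_Suc cong_def)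
  moreover have "m \<in> {..<14}" by (simp add: m_def)
  ultimately have key: "[- 48 * root_table (r mod 12) ! ((m + 2) mod 14) - 763 * root_table (r mod 12) ! ((m + 1) mod 14)
      - 4096 * root_table (r mod 12) ! m = root_table (r mod 12) ! ((m + 3) mod 14)] (mod 13)"
    by blast
  have e: "(j + i - 1) mod 14 = (m + i) mod 14" for i
    using j by (simp add: m_def mod_add_left_eq)
  have *: "root_seq r (j + i) = root_table (r mod 12) ! ((m + i) mod 14)" for i
    unfolding root_seq_def e ..
  have **: "root_seq r j = root_table (r mod 12) ! m"
    unfolding root_seq_def m_def ..
  show ?thesis unfolding * ** by (rule key)
qed

text \<open>The last term of the recurrence is kept as an arbitrary \<open>F0\<close>, since it
  takes a different shape when the recurrence starts at index 0.\<close>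

lemma comb_hecke_Delta_power_step:
  assumes F: "comb r (Suc (Suc j)) l2 F2" "comb r (Suc j) l1 F1" "comb r (Suc (Suc (Suc j))) l0 F0"
  shows "comb r (Suc (Suc (Suc j))) (- 48 * l2 - 763 * l1 - l0)
           (- 48 * Delta * F2 - (763 * Delta ^ 2 - Delta * CC) * F1 - F0)"
proof -
  have 1: "comb r (Suc (Suc (Suc j))) (- 48 * l2) (of_int (- 48) * (Delta * F2))"
    by (intro comb_scale comb_Delta F) simp
  have 2: "comb r (Suc (Suc (Suc j))) (- 763 * l1) (of_int (- 763) * (Delta * (Delta * F1)))"
    by (intro comb_scale comb_Delta F) simp_all
  have 3: "comb r (Suc (Suc (Suc j))) 0 (Delta * (CC * F1))"
    by (intro comb_Delta comb_CC [OF F(2)]) simp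
  have 4: "comb r (Suc (Suc (Suc j))) (- 1 * l0) (of_int (- 1) * F0)"
    by (intro comb_scale F)
  have "comb r (Suc (Suc (Suc j))) (- 48 * l2 + - 763 * l1 + 0 + - 1 * l0)
     (of_int (- 48) * (Delta * F2) + of_int (- 763) * (Delta * (Delta * F1)) + Delta * (CC * F1) + of_int (- 1) * F0)"
    by (intro comb_add 1 2 3 4)
  moreover have "of_int (- 48) * (Delta * F2) + of_int (- 763) * (Delta * (Delta * F1)) + Delta * (CC * F1) + of_int (- 1) * F0
      = - 48 * Delta * F2 - (763 * Delta ^ 2 - Delta * CC) * F1 - F0"
    by (simp add: power2_eq_square algebra_simps)
  moreover have "- 48 * l2 + - 763 * l1 + 0 + - 1 * l0 = - 48 * l2 - 763 * l1 - l0" by simp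
  ultimately show ?thesis by (simp only:)
qed

lemma low_form_nth_1_2:
  "fps_nth (low_form 0) 1 = 0" "fps_nth (low_form 0) 2 = 0"
  "fps_nth (low_form 4) 1 = 240" "fps_nth (low_form 4) 2 = 2160"
  "fps_nth (low_form 6) 1 = - 504" "fps_nth (low_form 6) 2 = - 16632"
  "fps_nth (low_form 8) 1 = 480" "fps_nth (low_form 8) 2 = 61920"
  "fps_nth (low_form 10) 1 = - 264" "fps_nth (low_form 10) 2 = - 135432"
  "fps_nth (low_form 14) 1 = - 24" "fps_nth (low_form 14) 2 = - 196632"
proof -
  show "fps_nth (low_form 0) 1 = 0" "fps_nth (low_form 0) 2 = 0"
    "fps_nth (low_form 4) 1 = 240" "fps_nth (low_form 4) 2 = 2160"
    "fps_nth (low_form 6) 1 = - 504" "fps_nth (low_form 6) 2 = - 16632"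
    by (simp_all add: low_form_def generators generators_Suc_0)
  have 8: "fps_nth (E4 * E4) 0 = 1" "fps_nth (E4 * E4) 1 = 480" "fps_nth (E4 * E4) 2 = 61920"
    unfolding fps_mult_nths generators by simp_all
  have "low_form 8 = E4 * E4" "low_form 10 = E4 * E6" "low_form 14 = E4 * E4 * E6" by (simp_all add: low_form_def)
  note eq = this
  show "fps_nth (low_form 8) 1 = 480" "fps_nth (low_form 8) 2 = 61920" unfolding eq by (rule 8)+
  show "fps_nth (low_form 10) 1 = - 264" "fps_nth (low_form 10) 2 = - 135432"
    unfolding eq fps_mult_nths generators by simp_all
  show "fps_nth (low_form 14) 1 = - 24" "fps_nth (low_form 14) 2 = - 196632"
    unfolding eq fps_mult_nths [of "E4 * E4"] 8 generators by simp_all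
qed

lemma mf_hecke_Delta_power:
  assumes r: "r \<in> residual_weights" and j: "j \<ge> 1"
  shows "mf (12 * j + r) (hecke_Delta_power r j)"
  unfolding hecke_Delta_power_def
  by (intro mf_hecke_int mf_mult mf_power mf_Delta mf_low_form r) (use j in auto)

lemma hecke_Delta_power_1:
  assumes r: "r \<in> residual_weights"
  shows "\<exists>l. [l = root_seq r 1] (mod 13) \<and> comb r 1 l (hecke_Delta_power r 1)"
proof -
  \<comment> \<open>The coefficient of \<open>Delta * low_form r\<close> at 2, which the operator
    moves to index 1.\<close>
  define l where "l = fps_nth (low_form r) 1 - 24"
  have nth: "fps_nth (Delta * low_form r) 0 = 0" "fps_nth (Delta * low_form r) 1 = 1" "fps_nth (Delta * low_form r) 2 = l"
    unfolding fps_mult_nths generators low_form_nth_0 l_def by simp_all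
  have "hecke_Delta_power r 1 = of_int l * basis_form 1 r 1"
  proof (rule mf_valence [OF mf_hecke_Delta_power [OF r] _ r])
    show "mf (12 * 1 + r) (of_int l * basis_form 1 r 1)"
      by (intro mf_of_int_mult mf_basis_form r) simp
    fix i :: nat assume "i \<le> 1"
    hence "i = 0 \<or> i = 1" by auto
    moreover have "basis_form 1 r 1 = Delta * low_form r" by (simp add: basis_form_def)
    ultimately show "fps_nth (hecke_Delta_power r 1) i = fps_nth (of_int l * basis_form 1 r 1) i"
      unfolding hecke_Delta_power_def power_one_right
      by (elim disjE; simp only: hecke_int_2_nths fps_nth_of_int_mult nth; simp)
  qed simp
  hence "comb r 1 l (hecke_Delta_power r 1)" unfolding comb_def by (intro exI [of _ "\<lambda>_. l"]) simp
  moreover have "[l = root_seq r 1] (mod 13)"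
    using r unfolding l_def
    by (elim residual_weightsE; simp only: low_form_nth_1_2; simp add: root_seq_def root_table_def cong_def)
  ultimately show ?thesis by blast
qed

lemma hecke_Delta_power_2:
  assumes r: "r \<in> residual_weights"
  shows "\<exists>l. [l = root_seq r 2] (mod 13) \<and> comb r 2 l (hecke_Delta_power r 2)"
proof -
  \<comment> \<open>Write a1, a2 for the coefficients of \<open>low_form r\<close>. At index 2 the
    image has coefficient a2 - 48 a1 + 1080, and the first basis form, entering with factor 1,
    accounts for a1 + 691 of it.\<close>
  define l where "l = fps_nth (low_form r) 2 - 49 * fps_nth (low_form r) 1 + 389"
  have n2: "fps_nth (Delta ^ 2 * low_form r) 0 = 0" "fps_nth (Delta ^ 2 * low_form r) 1 = 0"
    "fps_nth (Delta ^ 2 * low_form r) 2 = 1"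
    "fps_nth (Delta ^ 2 * low_form r) 4 = fps_nth (low_form r) 2 - 48 * fps_nth (low_form r) 1 + 1080"
    unfolding fps_mult_nths Delta_square_nth low_form_nth_0 by simp_all
  have c: "fps_nth (CC * low_form r) 0 = 1" "fps_nth (CC * low_form r) 1 = fps_nth (low_form r) 1 + 715"
    unfolding fps_mult_nths CC_nth low_form_nth_0 by simp_all
  have n1: "fps_nth (Delta * (CC * low_form r)) 0 = 0" "fps_nth (Delta * (CC * low_form r)) 1 = 1"
    "fps_nth (Delta * (CC * low_form r)) 2 = fps_nth (low_form r) 1 + 691"
    unfolding fps_mult_nths [of Delta] generators c by simp_all
  have b1: "basis_form 2 r 1 = Delta * (CC * low_form r)" and b2: "basis_form 2 r 2 = Delta ^ 2 * low_form r"
    by (simp_all add: basis_form_def)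
  have "hecke_Delta_power r 2 = basis_form 2 r 1 + of_int l * basis_form 2 r 2"
  proof (rule mf_valence [OF mf_hecke_Delta_power [OF r] _ r])
    show "mf (12 * 2 + r) (basis_form 2 r 1 + of_int l * basis_form 2 r 2)"
      by (intro mf_add mf_of_int_mult mf_basis_form r) simp_all
    fix i :: nat assume "i \<le> 2"
    hence "i = 0 \<or> i = 1 \<or> i = 2" by auto
    thus "fps_nth (hecke_Delta_power r 2) i = fps_nth (basis_form 2 r 1 + of_int l * basis_form 2 r 2) i"
      unfolding hecke_Delta_power_def b1 b2
      by (elim disjE; simp only: hecke_int_2_nths fps_nth_of_int_mult fps_add_nth n1 n2; simp add: l_def)
  qed simp
  moreover have "{1..2} = {1, 2::nat}" by auto
  ultimately have "comb r 2 l (hecke_Delta_power r 2)"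
    unfolding comb_def by (intro exI [of _ "\<lambda>i. if i = 1 then 1 else l"]) simp
  moreover have "[l = root_seq r 2] (mod 13)"
    using r unfolding l_def
    by (elim residual_weightsE; simp only: low_form_nth_1_2; simp add: root_seq_def root_table_def cong_def)
  ultimately show ?thesis by blast
qed

lemma cong_recurrence:
  assumes "[l2 = m2] (mod n)" "[l1 = m1] (mod n)" "[l0 = m0] (mod (n::int))"
  shows "[- 48 * l2 - 763 * l1 - l0 = - 48 * m2 - 763 * m1 - m0] (mod n)"
  by (intro cong_diff cong_mult cong_refl assms)

theorem comb_hecke_Delta_power:
  assumes r: "r \<in> residual_weights"
  shows "j \<ge> 1 \<Longrightarrow> \<exists>l. [l = root_seq r j] (mod 13) \<and> comb r j l (hecke_Delta_power r j)"
proof (induction j rule: less_induct)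
  case (less j)
  have "j = 1 \<or> j = 2 \<or> j = 3 \<or> (j - 3 \<ge> 1 \<and> j = (j - 3) + 3)" using less.prems by arith
  then consider "j = 1" | "j = 2" | "j = 3" | i where "i \<ge> 1" "j = i + 3" by blast
  thus ?case
  proof cases
    case 1 thus ?thesis using hecke_Delta_power_1 [OF r] by simp
  next
    case 2 thus ?thesis using hecke_Delta_power_2 [OF r] by simp
  next
    case 3
    obtain l1 where l1: "[l1 = root_seq r 1] (mod 13)" "comb r 1 l1 (hecke_Delta_power r 1)"
      using hecke_Delta_power_1 [OF r] by blast
    obtain l2 where l2: "[l2 = root_seq r 2] (mod 13)" "comb r 2 l2 (hecke_Delta_power r 2)"
      using hecke_Delta_power_2 [OF r] by blast
    define a :: int where "a = 4096 + 2048 * 2 ^ r"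
    have "basis_form 3 r 3 = Delta ^ 3 * low_form r" by (simp add: basis_form_def)
    moreover have "(\<Sum>i=1..3. of_int ((\<lambda>i. if i = 3 then a else 0) i) * basis_form 3 r i) = of_int a * basis_form 3 r 3"
      by (simp add: numeral_3_eq_3)
    ultimately have "comb r 3 a (of_int a * (Delta ^ 3 * low_form r))"
      unfolding comb_def by (intro exI [of _ "\<lambda>i. if i = 3 then a else 0"]) simp
    hence "comb r 3 (- 48 * l2 - 763 * l1 - a) (hecke_Delta_power r 3)"
      unfolding hecke_Delta_power_3 [OF r] a_def [symmetric]
      using comb_hecke_Delta_power_step [of r 0 l2 _ l1 _ a] l1(2) l2(2) by (simp add: numeral_2_eq_2 numeral_3_eq_3)
    moreover have "[- 48 * l2 - 763 * l1 - a = - 48 * root_seq r 2 - 763 * root_seq r 1 - a] (mod 13)"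
      using l2(1) l1(1) by (intro cong_recurrence cong_refl)
    moreover have "[- 48 * root_seq r 2 - 763 * root_seq r 1 - a = root_seq r 3] (mod 13)"
      using r unfolding a_def
      by (elim residual_weightsE; simp add: root_seq_def root_table_def cong_def)
    ultimately show ?thesis using 3 cong_trans by blast
  next
    case (4 i)
    obtain l0 where l0: "[l0 = root_seq r i] (mod 13)" "comb r i l0 (hecke_Delta_power r i)"
      using less.IH [of i] 4 by auto
    obtain l1 where l1: "[l1 = root_seq r (i + 1)] (mod 13)" "comb r (i + 1) l1 (hecke_Delta_power r (i + 1))"
      using less.IH [of "i + 1"] 4 by auto
    obtain l2 where l2: "[l2 = root_seq r (i + 2)] (mod 13)" "comb r (i + 2) l2 (hecke_Delta_power r (i + 2))"
      using less.IH [of "i + 2"] 4 by auto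
    have "comb r (Suc (Suc (Suc i))) (4096 * l0) (of_int 4096 * (Delta * (Delta * (Delta * hecke_Delta_power r i))))"
      using 4(1) l0(2) by (intro comb_scale comb_Delta) auto
    hence "comb r (Suc (Suc (Suc i))) (4096 * l0) (4096 * Delta ^ 3 * hecke_Delta_power r i)"
      by (simp add: power3_eq_cube mult.assoc)
    hence "comb r (i + 3) (- 48 * l2 - 763 * l1 - 4096 * l0) (hecke_Delta_power r (i + 3))"
      unfolding hecke_Delta_power_rec [OF r 4(1)]
      using comb_hecke_Delta_power_step [of r i l2 _ l1] l1(2) l2(2) by (simp add: numeral_2_eq_2 numeral_3_eq_3)
    moreover have "[- 48 * l2 - 763 * l1 - 4096 * l0 =
        - 48 * root_seq r (i + 2) - 763 * root_seq r (i + 1) - 4096 * root_seq r i] (mod 13)"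
      using l2(1) l1(1) l0(1) by (intro cong_recurrence cong_mult cong_refl)
    ultimately show ?thesis using root_seq_rec [OF r 4(1)] 4(2) cong_trans by blast
  qed
qed

section \<open>Cusp forms\<close>

lemma fps_cong_hecke_int:
  assumes FG: "fps_cong 13 F G" and kl: "12 dvd k - l" "l \<le> k" "l \<ge> 1"
  shows "fps_cong 13 (hecke_int 2 k F) (hecke_int 2 l G)"
proof -
  obtain m where "k - l = 12 * m" using kl(1) by blast
  hence "k - 1 = l - 1 + 12 * m" using kl by simp
  hence "(2::int) ^ (k - 1) = 2 ^ (l - 1) * 4096 ^ m" by (simp add: power_add power_mult)
  moreover have "[(4096::int) ^ m = 1 ^ m] (mod 13)" by (intro cong_pow) (simp add: cong_def)
  ultimately have "[(2::int) ^ (k - 1) = 2 ^ (l - 1) * 1] (mod 13)"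
    by (simp only: power_one) (intro cong_mult cong_refl)
  hence "[(2::int) ^ (k - 1) = 2 ^ (l - 1)] (mod 13)" by simp
  thus ?thesis using FG unfolding fps_cong_def hecke_int_nth
    by (auto intro!: cong_add cong_mult)
qed

lemma basis_form_cong:
  assumes "j \<le> d" "j \<le> e"
  shows "fps_cong 13 (basis_form d r j) (basis_form e r j)"
proof -
  have "fps_cong 13 (CC ^ n) (CC ^ m)" for n m
  proof -
    have "fps_cong 13 (CC ^ n) 1" for n using fps_cong_power [OF CC_cong_1, of n] by simp
    thus ?thesis using fps_cong_sym fps_cong_trans by blast
  qed
  thus ?thesis unfolding basis_form_def by (intro fps_cong_mult fps_cong_refl)
qed

text \<open>Modulo 13 the image may be computed in the smaller weight 12 (i + 1) + r, where
  \<open>comb_hecke_Delta_power\<close> gives its coordinates. The difference from the true image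
  has all coefficients divisible by 13, and \<open>basis_form_coeff_dvd\<close> passes this to the
  coordinates.\<close>

lemma hecke_basis_form:
  assumes r: "r \<in> residual_weights" and i: "i < d"
  obtains c :: "nat \<Rightarrow> int" where
    "hecke_int 2 (12 * d + r) (basis_form d r (Suc i)) = (\<Sum>l<d. of_int (c l) * basis_form d r (Suc l))"
    "\<And>l. i < l \<Longrightarrow> l < d \<Longrightarrow> [c l = 0] (mod 13)" "[c i = root_seq r (Suc i)] (mod 13)"
proof -
  let ?j = "Suc i"
  obtain l a where l: "[l = root_seq r ?j] (mod 13)" "a ?j = l"
    "hecke_Delta_power r ?j = (\<Sum>n=1..?j. of_int (a n) * basis_form ?j r n)"
    using comb_hecke_Delta_power [OF r, of ?j] unfolding comb_def by auto
  define F where "F = hecke_int 2 (12 * d + r) (basis_form d r ?j)"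
  define b where "b n = (if n \<le> i then a (Suc n) else 0)" for n
  have "fps_cong 13 (basis_form d r ?j) (basis_form ?j r ?j)"
    using i by (intro basis_form_cong) auto
  moreover have "basis_form ?j r ?j = Delta ^ ?j * low_form r" by (simp add: basis_form_def)
  ultimately have "fps_cong 13 (basis_form d r ?j) (Delta ^ ?j * low_form r)" by simp
  moreover have "12 * d + r - (12 * ?j + r) = 12 * (d - ?j)" using i by simp
  hence "12 dvd (12 * d + r) - (12 * ?j + r)" by (metis dvd_triv_left)
  ultimately have "fps_cong 13 F (hecke_Delta_power r ?j)"
    unfolding F_def hecke_Delta_power_def using i by (intro fps_cong_hecke_int) auto
  also have "hecke_Delta_power r ?j = (\<Sum>n=1..?j. of_int (a n) * basis_form ?j r n)" by (rule l(3))
  finally have 1: "fps_cong 13 F (\<Sum>n=1..?j. of_int (a n) * basis_form ?j r n)" .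
  have "fps_cong 13 (\<Sum>n=1..?j. of_int (a n) * basis_form ?j r n) (\<Sum>n=1..?j. of_int (a n) * basis_form d r n)"
    using i by (intro fps_cong_sum fps_cong_mult fps_cong_refl basis_form_cong) auto
  with 1 have "fps_cong 13 F (\<Sum>n=1..?j. of_int (a n) * basis_form d r n)" by (rule fps_cong_trans)
  also have "(\<Sum>n=1..?j. of_int (a n) * basis_form d r n) = (\<Sum>n\<le>i. of_int (a (Suc n)) * basis_form d r (Suc n))"
    unfolding One_nat_def sum.shift_bounds_cl_Suc_ivl by (simp add: atMost_atLeast0)
  also have "\<dots> = (\<Sum>n<d. of_int (b n) * basis_form d r (Suc n))"
    by (rule sum.mono_neutral_cong_left) (use i in \<open>auto simp: b_def\<close>)
  finally have dvd: "13 dvd fps_nth (F - (\<Sum>n<d. of_int (b n) * basis_form d r (Suc n))) n" for n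
    by (simp add: fps_cong_def cong_iff_dvd_diff)
  have mF: "mf (12 * d + r) F"
    unfolding F_def using i by (intro mf_hecke_int mf_basis_form r) auto
  have "fps_nth F 0 = 0"
    unfolding F_def hecke_int_2_nths by (simp add: basis_form_nth)
  hence "fps_nth (cfps F) 0 = 0" by simp
  then obtain n where n: "cfps F = (\<Sum>i<d. fps_const (n i) * cfps (basis_form d r (Suc i)))"
    by (rule basis_form_spans [OF mF r])
  have "(\<Sum>i<d. fps_const (n i - of_int (b i)) * cfps (basis_form d r (Suc i))) =
        cfps (F - (\<Sum>n<d. of_int (b n) * basis_form d r (Suc n)))"
    unfolding cfps_diff n cfps_sum cfps_mult cfps_of_int
    by (simp add: sum_subtractf [symmetric] algebra_simps flip: fps_const_sub)
  from basis_form_coeff_dvd [OF this dvd]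
  have "\<forall>i\<in>{..<d}. \<exists>z. n i - of_int (b i) = of_int (13 * z)" by simp
  then obtain z where z: "\<And>i. i < d \<Longrightarrow> n i - of_int (b i) = of_int (13 * z i)" by (metis lessThan_iff)
  define c where "c m = b m + 13 * z m" for m
  have nc: "n m = of_int (c m)" if "m < d" for m
    using z [OF that] by (simp add: c_def algebra_simps)
  have "cfps F = cfps (\<Sum>l<d. of_int (c l) * basis_form d r (Suc l))"
    unfolding n cfps_sum cfps_mult cfps_of_int by (intro sum.cong refl) (simp add: nc)
  hence "F = (\<Sum>l<d. of_int (c l) * basis_form d r (Suc l))" by (simp only: cfps_eq_iff)
  moreover have cb: "[c m = b m] (mod 13)" for m by (simp add: c_def cong_iff_dvd_diff)
  have "[c m = 0] (mod 13)" if "i < m" for m using cb [of m] that by (simp add: b_def)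
  moreover have "[c i = root_seq r (Suc i)] (mod 13)"
    using cong_trans [OF cb [of i], of "root_seq r (Suc i)"] l(1,2) by (simp add: b_def)
  ultimately show ?thesis using that [of c] unfolding F_def by blast
qed

section \<open>Power series as cusp forms, and a basis of the space\<close>

definition extend_form :: "complex fps \<Rightarrow> complex \<Rightarrow> complex" where
  "extend_form F z = (if Im z > 0 then qev F z else 0)"

lemma radius_ge_1_cmult: "fps_conv_radius F \<ge> 1 \<Longrightarrow> fps_conv_radius (fps_const c * F) \<ge> 1"
  for F :: "complex fps"
  by (intro radius_ge_1) auto

lemma extend_form_comb:
  assumes "\<And>i. i \<in> I \<Longrightarrow> fps_conv_radius (F i) \<ge> 1"
  shows "extend_form (\<Sum>i\<in>I. fps_const (a i) * F i) = (\<lambda>z. \<Sum>i\<in>I. a i * extend_form (F i) z)"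
proof
  fix z
  have "fps_conv_radius (\<Sum>i\<in>I. fps_const (a i) * F i) \<ge> 1 \<and>
      (Im z > 0 \<longrightarrow> qev (\<Sum>i\<in>I. fps_const (a i) * F i) z = (\<Sum>i\<in>I. a i * qev (F i) z))"
    using assms
    by (induction I rule: infinite_finite_induct) (auto simp: qev_add qev_mult radius_ge_1_cmult intro!: radius_ge_1)
  thus "extend_form (\<Sum>i\<in>I. fps_const (a i) * F i) z = (\<Sum>i\<in>I. a i * extend_form (F i) z)"
    by (simp add: extend_form_def)
qed

lemma extend_form_inject:
  assumes "fps_conv_radius F \<ge> 1" "fps_conv_radius G \<ge> 1" "extend_form F = extend_form G"
  shows "F = G"
proof (rule qev_eqI [OF assms(1,2)])
  fix z :: complex assume "Im z > 0"
  with fun_cong [OF assms(3), of z] show "qev F z = qev G z" by (simp add: extend_form_def)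
qed

text \<open>This links the given definition to power series: from left to right the matrix of the
  inversion is inserted, and from right to left Euclid's algorithm, in
  \<open>modular_fps_moebius\<close>, recovers all unimodular matrices.\<close>

lemma cusp_forms_eq: "cusp_forms k = extend_form ` {F. modular_fps k F \<and> fps_nth F 0 = 0}"
proof (intro equalityI subsetI)
  fix f assume "f \<in> cusp_forms k"
  hence out: "\<And>z. \<not> Im z > 0 \<Longrightarrow> f z = 0"
    and inv: "\<And>a b c d z. a * d - b * c = (1::int) \<Longrightarrow> Im z > 0 \<Longrightarrow>
      f ((of_int a * z + of_int b) / (of_int c * z + of_int d)) = (of_int c * z + of_int d) ^ k * f z"
    and "\<exists>c. c 0 = 0 \<and> (\<forall>z. Im z > 0 \<longrightarrow> (\<lambda>n. c n * exp (2 * of_real pi * \<i> * z) ^ n) sums f z)"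
    unfolding cusp_forms_def upper_half_plane_def by auto
  then obtain c where c: "c 0 = 0" "\<And>z. Im z > 0 \<Longrightarrow> (\<lambda>n. c n * nome z ^ n) sums f z"
    unfolding nome_def by blast
  define F where "F = Abs_fps c"
  have R: "fps_conv_radius F \<ge> 1"
    by (rule radius_ge_1I) (use c(2) in \<open>auto simp: F_def sums_iff\<close>)
  have qF: "qev F z = f z" if "Im z > 0" for z
    using qev_sums [OF R that] c(2) [OF that] by (simp add: F_def sums_iff)
  have "modular_fps k F"
    unfolding modular_fps_def
  proof (intro conjI R allI impI)
    fix z :: complex assume z: "Im z > 0"
    have "f (- 1 / z) = z ^ k * f z" using inv [of 0 0 "-1" 1 z] z by simp
    thus "qev F (- 1 / z) = z ^ k * qev F z"
      using qF [OF z] qF [OF Im_minus_inverse_pos [OF z]] by simp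
  qed
  moreover have "f = extend_form F" using qF out by (auto simp: extend_form_def)
  moreover have "fps_nth F 0 = 0" by (simp add: F_def c)
  ultimately show "f \<in> extend_form ` {F. modular_fps k F \<and> fps_nth F 0 = 0}" by blast
next
  fix f assume "f \<in> extend_form ` {F. modular_fps k F \<and> fps_nth F 0 = 0}"
  then obtain F where F: "modular_fps k F" "fps_nth F 0 = 0" and f: "f = extend_form F" by blast
  have R: "fps_conv_radius F \<ge> 1" by (rule modular_fps_radius [OF F(1)])
  show "f \<in> cusp_forms k"
    unfolding cusp_forms_def upper_half_plane_def
  proof (intro CollectI conjI allI impI ballI)
    show "f z = 0" if "z \<notin> {z. Im z > 0}" for z using that by (simp add: f extend_form_def)
    show "f holomorphic_on {z. Im z > 0}"
      by (rule holomorphic_transform [OF holomorphic_qev [OF R]]) (simp add: f extend_form_def)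
    show "f ((of_int a * z + of_int b) / (of_int c * z + of_int d)) = (of_int c * z + of_int d) ^ k * f z"
      if "a * d - b * c = 1" "z \<in> {z. Im z > 0}" for a b c d :: int and z
      using modular_fps_moebius [OF F(1) _ that(1), of z] Im_moebius_pos [OF _ that(1), of z] that(2)
      by (simp add: f extend_form_def)
    show "\<exists>c. c 0 = 0 \<and> (\<forall>z\<in>{z. Im z > 0}. (\<lambda>n. c n * exp (2 * of_real pi * \<i> * z) ^ n) sums f z)"
      using qev_sums [OF R] F(2)
      by (intro exI [of _ "fps_nth F"]) (simp add: f extend_form_def nome_def)
  qed
qed

lemma hecke_operator_2: "hecke_operator 2 k f = hecke_sum 2 k f"
proof
  fix z
  have "{(a, d). a * d = (2::nat)} = {(1, 2), (2, 1)}"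
  proof -
    have "a * d = 2 \<longleftrightarrow> a = 1 \<and> d = 2 \<or> a = 2 \<and> d = 1" for a d :: nat
    proof
      assume ad: "a * d = 2"
      hence "a dvd 2" by (metis dvd_triv_left)
      hence "a \<le> 2" by (rule dvd_imp_le) simp
      moreover have "a \<noteq> 0"
      proof
        assume "a = 0" with ad show False by simp
      qed
      ultimately have "a = 1 \<or> a = 2" by auto
      thus "a = 1 \<and> d = 2 \<or> a = 2 \<and> d = 1" using ad by auto
    qed auto
    thus ?thesis by auto
  qed
  thus "hecke_operator 2 k f z = hecke_sum 2 k f z"
    unfolding hecke_operator_def hecke_sum_2
    by (simp add: lessThan_nat_numeral lessThan_Suc add_divide_distrib)
qed

lemma hecke_operator_extend:
  assumes R: "fps_conv_radius F \<ge> 1"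
  shows "hecke_operator 2 k (extend_form F) = extend_form (hecke_fps 2 k F)"
proof
  fix z
  show "hecke_operator 2 k (extend_form F) z = extend_form (hecke_fps 2 k F) z"
    using qev_hecke_fps [OF R, of 2 z k]
    by (simp add: hecke_operator_2 hecke_sum_2 extend_form_def Im_divide_numeral)
qed

lemma hecke_operator_linear:
  "hecke_operator 2 k (\<lambda>z. \<Sum>i<n. a i * f i z) = (\<lambda>z. \<Sum>i<(n::nat). a i * hecke_operator 2 k (f i) z)"
  unfolding hecke_operator_2 hecke_sum_2
  by (auto simp: fun_eq_iff sum_divide_distrib sum_distrib_left algebra_simps add_divide_distrib simp flip: sum.distrib)

definition cusp_basis :: "nat \<Rightarrow> nat \<Rightarrow> (complex \<Rightarrow> complex) list" where
  "cusp_basis d r = map (\<lambda>i. extend_form (cfps (basis_form d r (Suc i)))) [0..<d]"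

lemma is_basis_list_cusp_basis:
  assumes r: "r \<in> residual_weights"
  shows "is_basis_list (cusp_basis d r) (cusp_forms (12 * d + r))"
proof -
  let ?f = "\<lambda>i. extend_form (cfps (basis_form d r (Suc i)))"
  let ?k = "12 * d + r"
  have m: "mf ?k (basis_form d r (Suc i))" if "i < d" for i
    using that by (intro mf_basis_form r) simp
  have R: "fps_conv_radius (cfps (basis_form d r (Suc i))) \<ge> 1" if "i < d" for i
    using modular_fps_radius [OF m [OF that]] .
  have inj: "inj_on ?f {..<d}"
  proof (rule linorder_inj_onI)
    fix i j :: nat assume ij: "i < j" "i \<in> {..<d}" "j \<in> {..<d}"
    show "?f i \<noteq> ?f j"
    proof
      assume "?f i = ?f j"
      hence "cfps (basis_form d r (Suc i)) = cfps (basis_form d r (Suc j))"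
        using ij R by (intro extend_form_inject) auto
      hence "basis_form d r (Suc i) = basis_form d r (Suc j)" by simp
      moreover have "fps_nth (basis_form d r (Suc i)) (Suc i) = 1" by (rule basis_form_nth)
      moreover have "fps_nth (basis_form d r (Suc j)) (Suc i) = 0" using ij by (intro basis_form_nth) simp
      ultimately show False by simp
    qed
  qed auto
  have set: "set (cusp_basis d r) = ?f ` {..<d}"
    by (auto simp: cusp_basis_def lessThan_atLeast0)
  have dist: "distinct (cusp_basis d r)"
    unfolding cusp_basis_def distinct_map using inj by (simp add: lessThan_atLeast0)
  have comb: "(\<Sum>v\<in>set (cusp_basis d r). (\<lambda>z. u v * v z)) =
      extend_form (\<Sum>i<d. fps_const (u (?f i)) * cfps (basis_form d r (Suc i)))" for u
  proof -
    have "(\<Sum>v\<in>set (cusp_basis d r). (\<lambda>z. u v * v z)) = (\<Sum>i<d. (\<lambda>z. u (?f i) * ?f i z))"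
      unfolding set by (rule sum.reindex_cong [OF inj refl refl])
    moreover have "extend_form (\<Sum>i<d. fps_const (u (?f i)) * cfps (basis_form d r (Suc i))) =
        (\<lambda>z. \<Sum>i<d. u (?f i) * ?f i z)"
      by (rule extend_form_comb) (use R in simp)
    ultimately show ?thesis by (simp only: cfun_sum_apply)
  qed
  have ind: "cfun.independent (set (cusp_basis d r))"
  proof
    assume "cfun.dependent (set (cusp_basis d r))"
    then obtain u where u: "\<exists>v\<in>set (cusp_basis d r). u v \<noteq> 0"
      "(\<Sum>v\<in>set (cusp_basis d r). (\<lambda>z. u v * v z)) = 0"
      using cfun.dependent_finite [of "set (cusp_basis d r)"] by auto
    have "(\<Sum>i<d. fps_const (u (?f i)) * cfps (basis_form d r (Suc i))) = cfps 0"
    proof (rule extend_form_inject)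
      show "extend_form (\<Sum>i<d. fps_const (u (?f i)) * cfps (basis_form d r (Suc i))) = extend_form (cfps 0)"
        using u(2) unfolding comb by (simp add: extend_form_def [abs_def] fun_eq_iff)
      show "fps_conv_radius (\<Sum>i<d. fps_const (u (?f i)) * cfps (basis_form d r (Suc i))) \<ge> 1"
        by (rule modular_fps_radius [of ?k], rule modular_fps_sum, rule modular_fps_cmult, rule m) simp
    qed simp
    from basis_form_coeff_dvd [OF this, of 0] have "\<forall>i<d. u (?f i) = 0" by auto
    with u(1) show False unfolding set by auto
  qed
  have sub: "cfun.subspace (cusp_forms ?k)"
  proof (rule cfun.subspaceI)
    show "0 \<in> cusp_forms ?k"
      unfolding cusp_forms_eq by (rule image_eqI [of _ _ 0]) (auto simp: extend_form_def fun_eq_iff)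
    fix f g assume "f \<in> cusp_forms ?k" "g \<in> cusp_forms ?k"
    then obtain F G where FG: "modular_fps ?k F" "fps_nth F 0 = 0" "f = extend_form F"
      "modular_fps ?k G" "fps_nth G 0 = 0" "g = extend_form G" unfolding cusp_forms_eq by blast
    show "f + g \<in> cusp_forms ?k"
      unfolding cusp_forms_eq
      by (rule image_eqI [of _ _ "F + G"])
         (use FG in \<open>auto simp: extend_form_def fun_eq_iff qev_add modular_fps_radius intro: modular_fps_add\<close>)
  next
    fix c f assume "f \<in> cusp_forms ?k"
    then obtain F where F: "modular_fps ?k F" "fps_nth F 0 = 0" "f = extend_form F" unfolding cusp_forms_eq by blast
    show "(\<lambda>z. c * f z) \<in> cusp_forms ?k"
      unfolding cusp_forms_eq
      by (rule image_eqI [of _ _ "fps_const c * F"])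
         (use F in \<open>auto simp: extend_form_def fun_eq_iff qev_mult modular_fps_radius intro: modular_fps_cmult\<close>)
  qed
  have in_cusp: "set (cusp_basis d r) \<subseteq> cusp_forms ?k"
    unfolding set cusp_forms_eq using m by (auto simp: basis_form_nth)
  have "cusp_forms ?k \<subseteq> cfun.span (set (cusp_basis d r))"
  proof
    fix f assume "f \<in> cusp_forms ?k"
    then obtain F where F: "modular_fps ?k F" "fps_nth F 0 = 0" "f = extend_form F" unfolding cusp_forms_eq by blast
    obtain c where "F = (\<Sum>i<d. fps_const (c i) * cfps (basis_form d r (Suc i)))"
      using basis_form_spans [OF F(1) r F(2)] .
    hence "f = (\<lambda>z. \<Sum>i<d. c i * ?f i z)"
      using F(3) R extend_form_comb [of "{..<d}" "\<lambda>i. cfps (basis_form d r (Suc i))" c] by simp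
    hence "f = (\<Sum>i<d. (\<lambda>z. c i * ?f i z))" by (simp only: cfun_sum_apply)
    also have "\<dots> \<in> cfun.span (set (cusp_basis d r))"
      by (intro cfun.span_sum cfun.span_scale cfun.span_base) (auto simp: set)
    finally show "f \<in> cfun.span (set (cusp_basis d r))" .
  qed
  moreover have "cfun.span (set (cusp_basis d r)) \<subseteq> cusp_forms ?k"
    by (rule cfun.span_minimal [OF in_cusp sub])
  ultimately show ?thesis using dist ind by (simp add: is_basis_list_def)
qed

lemma cusp_forms_2: "cusp_forms 2 = {\<lambda>z. 0}"
proof -
  have "F = 0" if "modular_fps 2 F" "fps_nth F 0 = 0" for F
    by (rule modular_fps_eq_0_weak [OF that(1), of 1]) (use that in auto)
  hence "{F. modular_fps 2 F \<and> fps_nth F 0 = 0} = {0}" by auto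
  thus ?thesis unfolding cusp_forms_eq by (auto simp: extend_form_def fun_eq_iff)
qed

theorem hecke_char_poly_12:
  assumes r: "r \<in> residual_weights"
  shows "\<exists>P :: int poly. map_poly of_int P = hecke_char_poly 2 (12 * d + r) \<and>
           poly_cong P (\<Prod>j = 1..cusp_dim (12 * d + r). [:- root_seq r j, 1:]) 13"
proof -
  let ?k = "12 * d + r"
  let ?b = "\<lambda>i. basis_form d r (Suc i)"
  have basis: "is_basis_list (cusp_basis d r) (cusp_forms ?k)" by (rule is_basis_list_cusp_basis [OF r])
  have len: "length (cusp_basis d r) = d" by (simp add: cusp_basis_def)
  have nth: "cusp_basis d r ! i = extend_form (cfps (?b i))" if "i < d" for i
    using that by (simp add: cusp_basis_def)
  have dim: "cusp_dim ?k = d"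
    using basis_list_length [OF basis] len by (simp add: cusp_dim_def)
  have R: "fps_conv_radius (cfps (?b i)) \<ge> 1" if "i < d" for i
    using that by (intro modular_fps_radius [of ?k] mf_basis_form r) simp
  define C :: "nat \<Rightarrow> (nat \<Rightarrow> int) \<Rightarrow> bool" where
    "C i c \<longleftrightarrow> hecke_int 2 ?k (?b i) = (\<Sum>l<d. of_int (c l) * ?b l) \<and>
      (\<forall>l. i < l \<longrightarrow> l < d \<longrightarrow> [c l = 0] (mod 13)) \<and> [c i = root_seq r (Suc i)] (mod 13)" for i c
  define N where "N i = (SOME c. C i c)" for i
  have "C i (N i)" if i: "i < d" for i
  proof -
    have "\<exists>c. C i c" unfolding C_def by (rule hecke_basis_form [OF r i]) blast
    thus ?thesis unfolding N_def by (rule someI_ex)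
  qed
  hence N: "\<And>i. i < d \<Longrightarrow> hecke_int 2 ?k (?b i) = (\<Sum>l<d. of_int (N i l) * ?b l)"
    and N0: "\<And>i l. i < d \<Longrightarrow> i < l \<Longrightarrow> l < d \<Longrightarrow> [N i l = 0] (mod 13)"
    and Nd: "\<And>i. i < d \<Longrightarrow> [N i i = root_seq r (Suc i)] (mod 13)"
    unfolding C_def by blast+
  define A where "A = Matrix.mat d d (\<lambda>(l, i). N i l)"
  \<comment> \<open>\<open>A\<close> with 0 below the diagonal and the root sequence on it. Column i
    holds the image of the i-th basis form, which modulo 13 involves only the forms up to index
    i.\<close>
  define U where "U = Matrix.mat d d (\<lambda>(l, i). if i < l then 0 else if i = l then root_seq r (Suc i) else N i l)"
  have A: "A \<in> carrier_mat d d" and U: "U \<in> carrier_mat d d" by (simp_all add: A_def U_def)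
  have act: "hecke_operator 2 ?k (cusp_basis d r ! j) =
      (\<lambda>z. \<Sum>l<d. of_int (N j l) * (cusp_basis d r ! l) z)" if j: "j < d" for j
  proof -
    have "hecke_operator 2 ?k (cusp_basis d r ! j) = extend_form (cfps (hecke_int 2 ?k (?b j)))"
      using j R by (simp add: nth hecke_operator_extend cfps_hecke_int)
    also have "cfps (hecke_int 2 ?k (?b j)) = (\<Sum>l<d. fps_const (of_int (N j l)) * cfps (?b l))"
      unfolding N [OF j] by (simp add: cfps_sum cfps_mult cfps_of_int)
    also have "extend_form \<dots> = (\<lambda>z. \<Sum>l<d. of_int (N j l) * extend_form (cfps (?b l)) z)"
      using R by (intro extend_form_comb) simp
    finally show ?thesis by (simp add: nth)
  qed
  have "hecke_char_poly 2 ?k = char_poly (Matrix.mat d d (\<lambda>(l, i). of_int (N i l)))"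
    unfolding hecke_char_poly_def
    using operator_char_poly_eq [where T = "hecke_operator 2 ?k" and N = "\<lambda>l i. of_int (N i l)", OF basis hecke_operator_linear] act
    by (simp add: len)
  also have "Matrix.mat d d (\<lambda>(l, i). of_int (N i l)) = map_mat of_int A"
    by (rule eq_matI) (auto simp: A_def)
  also have "char_poly \<dots> = map_poly of_int (char_poly A)"
    by (rule of_int_hom.char_poly_hom [OF A])
  finally have 1: "map_poly of_int (char_poly A) = hecke_char_poly 2 ?k" ..
  have "poly_cong (char_poly A) (char_poly U) 13"
  proof (rule char_poly_cong [OF A U])
    fix l i assume "l < d" "i < d"
    thus "[A $$ (l, i) = U $$ (l, i)] (mod 13)"
      using N0 [of i l] Nd [of i] by (auto simp: A_def U_def)
  qed
  also have "char_poly U = (\<Prod>a\<leftarrow>diag_mat U. [:- a, 1:])"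
    by (rule char_poly_upper_triangular [OF U]) (auto simp: U_def upper_triangular_def)
  also have "\<dots> = (\<Prod>i<d. [:- root_seq r (Suc i), 1:])"
  proof -
    have "diag_mat U = map (\<lambda>i. root_seq r (Suc i)) [0..<d]"
      using U by (auto simp: diag_mat_def U_def)
    thus ?thesis by (simp add: o_def prod.distinct_set_conv_list [symmetric] lessThan_atLeast0)
  qed
  also have "\<dots> = (\<Prod>j = 1..d. [:- root_seq r j, 1:])"
    unfolding One_nat_def by (rule prod.atLeast1_atMost_eq [unfolded One_nat_def, symmetric])
  finally show ?thesis using 1 dim by auto
qed

theorem mainTheorem3:
  fixes k :: nat
  assumes "k > 0" and "even k"
  shows "\<exists>P :: int poly. map_poly of_int P = hecke_char_poly 2 k \<and>
           poly_cong P (\<Prod>j = 1..cusp_dim k. [:- root_seq k j, 1:]) 13"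
proof (cases "k = 2")
  case True
  \<comment> \<open>In the form 12 d + r, weight 2 would have r = 14 and d = -1. Its space of cusp
    forms is zero and both polynomials are 1.\<close>
  have "is_basis_list [] (cusp_forms 2)"
    by (simp add: is_basis_list_def cusp_forms_2 cfun.independent_empty fun_eq_iff zero_fun_def)
  from operator_char_poly_eq [where T = "hecke_operator 2 2", OF this hecke_operator_linear] basis_list_length [OF this] True
  have "hecke_char_poly 2 k = char_poly (Matrix.mat 0 0 (\<lambda>(i, j). 0))" "cusp_dim k = 0"
    by (simp_all add: hecke_char_poly_def cusp_dim_def)
  moreover have "char_poly (Matrix.mat 0 0 (\<lambda>(i, j). 0 :: complex)) = 1"
    by (simp add: char_poly_def char_poly_matrix_def det_def)
  ultimately show ?thesis by (intro exI [of _ 1]) (simp add: poly_cong_def)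
next
  case False
  obtain d r where k: "k = 12 * d + r" and r: "r \<in> residual_weights"
  proof (cases "k mod 12 = 2")
    case True
    \<comment> \<open>A weight that is 2 modulo 12 gives up one multiple of 12 to have r = 14; as it
      is not 2 itself, such a multiple exists.\<close>
    with False have "k = 12 * (k div 12 - 1) + 14" by presburger
    thus ?thesis by (rule that) (simp add: residual_weights_def)
  next
    case F: False
    have "k mod 12 \<in> residual_weights"
      unfolding residual_weights_def using F \<open>even k\<close> by simp presburger
    thus ?thesis by (intro that [of "k div 12" "k mod 12"]) simp_all
  qed
  have "root_seq k = root_seq r" by (simp add: k root_seq_def fun_eq_iff)
  thus ?thesis using hecke_char_poly_12 [OF r, of d] by (simp add: k)
qed

end
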